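(* Let $\mathcal{T}$ be a tableau and let $\mathcal{A}=(A,\Omega)$ be a tree with back edges representing $\mathcal{T}$ whose priority assignment $\Omega$ has co-domain $\{0,\dots,q\}$. Then there is a disjunctive formula with alternation depth $\{0,\dots,q\}$ whose tableau is equivalent to $\mathcal{T}$.
   Context: Formulas of the (unimodal) modal $\mu$-calculus $L_\mu$ over propositions $P,Q,\dots$ and fixpoint variables $X,Y,\dots$ are given by $\phi ::= \top \mid \bot \mid P \mid \neg P \mid X \mid \phi\wedge\phi \mid \phi\vee\phi \mid \rightarrow\mathcal{B} \mid \mu X.\phi \mid \nu X.\phi$, where $\mathcal{B}$ is a finite set of formulas and $\rightarrow\mathcal{B}$ means $(\bigwedge_{\phi\in\mathcal{B}}\Diamond\phi)\wedge\Box\bigvee_{\phi\in\mathcal{B}}\phi$; formulas are guarded. Literals are propositions and their negations. Disjunctive formulas: the smallest set $\mathcal{F}$ containing $\top,\bot$ and all literals, closed under $\vee$, under $\mu X.\psi$ and $\nu X.\psi$ for $\psi\in\mathcal{F}$, and containing $\bigwedge\mathcal{A}\wedge\rightarrow\mathcal{B}$ whenever $\mathcal{A}$ is a finite set of literals and $\mathcal{B}\subseteq\mathcal{F}$ is finite. Priority assignment / alternation depth of a formula: a map $\Omega$ from its bound fixpoint variables to $\{0,\dots,n\}$, surjective onto $\{1,\dots,n\}$, with $\Omega(X)$ even for $\nu$-bound and odd for $\mu$-bound variables, and such that if $\Omega(X)<\Omega(Y)$ then $X$ does not occur free in the formula binding $Y$. The alternation depth is the co-domain $\{0,\dots,n\}$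 of such an assignment with least $n$. Tableau of $\Psi$: a tree labelled by sets of subformulas of $\Psi$, root $\{\Psi\}$, built with rules: $\{\Gamma,\psi\wedge\phi\}\to\{\Gamma,\psi,\phi\}$; $\{\Gamma,\psi\vee\phi\}\to\{\Gamma,\psi\}$ and $\{\Gamma,\phi\}$; $\{\Gamma,\sigma X.\phi\}\to\{\Gamma,\phi\}$; $\{\Gamma,X\}\to\{\Gamma,\phi\}$ with $\sigma X.\phi$ the binder of $X$; and, only when no other rule applies, the modal rule giving, for every $\rightarrow\mathcal{B}'\in\Gamma$ and $\psi\in\mathcal{B}'$, a child $\{\psi\}\cup\{\bigvee\mathcal{B}\mid\rightarrow\mathcal{B}\in\Gamma,\mathcal{B}\neq\mathcal{B}'\}$ (no children if the literals are inconsistent). Traces follow formulas along branches according to the rules; a $\mu$-trace is one whose outermost variable regenerated infinitely often is $\mu$-bound; an infinite branch is odd iff it carries a $\mu$-trace. The core of a tableau keeps only branching nodes (consecutive disjunction steps collapsed), typed as modal (with their literals) or disjunctive, with the successor structure and the parity of infinite paths. Tableaus are equivalent if their cores are bisimilar with respect to branching structure, node type, literals at modal nodes and parity of infinite paths. Tree with back edges $(A,\Omega)$: a finite tree with additional back edges (from a node to an ancestor), each node modal (with a set of literals) or disjunctive, with a priority map $\Omega$ from nodes to $\{0,\dots,q\}$; an infinite path through it has the parity of the highest priority seen infinitely often. It represents $\mathcal{T}$ if it is bisimilar to the core of $\mathcal{T}$ with respect to branching structure, node type, literals at modal nodes and parity of infinite paths.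
   Formalization: Alternation depth exactly {0,…,q} fails for non-minimal q (⊤, one node of priority 2); shown: the formula has a priority assignment with co-domain {0,…,q}, and depth exactly {0,…,q} if q is least among trees representing T. Variables count as disjunctive formulas. *)

theory Defs
  imports "HOL-Library.FSet" "HOL-Library.Infinite_Set"
begin

section \<open>Formulas\<close>

text \<open>Fixpoint variables are natural numbers, so that there are infinitely many of them;
  the type of propositions is arbitrary.\<close>

datatype 'p literal = Pos 'p | Neg 'p

datatype 'p fm =
    Top | Bot
  | Lit "'p literal"
  | Var nat
  | And "'p fm" "'p fm"
  | Or "'p fm" "'p fm"
  | Arrow "'p fm fset"
  | Mu nat "'p fm"
  | Nu nat "'p fm"

text \<open>Subformulas, free variables, and free variables with an occurrence
  outside the scope of every modality.\<close>

primrec sf :: "'p fm \<Rightarrow> 'p fm set" where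
  "sf Top = {Top}"
| "sf Bot = {Bot}"
| "sf (Lit l) = {Lit l}"
| "sf (Var X) = {Var X}"
| "sf (And a b) = insert (And a b) (sf a \<union> sf b)"
| "sf (Or a b) = insert (Or a b) (sf a \<union> sf b)"
| "sf (Arrow B) = insert (Arrow B) (\<Union> (fset (sf |`| B)))"
| "sf (Mu X a) = insert (Mu X a) (sf a)"
| "sf (Nu X a) = insert (Nu X a) (sf a)"

primrec fv :: "'p fm \<Rightarrow> nat set" where
  "fv Top = {}"
| "fv Bot = {}"
| "fv (Lit l) = {}"
| "fv (Var X) = {X}"
| "fv (And a b) = fv a \<union> fv b"
| "fv (Or a b) = fv a \<union> fv b"
| "fv (Arrow B) = \<Union> (fset (fv |`| B))"
| "fv (Mu X a) = fv a - {X}"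
| "fv (Nu X a) = fv a - {X}"

primrec unguarded_fv :: "'p fm \<Rightarrow> nat set" where
  "unguarded_fv Top = {}"
| "unguarded_fv Bot = {}"
| "unguarded_fv (Lit l) = {}"
| "unguarded_fv (Var X) = {X}"
| "unguarded_fv (And a b) = unguarded_fv a \<union> unguarded_fv b"
| "unguarded_fv (Or a b) = unguarded_fv a \<union> unguarded_fv b"
| "unguarded_fv (Arrow B) = {}"
| "unguarded_fv (Mu X a) = unguarded_fv a - {X}"
| "unguarded_fv (Nu X a) = unguarded_fv a - {X}"

definition binds :: "nat \<Rightarrow> 'p fm \<Rightarrow> 'p fm \<Rightarrow> bool" where
  "binds X \<phi> \<beta> \<longleftrightarrow> \<beta> = Mu X \<phi> \<or> \<beta> = Nu X \<phi>"

definition bound_vars :: "'p fm \<Rightarrow> nat set" where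
  "bound_vars \<Psi> = {X. \<exists>\<phi>. \<exists>\<beta>\<in>sf \<Psi>. binds X \<phi> \<beta>}"

definition guarded :: "'p fm \<Rightarrow> bool" where
  "guarded \<Psi> \<longleftrightarrow> (\<forall>X \<phi>. \<forall>\<beta>\<in>sf \<Psi>. binds X \<phi> \<beta> \<longrightarrow> X \<notin> unguarded_fv \<phi>)"

text \<open>Every variable has only one binding subformula, so that it makes sense to speak of
  the binder of a variable.\<close>

definition unique_binders :: "'p fm \<Rightarrow> bool" where
  "unique_binders \<Psi> \<longleftrightarrow>
     (\<forall>X \<phi> \<phi>'. \<forall>\<beta>\<in>sf \<Psi>. \<forall>\<beta>'\<in>sf \<Psi>. binds X \<phi> \<beta> \<longrightarrow> binds X \<phi>' \<beta>' \<longrightarrow> \<beta> = \<beta>')"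

definition sentence :: "'p fm \<Rightarrow> bool" where
  "sentence \<Psi> \<longleftrightarrow> fv \<Psi> = {} \<and> guarded \<Psi> \<and> unique_binders \<Psi>"

fun bigand :: "'p fm list \<Rightarrow> 'p fm" where
  "bigand [] = Top"
| "bigand [x] = x"
| "bigand (x # y # zs) = And x (bigand (y # zs))"

fun bigor :: "'p fm list \<Rightarrow> 'p fm" where
  "bigor [] = Bot"
| "bigor [x] = x"
| "bigor (x # y # zs) = Or x (bigor (y # zs))"

text \<open>The disjunction of a finite set is formed along an arbitrary but fixed enumeration.\<close>

definition Disj_set :: "'p fm fset \<Rightarrow> 'p fm" where
  "Disj_set B = bigor (SOME xs. distinct xs \<and> set xs = fset B)"


section \<open>Disjunctive formulas and alternation depth\<close>

text \<open>Fixpoint variables are themselves disjunctive, for otherwise the fixpoint clauses would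
  only produce vacuous fixpoints. An empty conjunction of literals is omitted; a nonempty
  finite set of literals may be enumerated in any order.\<close>

inductive disjunctive :: "'p fm \<Rightarrow> bool" where
  "disjunctive Top"
| "disjunctive Bot"
| "disjunctive (Lit l)"
| "disjunctive (Var X)"
| "disjunctive a \<Longrightarrow> disjunctive b \<Longrightarrow> disjunctive (Or a b)"
| "disjunctive a \<Longrightarrow> disjunctive (Mu X a)"
| "disjunctive a \<Longrightarrow> disjunctive (Nu X a)"
| "(\<And>b. b |\<in>| B \<Longrightarrow> disjunctive b) \<Longrightarrow> disjunctive (Arrow B)"
| "ls \<noteq> [] \<Longrightarrow> (\<And>b. b |\<in>| B \<Longrightarrow> disjunctive b) \<Longrightarrow>
     disjunctive (And (bigand (map Lit ls)) (Arrow B))"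

text \<open>\<open>priority_assignment \<Psi> \<Omega> n\<close>: \<open>\<Omega>\<close>, restricted to the bound variables
  of \<open>\<Psi>\<close>, is a priority assignment with co-domain \<open>{0..n}\<close>.\<close>

definition priority_assignment :: "'p fm \<Rightarrow> (nat \<Rightarrow> nat) \<Rightarrow> nat \<Rightarrow> bool" where
  "priority_assignment \<Psi> \<Omega> n \<longleftrightarrow>
     \<Omega> ` bound_vars \<Psi> \<subseteq> {0..n} \<and> {1..n} \<subseteq> \<Omega> ` bound_vars \<Psi> \<and>
     (\<forall>X \<phi>. Mu X \<phi> \<in> sf \<Psi> \<longrightarrow> odd (\<Omega> X)) \<and>
     (\<forall>X \<phi>. Nu X \<phi> \<in> sf \<Psi> \<longrightarrow> even (\<Omega> X)) \<and>
     (\<forall>X\<in>bound_vars \<Psi>. \<forall>Y\<in>bound_vars \<Psi>. \<Omega> X < \<Omega> Y \<longrightarrow>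
        (\<forall>\<phi>. \<forall>\<beta>\<in>sf \<Psi>. binds Y \<phi> \<beta> \<longrightarrow> X \<notin> fv \<beta>))"

text \<open>The number \<open>n\<close> stands for the alternation depth \<open>{0..n}\<close>.\<close>

definition alternation_depth :: "'p fm \<Rightarrow> nat" where
  "alternation_depth \<Psi> = (LEAST n. \<exists>\<Omega>. priority_assignment \<Psi> \<Omega> n)"


section \<open>Tableaus\<close>

text \<open>A child of a tableau node is addressed by the move leading to it; a node of the tree is
  addressed by the list of moves leading to it from the root. \<open>Modal_move B \<psi>\<close>
  leads to the child of a modal node given by \<open>Arrow B\<close> and \<open>\<psi> |\<in>| B\<close>.\<close>

datatype 'p move = Unary | LeftDisj | RightDisj | Modal_move "'p fm fset" "'p fm"

text \<open>\<open>reduct \<Psi> p m D\<close>: by a non-modal rule applied to the formula \<open>p\<close>, the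
  child in direction \<open>m\<close> has the formulas \<open>D\<close> in the place of \<open>p\<close>.\<close>

inductive reduct :: "'p fm \<Rightarrow> 'p fm \<Rightarrow> 'p move \<Rightarrow> 'p fm set \<Rightarrow> bool" for \<Psi> where
  "reduct \<Psi> (And a b) Unary {a, b}"
| "reduct \<Psi> (Or a b) LeftDisj {a}"
| "reduct \<Psi> (Or a b) RightDisj {b}"
| "reduct \<Psi> (Mu X a) Unary {a}"
| "reduct \<Psi> (Nu X a) Unary {a}"
| "\<beta> \<in> sf \<Psi> \<Longrightarrow> binds X a \<beta> \<Longrightarrow> reduct \<Psi> (Var X) Unary {a}"

definition reducible :: "'p fm \<Rightarrow> 'p fm \<Rightarrow> bool" where
  "reducible \<Psi> p \<longleftrightarrow> (\<exists>m D. reduct \<Psi> p m D)"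

definition literals :: "'p fm set \<Rightarrow> 'p literal set" where
  "literals \<Gamma> = {l. Lit l \<in> \<Gamma>}"

definition consistent :: "'p literal set \<Rightarrow> bool" where
  "consistent L \<longleftrightarrow> (\<nexists>P. Pos P \<in> L \<and> Neg P \<in> L)"

text \<open>\<open>tableau_rule \<Psi> \<Gamma> r m \<Gamma>'\<close>: if the rule \<open>r\<close> is applied to
  \<open>\<Gamma>\<close>, then there is a child in direction \<open>m\<close>, and its label is
  \<open>\<Gamma>'\<close>. Here \<open>r\<close> is \<open>Some p\<close> for the non-modal rule with principal
  formula \<open>p\<close>, and \<open>None\<close> for the modal rule.\<close>

inductive tableau_rule ::
  "'p fm \<Rightarrow> 'p fm set \<Rightarrow> 'p fm option \<Rightarrow> 'p move \<Rightarrow> 'p fm set \<Rightarrow> bool" for \<Psi> where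
  "p \<in> \<Gamma> \<Longrightarrow> reduct \<Psi> p m D \<Longrightarrow> tableau_rule \<Psi> \<Gamma> (Some p) m (\<Gamma> - {p} \<union> D)"
| "consistent (literals \<Gamma>) \<Longrightarrow> Arrow B \<in> \<Gamma> \<Longrightarrow> \<psi> |\<in>| B \<Longrightarrow>
     tableau_rule \<Psi> \<Gamma> None (Modal_move B \<psi>)
       (insert \<psi> {Disj_set B' | B'. Arrow B' \<in> \<Gamma> \<and> B' \<noteq> B})"

fun rule_applicable :: "'p fm \<Rightarrow> 'p fm set \<Rightarrow> 'p fm option \<Rightarrow> bool" where
  "rule_applicable \<Psi> \<Gamma> (Some p) \<longleftrightarrow> p \<in> \<Gamma> \<and> reducible \<Psi> p"
| "rule_applicable \<Psi> \<Gamma> None \<longleftrightarrow> (\<forall>p\<in>\<Gamma>. \<not> reducible \<Psi> p)"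

record 'p tableau =
  formula :: "'p fm"
  nodes :: "'p move list set"
  label :: "'p move list \<Rightarrow> 'p fm set"
  rule :: "'p move list \<Rightarrow> 'p fm option"

definition tableau_of :: "'p fm \<Rightarrow> 'p tableau \<Rightarrow> bool" where
  "tableau_of \<Psi> T \<longleftrightarrow>
     formula T = \<Psi> \<and> [] \<in> nodes T \<and> label T [] = {\<Psi>} \<and>
     (\<forall>u\<in>nodes T. rule_applicable \<Psi> (label T u) (rule T u)) \<and>
     (\<forall>u m. u @ [m] \<in> nodes T \<longleftrightarrow>
        u \<in> nodes T \<and> (\<exists>\<Gamma>'. tableau_rule \<Psi> (label T u) (rule T u) m \<Gamma>')) \<and>
     (\<forall>u\<in>nodes T. \<forall>m \<Gamma>'. tableau_rule \<Psi> (label T u) (rule T u) m \<Gamma>' \<longrightarrow>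
        label T (u @ [m]) = \<Gamma>')"

text \<open>An infinite branch is given by its sequence of moves.\<close>

definition branch_node :: "(nat \<Rightarrow> 'p move) \<Rightarrow> nat \<Rightarrow> 'p move list" where
  "branch_node b n = map b [0..<n]"

definition infinite_branch :: "'p tableau \<Rightarrow> (nat \<Rightarrow> 'p move) \<Rightarrow> bool" where
  "infinite_branch T b \<longleftrightarrow> (\<forall>n. branch_node b n \<in> nodes T)"

inductive trace_step ::
  "'p fm \<Rightarrow> 'p fm option \<Rightarrow> 'p move \<Rightarrow> 'p fm \<Rightarrow> 'p fm \<Rightarrow> bool" for \<Psi> where
  "reduct \<Psi> p m D \<Longrightarrow> \<phi> \<in> D \<Longrightarrow> trace_step \<Psi> (Some p) m p \<phi>"
| "\<phi> \<noteq> p \<Longrightarrow> trace_step \<Psi> (Some p) m \<phi> \<phi>"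
| "trace_step \<Psi> None (Modal_move B \<psi>) (Arrow B) \<psi>"
| "B' \<noteq> B \<Longrightarrow> trace_step \<Psi> None (Modal_move B \<psi>) (Arrow B') (Disj_set B')"

definition is_trace :: "'p tableau \<Rightarrow> (nat \<Rightarrow> 'p move) \<Rightarrow> (nat \<Rightarrow> 'p fm) \<Rightarrow> bool" where
  "is_trace T b t \<longleftrightarrow>
     (\<forall>n. t n \<in> label T (branch_node b n) \<and>
          trace_step (formula T) (rule T (branch_node b n)) (b n) (t n) (t (Suc n)))"

definition regenerated_inf ::
  "'p tableau \<Rightarrow> (nat \<Rightarrow> 'p move) \<Rightarrow> (nat \<Rightarrow> 'p fm) \<Rightarrow> nat \<Rightarrow> bool" where
  "regenerated_inf T b t X \<longleftrightarrow>
     (\<exists>\<^sub>\<infinity>n. t n = Var X \<and> rule T (branch_node b n) = Some (Var X))"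

text \<open>The outermost among the variables regenerated infinitely often is the one whose binder
  has the binders of all the others as subformulas.\<close>

definition mu_trace :: "'p tableau \<Rightarrow> (nat \<Rightarrow> 'p move) \<Rightarrow> (nat \<Rightarrow> 'p fm) \<Rightarrow> bool" where
  "mu_trace T b t \<longleftrightarrow> is_trace T b t \<and>
     (\<exists>X \<phi>. Mu X \<phi> \<in> sf (formula T) \<and> regenerated_inf T b t X \<and>
        (\<forall>Y \<psi>. \<forall>\<beta>\<in>sf (formula T).
           regenerated_inf T b t Y \<longrightarrow> binds Y \<psi> \<beta> \<longrightarrow> \<beta> \<in> sf (Mu X \<phi>)))"

definition odd_branch :: "'p tableau \<Rightarrow> (nat \<Rightarrow> 'p move) \<Rightarrow> bool" where
  "odd_branch T b \<longleftrightarrow> (\<exists>t. mu_trace T b t)"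


section \<open>Graphs with node types and parities of infinite paths\<close>

datatype 'p kind = Disjunctive | Modal "'p literal set"

record ('n, 'p) paritygraph =
  start :: 'n
  kind_of :: "'n \<Rightarrow> 'p kind"
  edge :: "'n \<Rightarrow> 'n \<Rightarrow> bool"
  odd_path :: "(nat \<Rightarrow> 'n) \<Rightarrow> bool"

definition infinite_path :: "('n, 'p) paritygraph \<Rightarrow> (nat \<Rightarrow> 'n) \<Rightarrow> bool" where
  "infinite_path G \<pi> \<longleftrightarrow> \<pi> 0 = start G \<and> (\<forall>n. edge G (\<pi> n) (\<pi> (Suc n)))"

definition bisimilar :: "('n, 'p) paritygraph \<Rightarrow> ('m, 'p) paritygraph \<Rightarrow> bool" where
  "bisimilar G H \<longleftrightarrow>
     (\<exists>R. R (start G) (start H) \<and>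
        (\<forall>x y. R x y \<longrightarrow>
           kind_of G x = kind_of H y \<and>
           (\<forall>x'. edge G x x' \<longrightarrow> (\<exists>y'. edge H y y' \<and> R x' y')) \<and>
           (\<forall>y'. edge H y y' \<longrightarrow> (\<exists>x'. edge G x x' \<and> R x' y'))) \<and>
        (\<forall>\<pi> \<rho>. infinite_path G \<pi> \<longrightarrow> infinite_path H \<rho> \<longrightarrow> (\<forall>n. R (\<pi> n) (\<rho> n)) \<longrightarrow>
           (odd_path G \<pi> \<longleftrightarrow> odd_path H \<rho>)))"


section \<open>The core of a tableau\<close>

definition modal_node :: "'p tableau \<Rightarrow> 'p move list \<Rightarrow> bool" where
  "modal_node T u \<longleftrightarrow> u \<in> nodes T \<and> rule T u = None"

definition disj_node :: "'p tableau \<Rightarrow> 'p move list \<Rightarrow> bool" where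
  "disj_node T u \<longleftrightarrow> u \<in> nodes T \<and> (\<exists>a b. rule T u = Some (Or a b))"

text \<open>The first modal or disjunctive node reached from \<open>u\<close> by non-branching rules;
  it exists for tableaus of guarded formulas.\<close>

definition entry :: "'p tableau \<Rightarrow> 'p move list \<Rightarrow> 'p move list" where
  "entry T u =
     (THE v. (modal_node T v \<or> disj_node T v) \<and> (\<exists>k. v = u @ replicate k Unary))"

text \<open>A successor of a disjunctive node of the core is the modal node at the end of a maximal
  sequence of disjunction steps (interleaved with non-branching ones).\<close>

definition core_edge :: "'p tableau \<Rightarrow> 'p move list \<Rightarrow> 'p move list \<Rightarrow> bool" where
  "core_edge T u v \<longleftrightarrow>
     (modal_node T u \<and>
        (\<exists>B \<psi>. u @ [Modal_move B \<psi>] \<in> nodes T \<and> v = entry T (u @ [Modal_move B \<psi>]))) \<or>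
     (disj_node T u \<and> modal_node T v \<and>
        (\<exists>w. set w \<subseteq> {Unary, LeftDisj, RightDisj} \<and> v = u @ w))"

definition core :: "'p tableau \<Rightarrow> ('p move list, 'p) paritygraph" where
  "core T =
     \<lparr> start = entry T [],
       kind_of = (\<lambda>u. if modal_node T u then Modal (literals (label T u)) else Disjunctive),
       edge = core_edge T,
       odd_path = (\<lambda>\<pi>. \<exists>b. infinite_branch T b \<and>
          (\<forall>n. \<exists>k. \<pi> n = branch_node b k) \<and> odd_branch T b) \<rparr>"

definition tableau_equivalent :: "'p tableau \<Rightarrow> 'p tableau \<Rightarrow> bool" where
  "tableau_equivalent T T' \<longleftrightarrow> bisimilar (core T) (core T')"


section \<open>Trees with back edges\<close>

record ('a, 'p) back_tree =
  vertices :: "'a set"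
  root :: 'a
  tree_edges :: "('a \<times> 'a) set"
  back_edges :: "('a \<times> 'a) set"
  vertex_kind :: "'a \<Rightarrow> 'p kind"

text \<open>A back edge may also lead from a node to itself.\<close>

definition is_back_tree :: "('a, 'p) back_tree \<Rightarrow> bool" where
  "is_back_tree A \<longleftrightarrow>
     finite (vertices A) \<and> root A \<in> vertices A \<and>
     tree_edges A \<subseteq> vertices A \<times> vertices A \<and>
     (\<forall>v\<in>vertices A. (root A, v) \<in> (tree_edges A)\<^sup>*) \<and>
     (\<forall>v. (v, root A) \<notin> tree_edges A) \<and>
     (\<forall>u u' v. (u, v) \<in> tree_edges A \<longrightarrow> (u', v) \<in> tree_edges A \<longrightarrow> u = u') \<and>
     back_edges A \<subseteq> vertices A \<times> vertices A \<and>
     (\<forall>(v, u)\<in>back_edges A. (u, v) \<in> (tree_edges A)\<^sup>*)"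

definition back_tree_graph ::
  "('a, 'p) back_tree \<Rightarrow> ('a \<Rightarrow> nat) \<Rightarrow> ('a, 'p) paritygraph" where
  "back_tree_graph A \<Omega> =
     \<lparr> start = root A,
       kind_of = vertex_kind A,
       edge = (\<lambda>u v. (u, v) \<in> tree_edges A \<union> back_edges A),
       odd_path = (\<lambda>\<pi>. odd (Max {k. \<exists>\<^sub>\<infinity>n. \<Omega> (\<pi> n) = k})) \<rparr>"

text \<open>\<open>represents A \<Omega> q T\<close>: the tree with back edges \<open>(A, \<Omega>)\<close>, whose
  priority assignment has co-domain \<open>{0..q}\<close>, represents \<open>T\<close>.\<close>

definition represents ::
  "('a, 'p) back_tree \<Rightarrow> ('a \<Rightarrow> nat) \<Rightarrow> nat \<Rightarrow> 'p tableau \<Rightarrow> bool" where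
  "represents A \<Omega> q T \<longleftrightarrow>
     is_back_tree A \<and> \<Omega> ` vertices A \<subseteq> {0..q} \<and>
     bisimilar (back_tree_graph A \<Omega>) (core T)"

text \<open>No tree with back edges representing \<open>T\<close> has a smaller co-domain than
  \<open>{0..q}\<close>. Trees with back edges being finite, it suffices to consider those whose
  vertices are natural numbers.\<close>

definition least_codomain :: "'p tableau \<Rightarrow> nat \<Rightarrow> bool" where
  "least_codomain T q \<longleftrightarrow>
     (\<forall>(B :: (nat, 'p) back_tree) \<Omega> q'. represents B \<Omega> q' T \<longrightarrow> q \<le> q')"

end

theory Submission
  imports Defs "HOL-Library.Sublist"
begin

text \<open>The graph underlying \<open>A\<close> is unfolded into a new tree with back edges, whose
  vertices are histories, that is, branches of vertices of \<open>A\<close>: a branch is closed by a back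
  edge to an earlier occurrence of the next vertex \<open>w\<close> as soon as no vertex of higher
  priority than \<open>w\<close> has been seen since. Branches are then finite, because on an infinite
  path a vertex of the highest priority seen infinitely often would close. Reading the new tree
  as a syntax tree, with a \<open>\<mu>\<close>- or \<open>\<nu>\<close>-binder of its own at each history, according to
  the parity of the priority, yields a disjunctive formula in which a variable free in a binder has
  at least the priority of that binder. Hence on an infinite path the outermost variable regenerated
  infinitely often belongs to the vertex of highest priority seen infinitely often. This holds for
  every priority assignment of the formula, so a smaller one would give a tree of histories with
  smaller co-domain representing the same tableau.\<close>

section \<open>Termination of the non-modal rules\<close>

text \<open>Reading \<open>A\<close> itself as a syntax tree would fail: a back edge may lead from
  below a vertex \<open>v\<close> to an ancestor \<open>u\<close> of lower priority, and then the
  variable of \<open>u\<close> is free in the binder of \<open>v\<close>, which a priority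
  assignment forbids. Postponing the loop until nothing higher lies in between removes exactly these
  back edges. The order of rules in a tableau of \<Phi> is not under control, and every tableau of
  \<Phi> has to be treated. What helps is that each label has one relevant formula, apart from
  literals and conjunctions of literals: no label contains two modal formulas, so the rule applied
  is forced and the relevant formulas of the labels along a branch form a trace. Guardedness bounds
  the chains of non-modal steps, so that below each node the core is reached. Nothing makes
  \<open>q\<close> optimal for \<open>T\<close>, hence the alternation depth is claimed to equal
  \<open>q\<close> only under \<open>least_codomain\<close>. That lower bound needs the parity of
  paths for an unknown priority assignment of \<Phi>; it is available because every back edge out of
  a subtree yields a free variable of the corresponding binder, and so an inequality between
  priorities.\<close>

lemma reduct_simps [simp]:
  "\<not> reduct \<Psi> Top m D" "\<not> reduct \<Psi> Bot m D" "\<not> reduct \<Psi> (Lit l) m D" "\<not> reduct \<Psi> (Arrow B) m D"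
  "reduct \<Psi> (And a b) m D \<longleftrightarrow> m = Unary \<and> D = {a, b}"
  "reduct \<Psi> (Or a b) m D \<longleftrightarrow> m = LeftDisj \<and> D = {a} \<or> m = RightDisj \<and> D = {b}"
  "reduct \<Psi> (Mu X a) m D \<longleftrightarrow> m = Unary \<and> D = {a}"
  "reduct \<Psi> (Nu X a) m D \<longleftrightarrow> m = Unary \<and> D = {a}"
  "reduct \<Psi> (Var X) m D \<longleftrightarrow> m = Unary \<and> (\<exists>a. \<exists>\<beta>\<in>sf \<Psi>. binds X a \<beta> \<and> D = {a})"
  by (auto elim: reduct.cases intro: reduct.intros) (erule reduct.cases; auto)+

lemma reducible_simps [simp]:
  "\<not> reducible \<Psi> Top" "\<not> reducible \<Psi> Bot" "\<not> reducible \<Psi> (Lit l)" "\<not> reducible \<Psi> (Arrow B)"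
  "reducible \<Psi> (And a b)" "reducible \<Psi> (Or a b)" "reducible \<Psi> (Mu X a)" "reducible \<Psi> (Nu X a)"
  "reducible \<Psi> (Var X) \<longleftrightarrow> (\<exists>a. \<exists>\<beta>\<in>sf \<Psi>. binds X a \<beta>)"
  by (auto simp: reducible_def)

lemma tableau_rule_simps [simp]:
  "tableau_rule \<Psi> \<Gamma> (Some p) m \<Gamma>' \<longleftrightarrow> p \<in> \<Gamma> \<and> (\<exists>D. reduct \<Psi> p m D \<and> \<Gamma>' = \<Gamma> - {p} \<union> D)"
  "tableau_rule \<Psi> \<Gamma> None m \<Gamma>' \<longleftrightarrow> consistent (literals \<Gamma>) \<and>
     (\<exists>B \<psi>. Arrow B \<in> \<Gamma> \<and> \<psi> |\<in>| B \<and> m = Modal_move B \<psi> \<and>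
        \<Gamma>' = insert \<psi> {Disj_set B' | B'. Arrow B' \<in> \<Gamma> \<and> B' \<noteq> B})"
  by (auto elim: tableau_rule.cases intro: tableau_rule.intros)

lemma sf_refl [simp]: "\<phi> \<in> sf \<phi>"
  by (cases \<phi>) auto

lemma sf_trans: "\<chi> \<in> sf \<phi> \<Longrightarrow> \<phi> \<in> sf \<psi> \<Longrightarrow> \<chi> \<in> sf \<psi>"
  by (induction \<psi>) auto

lemma sf_components:
  "And a b \<in> sf \<Psi> \<Longrightarrow> a \<in> sf \<Psi>" "And a b \<in> sf \<Psi> \<Longrightarrow> b \<in> sf \<Psi>"
  "Or a b \<in> sf \<Psi> \<Longrightarrow> a \<in> sf \<Psi>" "Or a b \<in> sf \<Psi> \<Longrightarrow> b \<in> sf \<Psi>"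
  "Mu X a \<in> sf \<Psi> \<Longrightarrow> a \<in> sf \<Psi>" "Nu X a \<in> sf \<Psi> \<Longrightarrow> a \<in> sf \<Psi>"
  by (erule sf_trans[rotated]; simp)+

lemma sf_Arrow: "Arrow B \<in> sf \<Psi> \<Longrightarrow> b |\<in>| B \<Longrightarrow> b \<in> sf \<Psi>"
  by (erule sf_trans[rotated]) (use sf_refl in fastforce)

lemma size_Arrow: "b |\<in>| B \<Longrightarrow> size b < size (Arrow B)"
proof -
  assume "b |\<in>| B"
  then have "Suc (size b) \<le> (\<Sum>x\<in>fset B. Suc (size x))" by (intro member_le_sum) auto
  then show ?thesis by simp
qed

lemma sf_size: "\<chi> \<in> sf \<phi> \<Longrightarrow> \<chi> = \<phi> \<or> size \<chi> < size \<phi>"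
proof (induction \<phi>)
  case (Arrow B)
  then consider "\<chi> = Arrow B" | b where "b |\<in>| B" "\<chi> \<in> sf b" by auto
  then show ?case
  proof cases
    case 2
    then show ?thesis using Arrow.IH[OF 2] size_Arrow[OF 2(1)] by auto
  qed simp
qed auto

text \<open>Between \<Psi> and the subformula the variable is captured somewhere. The capturing
  binder is strictly larger than the subformula, which gives the order of variables used in
  \<open>settles_Var\<close>.\<close>

lemma binder_of_free_var:
  "\<beta> \<in> sf \<Psi> \<Longrightarrow> Y \<in> fv \<beta> \<Longrightarrow> Y \<notin> fv \<Psi> \<Longrightarrow> \<exists>\<beta>'\<in>sf \<Psi>. \<exists>\<phi>. binds Y \<phi> \<beta>' \<and> \<beta> \<in> sf \<phi>"
proof (induction \<Psi>)
  case (Arrow B)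
  then obtain b where b: "b |\<in>| B" "\<beta> \<in> sf b" by fastforce
  then have "Y \<notin> fv b" using Arrow.prems by auto
  then show ?case using Arrow.IH[OF b Arrow.prems(2)] b(1) by auto
next
  case (Mu Z a) then show ?case by (cases "Y \<in> fv a") (auto simp: binds_def)
next
  case (Nu Z a) then show ?case by (cases "Y \<in> fv a") (auto simp: binds_def)
qed auto

lemma unguarded_fv_subset: "unguarded_fv \<phi> \<subseteq> fv \<phi>"
  by (induction \<phi>) auto

lemma binds_size: "binds X \<phi> \<beta> \<Longrightarrow> size \<phi> < size \<beta>"
  by (auto simp: binds_def)

lemma binds_unique: "unique_binders \<Psi> \<Longrightarrow> \<beta> \<in> sf \<Psi> \<Longrightarrow> \<beta>' \<in> sf \<Psi> \<Longrightarrow>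
    binds X \<phi> \<beta> \<Longrightarrow> binds X \<phi>' \<beta>' \<Longrightarrow> \<beta> = \<beta>' \<and> \<phi> = \<phi>'"
proof -
  assume a: "unique_binders \<Psi>" "\<beta> \<in> sf \<Psi>" "\<beta>' \<in> sf \<Psi>" "binds X \<phi> \<beta>" "binds X \<phi>' \<beta>'"
  then have "\<beta> = \<beta>'" unfolding unique_binders_def by blast
  then show ?thesis using a(4,5) by (auto simp: binds_def)
qed

text \<open>The number bounds the length of all chains of non-modal reducts that start from the
  formula. A counter is used rather than accessibility because its least value later enters a
  numeric weight.\<close>

primrec settles :: "'p fm \<Rightarrow> nat \<Rightarrow> 'p fm \<Rightarrow> bool" where
  "settles \<Psi> 0 p \<longleftrightarrow> \<not> reducible \<Psi> p"
| "settles \<Psi> (Suc n) p \<longleftrightarrow> (\<forall>m D. \<forall>d\<in>D. reduct \<Psi> p m D \<longrightarrow> settles \<Psi> n d)"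

lemma settles_Suc: "settles \<Psi> n p \<Longrightarrow> settles \<Psi> (Suc n) p"
proof (induction n arbitrary: p)
  case 0 then show ?case by (auto simp: reducible_def)
next
  case (Suc n) then show ?case by (auto simp del: settles.simps(1))
qed

lemma settles_mono: "settles \<Psi> n p \<Longrightarrow> n \<le> k \<Longrightarrow> settles \<Psi> k p"
  by (induction k) (auto simp: le_Suc_eq settles_Suc simp del: settles.simps)

lemma settles_two:
  assumes "\<exists>n. settles \<Psi> n a" "\<exists>n. settles \<Psi> n b"
  shows "\<exists>n. settles \<Psi> n a \<and> settles \<Psi> n b"
proof -
  obtain n k where "settles \<Psi> n a" "settles \<Psi> k b" using assms by blast
  then have "settles \<Psi> (max n k) a \<and> settles \<Psi> (max n k) b" by (auto intro: settles_mono)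
  then show ?thesis by blast
qed

text \<open>Below a modality nothing is reduced, so only unguarded variables matter. By guardedness
  the variable of a binder is not unguarded in its body, so the hypothesis passes from the binder to
  the body.\<close>

lemma settles_subformula:
  assumes g: "guarded \<Psi>"
  shows "p \<in> sf \<Psi> \<Longrightarrow> \<forall>X\<in>unguarded_fv p. \<exists>n. settles \<Psi> n (Var X) \<Longrightarrow> \<exists>n. settles \<Psi> n p"
proof (induction p)
  case (And a b)
  then have "a \<in> sf \<Psi>" "b \<in> sf \<Psi>"
    using sf_trans[of a "And a b"] sf_trans[of b "And a b"] by auto
  with And obtain n where "settles \<Psi> n a \<and> settles \<Psi> n b"
    using settles_two[of \<Psi> a b] by auto
  then have "settles \<Psi> (Suc n) (And a b)" by auto
  then show ?case by blast
next
  case (Or a b)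
  then have "a \<in> sf \<Psi>" "b \<in> sf \<Psi>"
    using sf_trans[of a "Or a b"] sf_trans[of b "Or a b"] by auto
  with Or obtain n where "settles \<Psi> n a \<and> settles \<Psi> n b"
    using settles_two[of \<Psi> a b] by auto
  then have "settles \<Psi> (Suc n) (Or a b)" by auto
  then show ?case by blast
next
  case (Mu X a)
  then have "a \<in> sf \<Psi>" "X \<notin> unguarded_fv a"
    using sf_trans[of a "Mu X a"] g by (auto simp: guarded_def binds_def)
  with Mu obtain n where "settles \<Psi> n a" by auto
  then have "settles \<Psi> (Suc n) (Mu X a)" by auto
  then show ?case by blast
next
  case (Nu X a)
  then have "a \<in> sf \<Psi>" "X \<notin> unguarded_fv a"
    using sf_trans[of a "Nu X a"] g by (auto simp: guarded_def binds_def)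
  with Nu obtain n where "settles \<Psi> n a" by auto
  then have "settles \<Psi> (Suc n) (Nu X a)" by auto
  then show ?case by blast
qed (auto intro: exI[of _ 0])

text \<open>Outer variables settle first: a variable free in the binder of \<open>X\<close> is bound further out.\<close>

lemma settles_Var:
  assumes \<Psi>: "sentence \<Psi>"
  shows "\<exists>n. settles \<Psi> n (Var X)"
proof (cases "\<exists>a. \<exists>\<beta>\<in>sf \<Psi>. binds X a \<beta>")
  case False
  then show ?thesis by (auto intro!: exI[of _ 0])
next
  case True
  have main: "\<beta> \<in> sf \<Psi> \<Longrightarrow> binds X a \<beta> \<Longrightarrow> \<exists>n. settles \<Psi> n (Var X)" for X a \<beta>
  proof (induction "size \<Psi> - size \<beta>" arbitrary: X a \<beta> rule: less_induct)
    case less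
    have a: "a \<in> sf \<Psi>" using less.prems sf_trans[of a \<beta> \<Psi>] by (auto simp: binds_def)
    have "\<exists>n. settles \<Psi> n (Var Y)" if Y: "Y \<in> unguarded_fv a" for Y
    proof -
      have "Y \<noteq> X" using \<Psi> less.prems Y by (auto simp: sentence_def guarded_def)
      then have "Y \<in> fv \<beta>" using Y less.prems unguarded_fv_subset[of a] by (auto simp: binds_def)
      then obtain \<beta>' \<phi> where *: "\<beta>' \<in> sf \<Psi>" "binds Y \<phi> \<beta>'" "\<beta> \<in> sf \<phi>"
        using binder_of_free_var[OF less.prems(1), of Y] \<Psi> unfolding sentence_def by auto
      have "size \<beta> < size \<beta>'" using sf_size[OF *(3)] binds_size[OF *(2)] by auto
      moreover have "size \<beta>' \<le> size \<Psi>" using sf_size[OF *(1)] by auto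
      ultimately show ?thesis using less.hyps[OF _ *(1,2)] by simp
    qed
    then obtain n where n: "settles \<Psi> n a"
      using settles_subformula[OF _ a] \<Psi> by (auto simp: sentence_def)
    have "settles \<Psi> (Suc n) (Var X)"
      using n binds_unique[OF _ less.prems(1) _ less.prems(2)] \<Psi> by (auto simp: sentence_def)
    then show ?case by blast
  qed
  from True show ?thesis using main by blast
qed

text \<open>Labels can leave the set of subformulas: the modal rule brings in
  \<open>Disj_set B\<close>, and disjunction steps then leave disjunctions of suffixes. Disjunctions
  of lists of subformulas are closed under all rules, and singleton lists give the subformulas
  themselves.\<close>

definition big_disjuncts :: "'p fm \<Rightarrow> 'p fm set" where
  "big_disjuncts \<Psi> = bigor ` {xs. set xs \<subseteq> sf \<Psi>}"

lemma sf_in_big_disjuncts: "p \<in> sf \<Psi> \<Longrightarrow> p \<in> big_disjuncts \<Psi>"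
  unfolding big_disjuncts_def by (rule image_eqI[of _ _ "[p]"]) auto

lemma settles_bigor: "\<forall>x\<in>set xs. \<exists>n. settles \<Psi> n x \<Longrightarrow> \<exists>n. settles \<Psi> n (bigor xs)"
proof (induction xs rule: bigor.induct)
  case (3 x y zs)
  then obtain n where "settles \<Psi> n x \<and> settles \<Psi> n (bigor (y # zs))"
    using settles_two[of \<Psi> x "bigor (y # zs)"] by auto
  then have "settles \<Psi> (Suc n) (bigor (x # y # zs))" by auto
  then show ?case by blast
qed (auto intro: exI[of _ 0])

lemma settles_big_disjuncts:
  assumes "sentence \<Psi>" "p \<in> big_disjuncts \<Psi>"
  shows "\<exists>n. settles \<Psi> n p"
proof -
  have "\<exists>n. settles \<Psi> n x" if "x \<in> sf \<Psi>" for x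
    using settles_subformula[OF _ that] settles_Var assms(1) by (auto simp: sentence_def)
  then show ?thesis using assms(2) unfolding big_disjuncts_def by (auto intro!: settles_bigor)
qed

lemma reduct_sf: "reduct \<Psi> p m D \<Longrightarrow> p \<in> sf \<Psi> \<Longrightarrow> D \<subseteq> sf \<Psi>"
  by (erule reduct.cases) (auto simp: binds_def dest: sf_components)

lemma reduct_big_disjuncts:
  assumes r: "reduct \<Psi> p m D" and p: "p \<in> big_disjuncts \<Psi>"
  shows "D \<subseteq> big_disjuncts \<Psi>"
proof -
  obtain xs where xs: "p = bigor xs" "set xs \<subseteq> sf \<Psi>" using p by (auto simp: big_disjuncts_def)
  show ?thesis
  proof (cases xs rule: bigor.cases)
    case (2 x)
    then show ?thesis using reduct_sf[OF r] xs sf_in_big_disjuncts by auto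
  next
    case (3 x y zs)
    then have "x \<in> big_disjuncts \<Psi>" using xs sf_in_big_disjuncts[of x \<Psi>] by auto
    moreover have "bigor (y # zs) \<in> big_disjuncts \<Psi>"
      using xs 3 unfolding big_disjuncts_def by (intro imageI) auto
    ultimately show ?thesis using r 3 xs by auto
  qed (use r xs in auto)
qed

lemma Arrow_big_disjuncts: "Arrow B \<in> big_disjuncts \<Psi> \<Longrightarrow> Arrow B \<in> sf \<Psi>"
  unfolding big_disjuncts_def by (auto elim!: bigor.elims[OF sym])

lemma Disj_set_enum: "\<exists>xs. distinct xs \<and> set xs = fset B \<and> Disj_set B = bigor xs"
proof -
  have "\<exists>xs. distinct xs \<and> set xs = fset B" using finite_distinct_list[of "fset B"] by auto
  from someI_ex[OF this] show ?thesis unfolding Disj_set_def by blast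
qed

lemma tableau_rule_big_disjuncts:
  assumes t: "tableau_rule \<Psi> \<Gamma> r m \<Gamma>'" and fin: "finite \<Gamma>" and sub: "\<Gamma> \<subseteq> big_disjuncts \<Psi>"
  shows "finite \<Gamma>' \<and> \<Gamma>' \<subseteq> big_disjuncts \<Psi>"
proof (cases r)
  case (Some p)
  then obtain D where D: "p \<in> \<Gamma>" "reduct \<Psi> p m D" "\<Gamma>' = \<Gamma> - {p} \<union> D" using t by auto
  moreover have "finite D" using D(2) by (cases) auto
  ultimately show ?thesis using reduct_big_disjuncts[OF D(2)] fin sub by auto
next
  case None
  then obtain B \<psi> where B: "Arrow B \<in> \<Gamma>" "\<psi> |\<in>| B"
    and \<Gamma>': "\<Gamma>' = insert \<psi> {Disj_set B' | B'. Arrow B' \<in> \<Gamma> \<and> B' \<noteq> B}"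
    using t by auto
  have "{B'. Arrow B' \<in> \<Gamma>} = Arrow -` \<Gamma>" by auto
  then have "finite {B'. Arrow B' \<in> \<Gamma>}" using fin by (simp add: finite_vimageI inj_def)
  then have "finite \<Gamma>'" unfolding \<Gamma>' by (auto intro: finite_subset[of _ "Disj_set ` {B'. Arrow B' \<in> \<Gamma>}"])
  moreover have *: "x \<in> sf \<Psi>" if "Arrow B' \<in> \<Gamma>" "x |\<in>| B'" for x B'
    using that sub Arrow_big_disjuncts[of B'] sf_Arrow[of B'] by blast
  have "Disj_set B' \<in> big_disjuncts \<Psi>" if "Arrow B' \<in> \<Gamma>" for B'
    using Disj_set_enum[of B'] *[OF that] unfolding big_disjuncts_def by (fastforce simp: image_iff)
  then have "\<Gamma>' \<subseteq> big_disjuncts \<Psi>" unfolding \<Gamma>' using *[OF B] sf_in_big_disjuncts by auto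
  ultimately show ?thesis by blast
qed

definition settling_time :: "'p fm \<Rightarrow> 'p fm \<Rightarrow> nat" where
  "settling_time \<Psi> p = (LEAST n. settles \<Psi> n p)"

text \<open>A rule replaces its principal formula by at most two formulas of smaller settling time.
  Base 3 makes the sum drop strictly, as two terms of at most a third each stay below the old one;
  base 2 could give equality.\<close>

definition label_weight :: "'p fm \<Rightarrow> 'p fm set \<Rightarrow> nat" where
  "label_weight \<Psi> \<Gamma> = (\<Sum>p\<in>\<Gamma>. 3 ^ settling_time \<Psi> p)"

lemma settling_time_reduct:
  assumes \<Psi>: "sentence \<Psi>" and p: "p \<in> big_disjuncts \<Psi>" and r: "reduct \<Psi> p m D" "d \<in> D"
  shows "settling_time \<Psi> d < settling_time \<Psi> p"
proof -
  have s: "settles \<Psi> (settling_time \<Psi> p) p"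
    unfolding settling_time_def using settles_big_disjuncts[OF \<Psi> p] by (auto intro: LeastI)
  then obtain n where n: "settling_time \<Psi> p = Suc n"
    using r by (cases "settling_time \<Psi> p") (auto simp: reducible_def)
  then have "settles \<Psi> n d" using s r by auto
  then show ?thesis using n unfolding settling_time_def by (simp add: Least_le less_Suc_eq_le)
qed

lemma label_weight_decreases:
  assumes \<Psi>: "sentence \<Psi>" and t: "tableau_rule \<Psi> \<Gamma> (Some p) m \<Gamma>'"
    and fin: "finite \<Gamma>" and sub: "\<Gamma> \<subseteq> big_disjuncts \<Psi>"
  shows "label_weight \<Psi> \<Gamma>' < label_weight \<Psi> \<Gamma>"
proof -
  let ?w = "\<lambda>p. 3 ^ settling_time \<Psi> p :: nat"
  from t obtain D where D: "p \<in> \<Gamma>" "reduct \<Psi> p m D" "\<Gamma>' = \<Gamma> - {p} \<union> D" by auto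
  have fD: "finite D" "card D \<le> 2" using D(2) by (cases; simp add: card_insert_if)+
  have d: "3 * ?w d \<le> ?w p" if "d \<in> D" for d
  proof -
    have "settling_time \<Psi> d < settling_time \<Psi> p"
      using settling_time_reduct[OF \<Psi> _ D(2) that] D(1) sub by auto
    then have "3 ^ Suc (settling_time \<Psi> d) \<le> ?w p" by (intro power_increasing) auto
    then show ?thesis by simp
  qed
  have "3 * sum ?w D = (\<Sum>d\<in>D. 3 * ?w d)" by (simp add: sum_distrib_left)
  also have "\<dots> \<le> card D * ?w p" using sum_bounded_above[of D "\<lambda>d. 3 * ?w d" "?w p"] d by simp
  also have "\<dots> \<le> 2 * ?w p" using fD by simp
  finally have "sum ?w D < ?w p" using zero_less_power[of "3::nat" "settling_time \<Psi> p"] by linarith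
  moreover have "sum ?w \<Gamma> = ?w p + sum ?w (\<Gamma> - {p})" using fin D(1) by (simp add: sum.remove)
  moreover have "sum ?w \<Gamma>' \<le> sum ?w (\<Gamma> - {p}) + sum ?w D"
    unfolding D(3) using fin fD sum.union_inter[of "\<Gamma> - {p}" D ?w] by simp
  ultimately show ?thesis unfolding label_weight_def by linarith
qed

section \<open>Nodes, labels and entries of an arbitrary tableau\<close>

lemma tableau_node_iff:
  "tableau_of \<Psi> T \<Longrightarrow> u @ [m] \<in> nodes T \<longleftrightarrow>
     u \<in> nodes T \<and> (\<exists>\<Gamma>'. tableau_rule \<Psi> (label T u) (rule T u) m \<Gamma>')"
  unfolding tableau_of_def by (elim conjE) (erule allE, erule allE, assumption)

lemma tableau_childI:
  assumes "tableau_of \<Psi> T" "u \<in> nodes T" "tableau_rule \<Psi> (label T u) (rule T u) m \<Gamma>'"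
  shows "u @ [m] \<in> nodes T" "label T (u @ [m]) = \<Gamma>'"
proof -
  show "u @ [m] \<in> nodes T" using tableau_node_iff[OF assms(1)] assms by blast
  have "\<forall>u\<in>nodes T. \<forall>m \<Gamma>'. tableau_rule \<Psi> (label T u) (rule T u) m \<Gamma>' \<longrightarrow> label T (u @ [m]) = \<Gamma>'"
    using assms(1) unfolding tableau_of_def by (elim conjE)
  then show "label T (u @ [m]) = \<Gamma>'" using assms by blast
qed

lemma tableau_child:
  assumes "tableau_of \<Psi> T" "u @ [m] \<in> nodes T"
  shows "u \<in> nodes T" "tableau_rule \<Psi> (label T u) (rule T u) m (label T (u @ [m]))"
proof -
  from tableau_node_iff[OF assms(1)] assms(2) obtain \<Gamma>'
    where *: "u \<in> nodes T" "tableau_rule \<Psi> (label T u) (rule T u) m \<Gamma>'" by blast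
  show "u \<in> nodes T" by fact
  show "tableau_rule \<Psi> (label T u) (rule T u) m (label T (u @ [m]))"
    using tableau_childI(2)[OF assms(1) *] *(2) by simp
qed

lemma tableau_prefix_closed: "tableau_of \<Psi> T \<Longrightarrow> u @ v \<in> nodes T \<Longrightarrow> u \<in> nodes T"
  by (induction v rule: rev_induct) (auto simp flip: append_assoc dest: tableau_child(1))

lemma tableau_rule_applicable:
  "tableau_of \<Psi> T \<Longrightarrow> u \<in> nodes T \<Longrightarrow> rule_applicable \<Psi> (label T u) (rule T u)"
  unfolding tableau_of_def by blast

lemma tableau_principal:
  "tableau_of \<Psi> T \<Longrightarrow> u \<in> nodes T \<Longrightarrow> rule T u = Some p \<Longrightarrow> p \<in> label T u \<and> reducible \<Psi> p"
  using tableau_rule_applicable by fastforce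

lemma tableau_root:
  "tableau_of \<Psi> T \<Longrightarrow> formula T = \<Psi>" "tableau_of \<Psi> T \<Longrightarrow> [] \<in> nodes T"
  "tableau_of \<Psi> T \<Longrightarrow> label T [] = {\<Psi>}"
  unfolding tableau_of_def by (elim conjE, assumption)+

lemma tableau_label:
  assumes T: "tableau_of \<Psi> T"
  shows "u \<in> nodes T \<Longrightarrow> finite (label T u) \<and> label T u \<subseteq> big_disjuncts \<Psi>"
proof (induction u rule: rev_induct)
  case Nil
  then show ?case using tableau_root[OF T] sf_in_big_disjuncts[OF sf_refl] by auto
next
  case (snoc m u)
  then show ?case using tableau_rule_big_disjuncts tableau_child[OF T snoc.prems] by blast
qed

lemma label_weight_child:
  assumes "sentence \<Psi>" "tableau_of \<Psi> T" "u @ [m] \<in> nodes T" "rule T u = Some p"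
  shows "label_weight \<Psi> (label T (u @ [m])) < label_weight \<Psi> (label T u)"
  using label_weight_decreases[OF assms(1)] tableau_child[OF assms(2,3)] tableau_label[OF assms(2)]
    assms(4) by metis

abbreviation nonmodal_moves :: "'p move set" where
  "nonmodal_moves \<equiv> {Unary, LeftDisj, RightDisj}"

lemma reduct_nonmodal: "reduct \<Psi> p m D \<Longrightarrow> m \<in> nonmodal_moves"
  by (erule reduct.cases) auto

lemma reaches_modal_node:
  assumes \<Psi>: "sentence \<Psi>" and T: "tableau_of \<Psi> T"
  shows "u \<in> nodes T \<Longrightarrow> \<exists>w. set w \<subseteq> nonmodal_moves \<and> modal_node T (u @ w)"
proof (induction "label_weight \<Psi> (label T u)" arbitrary: u rule: less_induct)
  case less
  show ?case
  proof (cases "rule T u")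
    case None
    then show ?thesis using less.prems by (intro exI[of _ "[]"]) (simp add: modal_node_def)
  next
    case (Some p)
    then have p: "p \<in> label T u" "reducible \<Psi> p" using tableau_principal[OF T less.prems] by auto
    then obtain m D where D: "reduct \<Psi> p m D" by (auto simp: reducible_def)
    then have t: "tableau_rule \<Psi> (label T u) (rule T u) m (label T u - {p} \<union> D)"
      using Some p by auto
    note c = tableau_childI(1)[OF T less.prems t]
    obtain w where "set w \<subseteq> nonmodal_moves" "modal_node T ((u @ [m]) @ w)"
      using less.hyps[OF label_weight_child[OF \<Psi> T c Some] c] by auto
    then show ?thesis using reduct_nonmodal[OF D] by (intro exI[of _ "m # w"]) auto
  qed
qed

lemma entry_exists:
  assumes \<Psi>: "sentence \<Psi>" and T: "tableau_of \<Psi> T"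
  shows "u \<in> nodes T \<Longrightarrow> \<exists>k. modal_node T (u @ replicate k Unary) \<or> disj_node T (u @ replicate k Unary)"
proof (induction "label_weight \<Psi> (label T u)" arbitrary: u rule: less_induct)
  case less
  show ?case
  proof (cases "modal_node T u \<or> disj_node T u")
    case True
    then show ?thesis by (intro exI[of _ 0]) simp
  next
    case False
    then obtain p where p: "rule T u = Some p" "\<nexists>a b. p = Or a b"
      using less.prems by (cases "rule T u") (auto simp: modal_node_def disj_node_def)
    then have q: "p \<in> label T u" "reducible \<Psi> p" using tableau_principal[OF T less.prems] by auto
    then obtain D where D: "reduct \<Psi> p Unary D" using p(2) by (cases p) auto
    then have t: "tableau_rule \<Psi> (label T u) (rule T u) Unary (label T u - {p} \<union> D)"
      using p q by auto
    note c = tableau_childI(1)[OF T less.prems t]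
    obtain k where k: "modal_node T ((u @ [Unary]) @ replicate k Unary) \<or>
        disj_node T ((u @ [Unary]) @ replicate k Unary)"
      using less.hyps[OF label_weight_child[OF \<Psi> T c p(1)] c] by blast
    then show ?thesis by (intro exI[of _ "Suc k"]) simp
  qed
qed

text \<open>This makes \<open>entry\<close> well defined: of two candidates on one chain of unary
  moves, the shorter one would have a unary child.\<close>

lemma no_unary_child:
  assumes "tableau_of \<Psi> T" "modal_node T u \<or> disj_node T u"
  shows "u @ Unary # w \<notin> nodes T"
proof
  assume "u @ Unary # w \<in> nodes T"
  then have "u @ [Unary] \<in> nodes T" using tableau_prefix_closed[OF assms(1), of "u @ [Unary]" w] by simp
  from tableau_child(2)[OF assms(1) this] show False
    using assms(2) by (auto simp: modal_node_def disj_node_def)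
qed

lemma entry_eqI:
  assumes T: "tableau_of \<Psi> T"
    and v: "modal_node T (u @ replicate k Unary) \<or> disj_node T (u @ replicate k Unary)"
  shows "entry T u = u @ replicate k Unary"
  unfolding entry_def
proof (rule the_equality)
  show "(modal_node T (u @ replicate k Unary) \<or> disj_node T (u @ replicate k Unary)) \<and>
     (\<exists>k'. u @ replicate k Unary = u @ replicate k' Unary)" using v by blast
next
  have no: "\<not> i < j"
    if "modal_node T (u @ replicate i Unary) \<or> disj_node T (u @ replicate i Unary)"
      "u @ replicate j Unary \<in> nodes T" for i j
  proof
    assume "i < j"
    then obtain l where "j = i + Suc l" using less_imp_Suc_add by auto
    then have "u @ replicate j Unary = (u @ replicate i Unary) @ Unary # replicate l Unary"
      by (simp add: replicate_add replicate_app_Cons_same)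
    then show False using no_unary_child[OF T that(1)] that(2) by metis
  qed
  fix v' assume *: "(modal_node T v' \<or> disj_node T v') \<and> (\<exists>k. v' = u @ replicate k Unary)"
  then obtain k' where k': "v' = u @ replicate k' Unary" by blast
  have "u @ replicate k' Unary \<in> nodes T" "u @ replicate k Unary \<in> nodes T"
    using * k' v by (auto simp: modal_node_def disj_node_def)
  then have "k' = k" using no[of k k'] no[of k' k] v * k' by (metis linorder_neqE_nat)
  then show "v' = u @ replicate k Unary" using k' by simp
qed

lemma entry_cases:
  assumes "sentence \<Psi>" "tableau_of \<Psi> T" "u \<in> nodes T"
  obtains k where "entry T u = u @ replicate k Unary" "modal_node T (entry T u) \<or> disj_node T (entry T u)"
  using entry_exists[OF assms] entry_eqI[OF assms(2)] by metis

lemma core_edge_node: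
  assumes "sentence \<Psi>" "tableau_of \<Psi> T" "core_edge T u v"
  shows "modal_node T v \<or> disj_node T v"
  using assms(3) entry_cases[OF assms(1,2)] unfolding core_edge_def by blast

lemma disj_node_core_edge:
  assumes "sentence \<Psi>" "tableau_of \<Psi> T" "disj_node T u"
  shows "\<exists>v. core_edge T u v"
proof -
  have "u \<in> nodes T" using assms(3) by (simp add: disj_node_def)
  from reaches_modal_node[OF assms(1,2) this] obtain w
    where "set w \<subseteq> nonmodal_moves" "modal_node T (u @ w)" by blast
  then have "core_edge T u (u @ w)" using assms(3) unfolding core_edge_def by simp
  then show ?thesis ..
qed

section \<open>Bisimulations and the cores of tableaus\<close>

text \<open>The graph of a map that respects edges both ways is composed with the given
  bisimulation; a path of \<open>G\<close> is carried to a path of \<open>H\<close>, where parity is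
  known. The invariant \<open>I\<close> confines the demands to points at which \<open>f\<close> is
  meaningful. In both uses \<open>H\<close> is the graph of \<open>A\<close>, while \<open>G\<close>
  is the core of a tableau of the new formula or its tree of histories.\<close>

lemma bisimilar_via_map:
  assumes bis: "bisimilar H K"
    and start: "I (start G)" "f (start G) = start H"
    and kind: "\<And>x. I x \<Longrightarrow> kind_of G x = kind_of H (f x)"
    and forth: "\<And>x x'. I x \<Longrightarrow> edge G x x' \<Longrightarrow> I x' \<and> edge H (f x) (f x')"
    and backward: "\<And>x y. I x \<Longrightarrow> edge H (f x) y \<Longrightarrow> \<exists>x'. edge G x x' \<and> f x' = y"
    and parity: "\<And>\<pi>. infinite_path G \<pi> \<Longrightarrow> (\<And>n. I (\<pi> n)) \<Longrightarrow> odd_path G \<pi> \<longleftrightarrow> odd_path H (f \<circ> \<pi>)"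
  shows "bisimilar G K"
proof -
  obtain R where R: "R (start H) (start K)"
    and step: "\<And>x y. R x y \<Longrightarrow> kind_of H x = kind_of K y \<and>
           (\<forall>x'. edge H x x' \<longrightarrow> (\<exists>y'. edge K y y' \<and> R x' y')) \<and>
           (\<forall>y'. edge K y y' \<longrightarrow> (\<exists>x'. edge H x x' \<and> R x' y'))"
    and par: "\<And>\<pi> \<rho>. infinite_path H \<pi> \<Longrightarrow> infinite_path K \<rho> \<Longrightarrow> (\<forall>n. R (\<pi> n) (\<rho> n)) \<Longrightarrow>
           odd_path H \<pi> \<longleftrightarrow> odd_path K \<rho>"
    using bis unfolding bisimilar_def by blast
  let ?R = "\<lambda>x y. I x \<and> R (f x) y"
  have "?R (start G) (start K)" using start R by simp
  moreover have "kind_of G x = kind_of K y \<and>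
           (\<forall>x'. edge G x x' \<longrightarrow> (\<exists>y'. edge K y y' \<and> ?R x' y')) \<and>
           (\<forall>y'. edge K y y' \<longrightarrow> (\<exists>x'. edge G x x' \<and> ?R x' y'))" if "?R x y" for x y
    using that step[of "f x" y] kind[of x] forth[of x] backward[of x] by metis
  moreover have "odd_path G \<pi> \<longleftrightarrow> odd_path K \<rho>"
    if "infinite_path G \<pi>" "infinite_path K \<rho>" "\<forall>n. ?R (\<pi> n) (\<rho> n)" for \<pi> \<rho>
  proof -
    have "infinite_path H (f \<circ> \<pi>)" using that start forth unfolding infinite_path_def by auto
    then have "odd_path H (f \<circ> \<pi>) \<longleftrightarrow> odd_path K \<rho>" using par that by auto
    then show ?thesis using parity that by auto
  qed
  ultimately show ?thesis unfolding bisimilar_def by (intro exI[of _ ?R]) blast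
qed

lemma tableau_rule_deterministic:
  assumes "unique_binders \<Psi>" "tableau_rule \<Psi> \<Gamma> r m \<Gamma>'" "tableau_rule \<Psi> \<Gamma> r m \<Gamma>''"
  shows "\<Gamma>' = \<Gamma>''"
proof (cases r)
  case None
  then show ?thesis using assms by auto
next
  case (Some p)
  then obtain D D' where D: "reduct \<Psi> p m D" "reduct \<Psi> p m D'"
    "\<Gamma>' = \<Gamma> - {p} \<union> D" "\<Gamma>'' = \<Gamma> - {p} \<union> D'" using assms by auto
  have "D = D'" using D(1,2)
    by (cases p) (auto dest: binds_unique[OF assms(1)])
  then show ?thesis using D by simp
qed

text \<open>The rule is chosen as a function \<open>r\<close> of the label alone, so that labels can
  be computed by folding along the address, with \<open>None\<close> for addresses outside the tree.
  Unique binders make the variable rule deterministic, without which no single label could satisfy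
  the condition on children.\<close>

lemma tableau_exists:
  fixes \<Psi> :: "'p fm"
  assumes \<Psi>: "unique_binders \<Psi>"
  shows "\<exists>T. tableau_of \<Psi> T"
proof -
  have ex: "\<exists>r. rule_applicable \<Psi> \<Gamma> r" for \<Gamma> :: "'p fm set"
    by (cases "\<exists>p\<in>\<Gamma>. reducible \<Psi> p") (metis rule_applicable.simps)+
  define r where "r \<Gamma> = (SOME r. rule_applicable \<Psi> \<Gamma> r)" for \<Gamma>
  have r: "rule_applicable \<Psi> \<Gamma> (r \<Gamma>)" for \<Gamma> unfolding r_def using someI_ex[OF ex] .
  define step where "step x m = (case x of None \<Rightarrow> None
      | Some \<Gamma> \<Rightarrow> if \<exists>\<Gamma>'. tableau_rule \<Psi> \<Gamma> (r \<Gamma>) m \<Gamma>'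
                   then Some (SOME \<Gamma>'. tableau_rule \<Psi> \<Gamma> (r \<Gamma>) m \<Gamma>') else None)" for x m
  define L where "L u = foldl step (Some {\<Psi>}) u" for u
  have step_Some: "step (Some \<Gamma>) m = Some \<Gamma>'" if "tableau_rule \<Psi> \<Gamma> (r \<Gamma>) m \<Gamma>'" for \<Gamma> m \<Gamma>'
  proof -
    have "(SOME \<Gamma>'. tableau_rule \<Psi> \<Gamma> (r \<Gamma>) m \<Gamma>') = \<Gamma>'"
      using that tableau_rule_deterministic[OF \<Psi>] by (metis someI)
    then show ?thesis using that unfolding step_def by auto
  qed
  define T where "T = \<lparr>formula = \<Psi>, nodes = {u. L u \<noteq> None}, label = (\<lambda>u. the (L u)),
    rule = (\<lambda>u. r (the (L u)))\<rparr>"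
  have L_snoc: "L (u @ [m]) = step (L u) m" for u m unfolding L_def by simp
  have "tableau_of \<Psi> T" unfolding tableau_of_def
  proof (intro conjI ballI allI impI)
    show "formula T = \<Psi>" "[] \<in> nodes T" "label T [] = {\<Psi>}" unfolding T_def L_def by auto
    show "rule_applicable \<Psi> (label T u) (rule T u)" for u unfolding T_def using r by simp
    show "(u @ [m] \<in> nodes T) =
        (u \<in> nodes T \<and> (\<exists>\<Gamma>'. tableau_rule \<Psi> (label T u) (rule T u) m \<Gamma>'))" for u m
      unfolding T_def by (auto simp: L_snoc step_def split: option.splits)
    show "label T (u @ [m]) = \<Gamma>'"
      if "u \<in> nodes T" "tableau_rule \<Psi> (label T u) (rule T u) m \<Gamma>'" for u m \<Gamma>'
      using that step_Some unfolding T_def by (auto simp: L_snoc)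
  qed
  then show ?thesis ..
qed

text \<open>These properties hold for the core of a tableau; there a disjunctive node has a
  successor because the formula is guarded.\<close>

locale core_like_graph =
  fixes vs :: "'a set" and succ :: "'a \<Rightarrow> 'a set" and kind :: "'a \<Rightarrow> 'p kind"
    and \<Omega> :: "'a \<Rightarrow> nat" and r :: 'a and q :: nat
  assumes finite_vs: "finite vs" and r_vs: "r \<in> vs" and succ_vs: "succ x \<subseteq> vs"
    and \<Omega>_le: "x \<in> vs \<Longrightarrow> \<Omega> x \<le> q"
    and finite_literals: "x \<in> vs \<Longrightarrow> kind x = Modal L \<Longrightarrow> finite L"
    and consistent_literals: "x \<in> vs \<Longrightarrow> kind x = Modal L \<Longrightarrow> y \<in> succ x \<Longrightarrow> consistent L"
    and disj_succ: "x \<in> vs \<Longrightarrow> kind x = Disjunctive \<Longrightarrow> succ x \<noteq> {}"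
    and disj_succ_modal: "x \<in> vs \<Longrightarrow> kind x = Disjunctive \<Longrightarrow> y \<in> succ x \<Longrightarrow> kind y \<noteq> Disjunctive"

text \<open>Every vertex is reachable from the root and hence related to some node of the core,
  whose local properties it inherits. Consistency of the literals is inherited only in the presence
  of a successor, since the modal rule has no children otherwise.\<close>

lemma represents_core_like:
  assumes \<Psi>: "sentence \<Psi>" and T: "tableau_of \<Psi> T" and rep: "represents A \<Omega> q T"
  shows "core_like_graph (vertices A) (\<lambda>x. {y. (x, y) \<in> tree_edges A \<union> back_edges A})
    (vertex_kind A) \<Omega> (root A) q"
proof -
  let ?E = "tree_edges A \<union> back_edges A"
  have A: "finite (vertices A)" "root A \<in> vertices A" "?E \<subseteq> vertices A \<times> vertices A"
    "\<And>v. v \<in> vertices A \<Longrightarrow> (root A, v) \<in> (tree_edges A)\<^sup>*" "\<Omega> ` vertices A \<subseteq> {0..q}"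
    using rep unfolding represents_def is_back_tree_def by auto
  have "bisimilar (back_tree_graph A \<Omega>) (core T)" using rep unfolding represents_def by simp
  then obtain R where R: "R (root A) (entry T [])"
    and R_step: "\<And>x y. R x y \<Longrightarrow> vertex_kind A x = kind_of (core T) y \<and>
           (\<forall>x'. (x, x') \<in> ?E \<longrightarrow> (\<exists>y'. core_edge T y y' \<and> R x' y')) \<and>
           (\<forall>y'. core_edge T y y' \<longrightarrow> (\<exists>x'. (x, x') \<in> ?E \<and> R x' y'))"
    unfolding bisimilar_def back_tree_graph_def core_def by auto
  have core_node: "\<exists>u. R v u \<and> (modal_node T u \<or> disj_node T u)" if "v \<in> vertices A" for v
    using A(4)[OF that]
  proof (induction rule: rtrancl_induct)
    case base
    then show ?case using R entry_cases[OF \<Psi> T tableau_root(2)[OF T]] by metis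
  next
    case (step y z)
    then show ?case using R_step[of y] core_edge_node[OF \<Psi> T] by (metis UnI1)
  qed
  have modal: "modal_node T u \<and> L = literals (label T u)" if "R x u" "vertex_kind A x = Modal L" for x u L
    using R_step[OF that(1)] that(2) by (auto simp: core_def split: if_splits)
  have disj: "disj_node T u" if "R x u" "vertex_kind A x = Disjunctive"
    "modal_node T u \<or> disj_node T u" for x u
    using R_step[OF that(1)] that(2,3) by (auto simp: core_def split: if_splits)
  show ?thesis
  proof
    show "finite (vertices A)" "root A \<in> vertices A" by fact+
    show "{y. (x, y) \<in> ?E} \<subseteq> vertices A" for x using A(3) by blast
    show "\<Omega> x \<le> q" if "x \<in> vertices A" for x using A(5) that by auto
  next
    fix x L assume x: "x \<in> vertices A" "vertex_kind A x = Modal L"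
    obtain u where u: "R x u" "modal_node T u \<or> disj_node T u" using core_node[OF x(1)] by blast
    have m: "modal_node T u" "L = literals (label T u)" using modal[OF u(1) x(2)] by auto
    have "finite (label T u)" using tableau_label[OF T] m(1) unfolding modal_node_def by blast
    then have "finite (Lit -` label T u)" by (simp add: finite_vimageI inj_def)
    then show "finite L" unfolding m(2) literals_def by (simp add: vimage_def)
    fix y assume "y \<in> {y. (x, y) \<in> ?E}"
    then obtain v where "core_edge T u v" using R_step[OF u(1)] by auto
    then obtain B \<psi> where "u @ [Modal_move B \<psi>] \<in> nodes T"
      using m(1) unfolding core_edge_def disj_node_def modal_node_def by auto
    from tableau_child(2)[OF T this] show "consistent L"
      using m unfolding modal_node_def by simp
  next
    fix x assume x: "x \<in> vertices A" "vertex_kind A x = Disjunctive"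
    obtain u where u: "R x u" "modal_node T u \<or> disj_node T u" using core_node[OF x(1)] by blast
    have d: "disj_node T u" using disj[OF u(1) x(2) u(2)] .
    show "{y. (x, y) \<in> ?E} \<noteq> {}" using disj_node_core_edge[OF \<Psi> T d] R_step[OF u(1)] by auto
    fix y assume "y \<in> {y. (x, y) \<in> ?E}"
    then obtain v where v: "core_edge T u v" "R y v" using R_step[OF u(1)] by auto
    then have "modal_node T v" using d unfolding core_edge_def disj_node_def modal_node_def by auto
    then show "vertex_kind A y \<noteq> Disjunctive" using R_step[OF v(2)] by (auto simp: core_def)
  qed
qed

section \<open>Histories and the disjunctive formula\<close>

definition bnd :: "nat \<Rightarrow> nat \<Rightarrow> 'p fm \<Rightarrow> 'p fm" where
  "bnd k X \<phi> = (if odd k then Mu X \<phi> else Nu X \<phi>)"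

lemma bnd_simps [simp]:
  "sf (bnd k X \<phi>) = insert (bnd k X \<phi>) (sf \<phi>)" "fv (bnd k X \<phi>) = fv \<phi> - {X}"
  "unguarded_fv (bnd k X \<phi>) = unguarded_fv \<phi> - {X}"
  "binds Y \<psi> (bnd k X \<phi>) \<longleftrightarrow> Y = X \<and> \<psi> = \<phi>"
  "bnd k X \<phi> \<noteq> Or a b" "bnd k X \<phi> \<noteq> And a b" "bnd k X \<phi> \<noteq> Var Y" "bnd k X \<phi> \<noteq> Lit l" "bnd k X \<phi> \<noteq> Arrow B"
  "reduct \<Psi> (bnd k X \<phi>) m D \<longleftrightarrow> m = Unary \<and> D = {\<phi>}"
  "reducible \<Psi> (bnd k X \<phi>)"
  by (auto simp: bnd_def binds_def)

lemma disjunctive_bnd: "disjunctive \<phi> \<Longrightarrow> disjunctive (bnd k X \<phi>)"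
  by (auto simp: bnd_def intro: disjunctive.intros)

definition literal_list :: "'p literal set \<Rightarrow> 'p literal list" where
  "literal_list L = (SOME ls. set ls = L)"

lemma set_literal_list: "finite L \<Longrightarrow> set (literal_list L) = L"
  unfolding literal_list_def using finite_list[of L] by (rule someI_ex)

text \<open>The case without literals is separate because \<open>disjunctive\<close> admits a
  conjunction only for a nonempty list of literals.\<close>

definition node_formula :: "'p kind \<Rightarrow> 'p fm list \<Rightarrow> 'p fm" where
  "node_formula k cs = (case k of Disjunctive \<Rightarrow> bigor cs
     | Modal L \<Rightarrow> if literal_list L = [] then Arrow (fset_of_list cs)
         else And (bigand (map Lit (literal_list L))) (Arrow (fset_of_list cs)))"

lemma bigand_Lit_sf: "\<beta> \<in> sf (bigand (map Lit ls)) \<Longrightarrow> \<not> binds X \<phi> \<beta>"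
  by (induction ls rule: induct_list012) (auto simp: binds_def)

lemma bigand_Lit_fv [simp]: "fv (bigand (map Lit ls)) = {}" "unguarded_fv (bigand (map Lit ls)) = {}"
  by (induction ls rule: induct_list012) auto

lemma bigor_sf: "\<beta> \<in> sf (bigor cs) \<Longrightarrow> binds X \<phi> \<beta> \<Longrightarrow> \<exists>c\<in>set cs. \<beta> \<in> sf c"
  by (induction cs rule: bigor.induct) (auto simp: binds_def)

lemma bigor_fv: "fv (bigor cs) = (\<Union>c\<in>set cs. fv c)"
  "unguarded_fv (bigor cs) = (\<Union>c\<in>set cs. unguarded_fv c)"
  by (induction cs rule: bigor.induct) auto

lemma sf_bigor: "c \<in> set cs \<Longrightarrow> sf c \<subseteq> sf (bigor cs)"
  by (induction cs rule: bigor.induct) auto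

lemma disjunctive_bigor: "(\<And>c. c \<in> set cs \<Longrightarrow> disjunctive c) \<Longrightarrow> disjunctive (bigor cs)"
  by (induction cs rule: bigor.induct) (auto intro: disjunctive.intros)

lemma node_formula_sf:
  "\<beta> \<in> sf (node_formula k cs) \<Longrightarrow> binds X \<phi> \<beta> \<Longrightarrow> \<exists>c\<in>set cs. \<beta> \<in> sf c"
  by (auto simp: node_formula_def fset_of_list.rep_eq bigand_Lit_sf dest: bigor_sf
      split: kind.splits if_splits) (auto simp: binds_def)

lemma sf_node_formula: "c \<in> set cs \<Longrightarrow> sf c \<subseteq> sf (node_formula k cs)"
  using sf_bigor[of c cs] by (auto simp: node_formula_def fset_of_list.rep_eq split: kind.splits)

lemma node_formula_fv: "fv (node_formula k cs) = (\<Union>c\<in>set cs. fv c)"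
  by (auto simp: node_formula_def fset_of_list.rep_eq bigor_fv split: kind.splits)

lemma unguarded_fv_node_formula:
  "unguarded_fv (node_formula k cs) = (if k = Disjunctive then \<Union>c\<in>set cs. unguarded_fv c else {})"
  by (auto simp: node_formula_def bigor_fv split: kind.splits)

lemma disjunctive_node_formula:
  "(\<And>c. c \<in> set cs \<Longrightarrow> disjunctive c) \<Longrightarrow> disjunctive (node_formula k cs)"
  by (auto simp: node_formula_def fset_of_list.rep_eq intro!: disjunctive.intros disjunctive_bigor
      split: kind.splits)

text \<open>The number \<open>Suc k\<close> is both the variable and its intended priority, so that
  the parity of the binder is right. Around a closed formula all layers are closed, so they add no
  condition on free variables.\<close>

primrec vacuous :: "nat \<Rightarrow> 'p fm \<Rightarrow> 'p fm" where
  "vacuous 0 \<phi> = \<phi>"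
| "vacuous (Suc k) \<phi> = bnd (Suc k) (Suc k) (vacuous k \<phi>)"

lemma sf_vacuous: "\<beta> \<in> sf (vacuous k \<phi>) \<longleftrightarrow> \<beta> \<in> sf \<phi> \<or> (\<exists>j<k. \<beta> = vacuous (Suc j) \<phi>)"
  by (induction k) (auto simp: less_Suc_eq)

lemma fv_vacuous: "fv (vacuous k \<phi>) \<subseteq> fv \<phi>"
  by (induction k) auto

lemma disjunctive_vacuous: "disjunctive \<phi> \<Longrightarrow> disjunctive (vacuous k \<phi>)"
  by (induction k) (auto intro: disjunctive_bnd)

context core_like_graph
begin

text \<open>The list is not a singleton, so that the formula of a disjunctive node is a proper
  disjunction; a unique successor is repeated.\<close>

definition succs :: "'a \<Rightarrow> 'a list" where
  "succs x = (SOME xs. set xs = succ x \<and> length xs \<noteq> 1)"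

lemma succs: "set (succs x) = succ x" "length (succs x) \<noteq> 1"
proof -
  have "finite (succ x)" using finite_vs succ_vs finite_subset by blast
  then obtain xs where xs: "set xs = succ x" using finite_list by blast
  \<comment> \<open>Doubling keeps the set and makes the length even, hence different from
    1.\<close>
  have "set (xs @ xs) = succ x \<and> length (xs @ xs) \<noteq> 1" using xs by auto presburger
  then have "\<exists>xs. set xs = succ x \<and> length xs \<noteq> 1" by blast
  from someI_ex[OF this] show "set (succs x) = succ x" "length (succs x) \<noteq> 1"
    unfolding succs_def by blast+
qed

text \<open>A history is the list of the vertices on a branch of the syntax tree. The branch is
  closed by a back edge as soon as the next vertex \<open>w\<close> occurs in the history and
  dominates everything seen since.\<close>

definition loops_to :: "'a list \<Rightarrow> 'a \<Rightarrow> 'a list \<Rightarrow> bool" where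
  "loops_to h w g \<longleftrightarrow> g \<noteq> [] \<and> last g = w \<and> (\<exists>zs. h = g @ zs \<and> (\<forall>x\<in>set zs. \<Omega> x \<le> \<Omega> w))"

definition loops :: "'a list \<Rightarrow> 'a \<Rightarrow> bool" where
  "loops h w \<longleftrightarrow> (\<exists>g. loops_to h w g)"

text \<open>Several earlier occurrences of \<open>w\<close> may qualify; any fixed choice will do.
  In both cases the new history ends in \<open>w\<close>, which is why \<open>last\<close> maps
  paths of histories to paths of the given graph.\<close>

definition next_hist :: "'a list \<Rightarrow> 'a \<Rightarrow> 'a list" where
  "next_hist h w = (if loops h w then SOME g. loops_to h w g else h @ [w])"

lemma next_hist_loops: "loops h w \<Longrightarrow> loops_to h w (next_hist h w)"
  unfolding next_hist_def loops_def by (auto intro: someI)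

lemma next_hist_new: "\<not> loops h w \<Longrightarrow> next_hist h w = h @ [w]"
  unfolding next_hist_def by simp

lemma last_next_hist [simp]: "last (next_hist h w) = w"
  using next_hist_loops[of h w] next_hist_new[of h w] by (cases "loops h w") (auto simp: loops_to_def)

definition hist_ext :: "('a list \<times> 'a list) set" where
  "hist_ext = {(h @ [w], h) | h w. w \<in> succ (last h) \<and> \<not> loops h w}"

lemma wf_hist_ext: "wf hist_ext"
  unfolding wf_iff_no_infinite_down_chain
proof
  assume "\<exists>f. \<forall>i. (f (Suc i), f i) \<in> hist_ext"
  then obtain f where f: "\<forall>i. (f (Suc i), f i) \<in> hist_ext" ..
  have "\<forall>i. \<exists>w. f (Suc i) = f i @ [w] \<and> w \<in> vs \<and> \<not> loops (f i) w"
  proof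
    fix i
    show "\<exists>w. f (Suc i) = f i @ [w] \<and> w \<in> vs \<and> \<not> loops (f i) w"
      using f[rule_format, of i] succ_vs unfolding hist_ext_def by blast
  qed
  then obtain w where f: "\<And>i. f (Suc i) = f i @ [w i]" and w: "\<And>i. w i \<in> vs"
    and nl: "\<And>i. \<not> loops (f i) (w i)" by metis
  have f_seg: "i \<le> j \<Longrightarrow> f j = f i @ map w [i..<j]" for i j
    by (induction j) (auto simp: f le_Suc_eq)
  define I where "I = {x \<in> vs. infinite {i. w i = x}}"
  have "(\<Union>x\<in>vs. {i. w i = x}) = UNIV" using w by auto
  then have "infinite (\<Union>x\<in>vs. {i. w i = x})" by simp
  then have "I \<noteq> {}" unfolding I_def using finite_vs by auto
  moreover have "finite I" unfolding I_def using finite_vs by simp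
  ultimately have "Max (\<Omega> ` I) \<in> \<Omega> ` I" by simp
  then obtain x where x: "x \<in> I" "\<Omega> x = Max (\<Omega> ` I)" by auto
  have max: "\<Omega> y \<le> \<Omega> x" if "y \<in> I" for y using that x(2) \<open>finite I\<close> by simp
  \<comment> \<open>As \<open>x\<close> has the highest priority among the vertices that occur
    infinitely often, all higher ones die out; from \<open>N\<close> on none is seen.\<close>
  have "{i. \<Omega> x < \<Omega> (w i)} \<subseteq> (\<Union>y\<in>vs - I. {i. w i = y})" using w max by fastforce
  moreover have "finite (\<Union>y\<in>vs - I. {i. w i = y})" using finite_vs unfolding I_def by auto
  ultimately have "finite {i. \<Omega> x < \<Omega> (w i)}" by (rule finite_subset)
  then obtain N where N: "\<forall>i\<in>{i. \<Omega> x < \<Omega> (w i)}. i < N" using finite_nat_set_iff_bounded by blast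
  have inf: "infinite {i. w i = x}" using x unfolding I_def by simp
  then obtain i where i: "N < i" "w i = x" unfolding infinite_nat_iff_unbounded by blast
  from inf obtain j where j: "i < j" "w j = x" unfolding infinite_nat_iff_unbounded by blast
  \<comment> \<open>Here \<open>i\<close> and \<open>j\<close> are two occurrences of
    \<open>x\<close> after \<open>N\<close>. The vertex \<open>w i\<close> is appended on the way
    from \<open>f i\<close> to \<open>f (Suc i)\<close>, so \<open>f (Suc i)\<close> is the prefix
    that ends in it.\<close>
  have "loops_to (f j) (w j) (f (Suc i))" unfolding loops_to_def
  proof (intro conjI exI)
    show "f (Suc i) \<noteq> []" "last (f (Suc i)) = w j" using f i j by auto
    show "f j = f (Suc i) @ map w [Suc i..<j]" using f_seg[of "Suc i" j] j by simp
    have "\<Omega> (w l) \<le> \<Omega> x" if "Suc i \<le> l" for l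
      using N[rule_format, of l] i(1) that by (cases "\<Omega> x < \<Omega> (w l)") auto
    then show "\<forall>x\<in>set (map w [Suc i..<j]). \<Omega> x \<le> \<Omega> (w j)" using j by auto
  qed
  then show False using nl[of j] unfolding loops_def by blast
qed

inductive_set hists :: "'a list set" where
  root: "[r] \<in> hists"
| ext: "h \<in> hists \<Longrightarrow> w \<in> succ (last h) \<Longrightarrow> \<not> loops h w \<Longrightarrow> h @ [w] \<in> hists"

lemma hists_not_Nil: "h \<in> hists \<Longrightarrow> h \<noteq> []"
  by (erule hists.cases) auto

lemma root_prefix: "h \<in> hists \<Longrightarrow> prefix [r] h"
  by (induction rule: hists.induct) auto

lemma last_hists: "h \<in> hists \<Longrightarrow> last h \<in> vs"
  by (induction rule: hists.induct) (use r_vs succ_vs in auto)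

lemma hists_prefix: "h \<in> hists \<Longrightarrow> prefix g h \<Longrightarrow> g \<noteq> [] \<Longrightarrow> g \<in> hists"
  by (induction arbitrary: g rule: hists.induct) (auto intro: hists.intros simp: prefix_Cons)

lemma hists_snoc: "h @ [w] \<in> hists \<Longrightarrow> h \<noteq> [] \<Longrightarrow> h \<in> hists \<and> w \<in> succ (last h) \<and> \<not> loops h w"
  by (erule hists.cases) auto

lemma loops_to_prefix: "loops_to h w g \<Longrightarrow> prefix g h \<and> g \<noteq> []"
  unfolding loops_to_def by auto

lemma next_hist_in: "h \<in> hists \<Longrightarrow> w \<in> succ (last h) \<Longrightarrow> next_hist h w \<in> hists"
  using next_hist_loops[of h w] next_hist_new[of h w] hists_prefix loops_to_prefix
  by (cases "loops h w") (auto intro: hists.ext)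

text \<open>Koenig's lemma in the form of a well-founded induction: each history has finitely many
  one-step extensions, and no chain of extensions is infinite.\<close>

lemma finite_hists: "finite hists"
proof -
  have "h \<noteq> [] \<Longrightarrow> finite {g \<in> hists. prefix h g}" for h
  proof (induction h rule: wf_induct_rule[OF wf_hist_ext])
    case (1 h)
    let ?W = "{w \<in> succ (last h). \<not> loops h w}"
    have "{g \<in> hists. prefix h g} \<subseteq> insert h (\<Union>w\<in>?W. {g \<in> hists. prefix (h @ [w]) g})"
    proof
      fix g assume g: "g \<in> {g \<in> hists. prefix h g}"
      then obtain zs where zs: "g = h @ zs" by (auto elim: prefixE)
      show "g \<in> insert h (\<Union>w\<in>?W. {g \<in> hists. prefix (h @ [w]) g})"
      proof (cases zs)
        case (Cons w ws)
        then have p: "prefix (h @ [w]) g" using zs by simp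
        then have "h @ [w] \<in> hists" using hists_prefix g by blast
        then show ?thesis using hists_snoc[of h w] "1.prems" p g by blast
      qed (use zs in simp)
    qed
    moreover have "finite (insert h (\<Union>w\<in>?W. {g \<in> hists. prefix (h @ [w]) g}))"
      using 1 finite_subset[OF succ_vs finite_vs] unfolding hist_ext_def by auto
    ultimately show ?case by (rule finite_subset)
  qed
  from this[of "[r]"] show ?thesis using root_prefix by (simp add: Collect_conj_eq) (metis Int_absorb2 mem_Collect_eq subsetI)
qed

text \<open>The variables \<open>1..q\<close> are reserved for vacuous binders, which
  make the priority assignment surjective even if \<open>\<Omega>\<close> is not.\<close>

definition var :: "'a list \<Rightarrow> nat" where
  "var = (SOME c. inj_on c hists \<and> c ` hists \<subseteq> {q<..})"

lemma var: "inj_on var hists" "h \<in> hists \<Longrightarrow> q < var h"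
proof -
  obtain c :: "'a list \<Rightarrow> nat" where c: "inj_on c hists"
    using finite_imp_inj_to_nat_seg[OF finite_hists] by metis
  have "inj_on (\<lambda>h. c h + Suc q) hists \<and> (\<lambda>h. c h + Suc q) ` hists \<subseteq> {q<..}"
    using c by (auto simp: inj_on_def)
  then have "\<exists>c :: 'a list \<Rightarrow> nat. inj_on c hists \<and> c ` hists \<subseteq> {q<..}" by blast
  from someI_ex[OF this] show "inj_on var hists" "h \<in> hists \<Longrightarrow> q < var h"
    unfolding var_def by blast+
qed

lemma var_eq: "g \<in> hists \<Longrightarrow> h \<in> hists \<Longrightarrow> var g = var h \<longleftrightarrow> g = h"
  using var(1) by (auto simp: inj_on_def)

text \<open>The relation \<open>hist_ext\<close> is well founded on all lists, so the recursion
  needs no restriction to \<open>hists\<close>. The parts of the right-hand side get the names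
  \<open>child\<close> and \<open>body\<close> only afterwards, since they contain the recursive
  call.\<close>

function build :: "'a list \<Rightarrow> 'p fm" where
  "build h = bnd (\<Omega> (last h)) (var h) (node_formula (kind (last h))
     (map (\<lambda>w. if loops h w then Var (var (next_hist h w)) else build (h @ [w])) (succs (last h))))"
  by auto
termination
  by (relation hist_ext) (use wf_hist_ext in \<open>auto simp: hist_ext_def succs\<close>)

declare build.simps [simp del]

definition child :: "'a list \<Rightarrow> 'a \<Rightarrow> 'p fm" where
  "child h w = (if loops h w then Var (var (next_hist h w)) else build (h @ [w]))"

definition body :: "'a list \<Rightarrow> 'p fm" where
  "body h = node_formula (kind (last h)) (map (child h) (succs (last h)))"

lemma build_eq: "build h = bnd (\<Omega> (last h)) (var h) (body h)"
  unfolding body_def child_def by (rule build.simps)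

lemma hist_induct [consumes 1, case_names step]:
  assumes "h \<in> hists"
    and step: "\<And>h. h \<in> hists \<Longrightarrow> (\<And>w. w \<in> succ (last h) \<Longrightarrow> \<not> loops h w \<Longrightarrow> P (h @ [w])) \<Longrightarrow> P h"
  shows "P h"
  using assms(1)
proof (induction h rule: wf_induct_rule[OF wf_hist_ext])
  case (1 h)
  then show ?case using step[of h] hists.ext[of h] unfolding hist_ext_def by blast
qed

lemma sf_build:
  "h \<in> hists \<Longrightarrow> \<beta> \<in> sf (build h) \<Longrightarrow> binds X \<phi> \<beta> \<Longrightarrow>
     \<exists>g\<in>hists. prefix h g \<and> \<beta> = build g \<and> X = var g \<and> \<phi> = body g"
proof (induction h rule: hist_induct)
  case (step h)
  show ?case
  proof (cases "\<beta> = build h")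
    case True
    then show ?thesis using step by (auto simp: build_eq)
  next
    case False
    then have "\<beta> \<in> sf (body h)" using step.prems by (auto simp: build_eq)
    then obtain w where w: "w \<in> succ (last h)" "\<beta> \<in> sf (child h w)"
      using node_formula_sf step.prems(2) unfolding body_def by (fastforce simp: succs)
    then have nl: "\<not> loops h w" "\<beta> \<in> sf (build (h @ [w]))"
      using step.prems(2) by (auto simp: child_def binds_def split: if_splits)
    show ?thesis using step.IH[OF w(1) nl(1) nl(2) step.prems(2)] by (auto dest: append_prefixD)
  qed
qed

lemma sf_child: "w \<in> succ (last h) \<Longrightarrow> sf (child h w) \<subseteq> sf (body h)"
  unfolding body_def by (rule sf_node_formula) (auto simp: succs)

lemma build_in_sf: "g \<in> hists \<Longrightarrow> prefix h g \<Longrightarrow> h \<noteq> [] \<Longrightarrow> build g \<in> sf (build h)"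
proof (induction rule: hists.induct)
  case root
  then show ?case by (auto simp: prefix_Cons)
next
  case (ext g w)
  show ?case
  proof (cases "h = g @ [w]")
    case False
    then have "build g \<in> sf (build h)" using ext by simp
    moreover have "build (g @ [w]) \<in> sf (build g)"
      using sf_child[OF ext.hyps(2)] ext.hyps(3) sf_refl[of "build (g @ [w])"]
      by (auto simp: build_eq[of g] child_def simp del: sf_refl)
    ultimately show ?thesis using sf_trans by blast
  qed simp
qed

lemma fv_body: "fv (body h) = (\<Union>w\<in>succ (last h). fv (child h w))"
  unfolding body_def by (auto simp: node_formula_fv succs)

text \<open>A free variable comes from a back edge that leaves the subtree of \<open>h\<close> and
  ends at a proper prefix \<open>g\<close>. Such an edge exists only if nothing after
  \<open>g\<close> has a higher priority than \<open>last g\<close>, and \<open>last h\<close> comes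
  after \<open>g\<close>.\<close>

lemma fv_build:
  "h \<in> hists \<Longrightarrow> X \<in> fv (build h) \<Longrightarrow>
     \<exists>g. X = var g \<and> strict_prefix g h \<and> g \<noteq> [] \<and> \<Omega> (last h) \<le> \<Omega> (last g)"
proof -
  \<comment> \<open>Strengthened for the induction: the bound for all vertices after
    \<open>g\<close> survives when the last vertex of the history is dropped, the bound for the last
    one alone does not.\<close>
  have "h \<in> hists \<Longrightarrow> X \<in> fv (build h) \<Longrightarrow>
     \<exists>g zs. X = var g \<and> h = g @ zs \<and> zs \<noteq> [] \<and> g \<noteq> [] \<and> (\<forall>x\<in>set zs. \<Omega> x \<le> \<Omega> (last g))" for h X
  proof (induction h rule: hist_induct)
    case (step h)
    then have X: "X \<in> fv (body h)" "X \<noteq> var h" by (auto simp: build_eq)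
    then obtain w where w: "w \<in> succ (last h)" "X \<in> fv (child h w)" by (auto simp: fv_body)
    show ?case
    proof (cases "loops h w")
      case True
      then have "X = var (next_hist h w)" using w by (simp add: child_def)
      moreover obtain zs where "h = next_hist h w @ zs" "next_hist h w \<noteq> []" "\<forall>x\<in>set zs. \<Omega> x \<le> \<Omega> w"
        using next_hist_loops[OF True] unfolding loops_to_def by blast
      moreover have "zs \<noteq> []" using calculation X(2) by auto
      ultimately show ?thesis by (metis last_next_hist)
    next
      case False
      then have "X \<in> fv (build (h @ [w]))" using w by (simp add: child_def)
      from step.IH[OF w(1) False this] obtain g zs where g: "X = var g" "h @ [w] = g @ zs"
        "zs \<noteq> []" "g \<noteq> []" "\<forall>x\<in>set zs. \<Omega> x \<le> \<Omega> (last g)" by blast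
      then obtain zs' where zs': "zs = zs' @ [w]" "h = g @ zs'" by (cases zs rule: rev_cases) auto
      moreover have "zs' \<noteq> []" using zs' g X(2) by auto
      ultimately show ?thesis using g by auto
    qed
  qed
  moreover assume "h \<in> hists" "X \<in> fv (build h)"
  ultimately obtain g zs where g: "X = var g" "h = g @ zs" "zs \<noteq> []" "g \<noteq> []"
    "\<forall>x\<in>set zs. \<Omega> x \<le> \<Omega> (last g)" by blast
  then have "last h \<in> set zs" by simp
  then show ?thesis using g by (auto intro!: exI[of _ g] simp: strict_prefix_def)
qed

text \<open>A converse of \<open>fv_build\<close>: since each history has a variable of its own, no
  binder strictly between \<open>g\<close> and the back edge at \<open>k\<close> captures the
  variable of \<open>g\<close>. The induction climbs from \<open>k\<close> up to \<open>h\<close>.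
  It is this lemma that ties down every priority assignment of \<Phi>.\<close>

lemma var_in_fv_build:
  "k \<in> hists \<Longrightarrow> w \<in> succ (last k) \<Longrightarrow> loops k w \<Longrightarrow> g = next_hist k w \<Longrightarrow>
     strict_prefix g h \<Longrightarrow> prefix h k \<Longrightarrow> var g \<in> fv (build h)"
proof -
  assume k: "k \<in> hists" "w \<in> succ (last k)" "loops k w" "g = next_hist k w" "strict_prefix g h" "prefix h k"
  have gh: "g \<in> hists" using next_hist_in k by blast
  have "prefix h k' \<Longrightarrow> prefix k' k \<Longrightarrow> var g \<in> fv (build k')" for k'
  proof (induction "length k - length k'" arbitrary: k' rule: less_induct)
    case less
    have "g \<noteq> []" using hists_not_Nil[OF gh] .
    have sp: "strict_prefix g k'" using less.prems k(5) prefix_order.less_le_trans by blast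
    then have "k' \<noteq> []" by auto
    then have k': "k' \<noteq> []" "k' \<in> hists" using less.prems hists_prefix[OF k(1), of k'] by auto
    have ne: "var g \<noteq> var k'" using var_eq[OF gh k'(2)] sp by auto
    obtain zs where zs: "k = k' @ zs" using less.prems by (auto elim: prefixE)
    have "\<exists>v\<in>succ (last k'). var g \<in> fv (child k' v)"
    proof (cases zs)
      case Nil
      then show ?thesis using k zs by (auto simp: child_def)
    next
      case (Cons v vs)
      then have p: "prefix (k' @ [v]) k" using zs by simp
      then have "k' @ [v] \<in> hists" using hists_prefix[OF k(1)] by simp
      then have v: "v \<in> succ (last k')" "\<not> loops k' v" using hists_snoc k' by blast+
      have "var g \<in> fv (build (k' @ [v]))"
        using less.hyps[of "k' @ [v]"] less.prems p zs Cons by auto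
      then show ?thesis using v by (auto simp: child_def)
    qed
    then show ?case using ne by (simp add: build_eq fv_body)
  qed
  then show "var g \<in> fv (build h)" using k(6) by blast
qed

definition \<Phi> :: "'p fm" where
  "\<Phi> = vacuous q (build [r])"

lemma fv_root: "fv (build [r]) = {}"
  using fv_build[OF hists.root] by (auto simp: strict_prefix_def prefix_Cons)

lemma binders_\<Phi>:
  assumes "\<beta> \<in> sf \<Phi>" "binds X \<phi> \<beta>"
  shows "(\<exists>g\<in>hists. \<beta> = build g \<and> X = var g \<and> \<phi> = body g) \<or>
    (\<exists>j<q. \<beta> = vacuous (Suc j) (build [r]) \<and> X = Suc j \<and> \<phi> = vacuous j (build [r]))"
proof -
  have "\<beta> \<in> sf (build [r]) \<or> (\<exists>j<q. \<beta> = vacuous (Suc j) (build [r]))"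
    using assms(1) unfolding \<Phi>_def by (simp only: sf_vacuous)
  then show ?thesis using sf_build[OF hists.root _ assms(2)] assms(2) by auto
qed

lemma build_in_\<Phi>: "h \<in> hists \<Longrightarrow> build h \<in> sf \<Phi>"
  unfolding \<Phi>_def sf_vacuous using build_in_sf[OF _ root_prefix] by simp

lemma vacuous_in_\<Phi>: "j < q \<Longrightarrow> vacuous (Suc j) (build [r]) \<in> sf \<Phi>"
  unfolding \<Phi>_def sf_vacuous by blast

lemma bound_vars_\<Phi>: "bound_vars \<Phi> = var ` hists \<union> {1..q}"
proof
  show "bound_vars \<Phi> \<subseteq> var ` hists \<union> {1..q}"
    unfolding bound_vars_def using binders_\<Phi> by fastforce
  have "var h \<in> bound_vars \<Phi>" if "h \<in> hists" for h
    using build_in_\<Phi>[OF that] unfolding bound_vars_def build_eq by force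
  moreover have "Suc j \<in> bound_vars \<Phi>" if "j < q" for j
    using vacuous_in_\<Phi>[OF that] unfolding bound_vars_def by force
  ultimately show "var ` hists \<union> {1..q} \<subseteq> bound_vars \<Phi>"
    by (auto simp: Suc_le_eq gr0_conv_Suc dest!: gr0_implies_Suc)
qed

lemma disjunctive_\<Phi>: "disjunctive \<Phi>"
proof -
  have "disjunctive (build h)" if "h \<in> hists" for h
    using that
  proof (induction h rule: hist_induct)
    case (step h)
    then have "disjunctive (child h w)" if "w \<in> succ (last h)" for w
      using that by (auto simp: child_def intro: disjunctive.intros)
    then show ?case unfolding build_eq body_def
      by (auto intro!: disjunctive_bnd disjunctive_node_formula simp: succs)
  qed
  then show ?thesis unfolding \<Phi>_def using hists.root by (intro disjunctive_vacuous)
qed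

text \<open>Only a disjunctive vertex has unguarded variables in its body, and its successors are
  modal. Such a variable is therefore a child itself and names a history ending in a modal vertex,
  which cannot be \<open>h\<close>.\<close>

lemma guarded_body:
  assumes h: "h \<in> hists"
  shows "var h \<notin> unguarded_fv (body h)"
proof
  assume "var h \<in> unguarded_fv (body h)"
  then have d: "kind (last h) = Disjunctive"
    and "\<exists>w\<in>succ (last h). var h \<in> unguarded_fv (child h w)"
    unfolding body_def by (auto simp: unguarded_fv_node_formula succs split: if_splits)
  then obtain w where w: "w \<in> succ (last h)" "var h \<in> unguarded_fv (child h w)" by blast
  have m: "kind w \<noteq> Disjunctive" using disj_succ_modal[OF last_hists[OF h] d w(1)] .
  show False
  proof (cases "loops h w")
    case True
    then have "h = next_hist h w" using w h next_hist_in[OF h w(1)] var_eq by (simp add: child_def)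
    then show False using d m last_next_hist[of h w] by metis
  next
    case False
    then show False using w m by (auto simp: child_def build_eq body_def unguarded_fv_node_formula)
  qed
qed

lemma sentence_\<Phi>: "sentence \<Phi>"
  unfolding sentence_def
proof (intro conjI)
  show "fv \<Phi> = {}" unfolding \<Phi>_def using fv_vacuous fv_root by blast
  show "guarded \<Phi>" unfolding guarded_def
  proof (intro allI ballI impI)
    fix X \<phi> \<beta> assume *: "\<beta> \<in> sf \<Phi>" "binds X \<phi> \<beta>"
    from binders_\<Phi>[OF *] show "X \<notin> unguarded_fv \<phi>"
      using guarded_body fv_vacuous[of _ "build [r]"] fv_root
        unguarded_fv_subset[of "vacuous _ (build [r])"] by fastforce
  qed
  show "unique_binders \<Phi>" unfolding unique_binders_def
  proof (intro allI ballI impI)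
    fix X \<phi> \<phi>' \<beta> \<beta>'
    assume *: "\<beta> \<in> sf \<Phi>" "\<beta>' \<in> sf \<Phi>" "binds X \<phi> \<beta>" "binds X \<phi>' \<beta>'"
    show "\<beta> = \<beta>'"
      using binders_\<Phi>[OF *(1,3)] binders_\<Phi>[OF *(2,4)] var_eq var(2) by fastforce
  qed
qed

section \<open>The priority assignment of \<Phi>\<close>

definition var_priority :: "nat \<Rightarrow> nat" where
  "var_priority X = (if X \<le> q then X else \<Omega> (last (inv_into hists var X)))"

lemma var_priority_simps: "j \<le> q \<Longrightarrow> var_priority j = j" "h \<in> hists \<Longrightarrow> var_priority (var h) = \<Omega> (last h)"
  using var(2)[of h] inv_into_f_f[OF var(1), of h] by (auto simp: var_priority_def)

lemma priority_assignment_\<Phi>: "priority_assignment \<Phi> var_priority q"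
  unfolding priority_assignment_def
proof (intro conjI allI ballI impI)
  show "var_priority ` bound_vars \<Phi> \<subseteq> {0..q}"
    using \<Omega>_le[OF last_hists] by (auto simp: bound_vars_\<Phi> var_priority_simps)
  have "j \<in> var_priority ` bound_vars \<Phi>" if "j \<in> {1..q}" for j
    using that by (intro image_eqI[of _ _ j]) (auto simp: bound_vars_\<Phi> var_priority_simps)
  then show "{1..q} \<subseteq> var_priority ` bound_vars \<Phi>" by blast
next
  fix X \<phi> assume "Mu X \<phi> \<in> sf \<Phi>"
  from binders_\<Phi>[OF this, of X \<phi>] show "odd (var_priority X)"
    by (auto simp: binds_def build_eq bnd_def var_priority_simps Suc_le_eq split: if_splits)
next
  fix X \<phi> assume "Nu X \<phi> \<in> sf \<Phi>"
  from binders_\<Phi>[OF this, of X \<phi>] show "even (var_priority X)"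
    by (auto simp: binds_def build_eq bnd_def var_priority_simps Suc_le_eq split: if_splits)
next
  fix X Y \<phi> \<beta> assume lt: "var_priority X < var_priority Y" and \<beta>: "\<beta> \<in> sf \<Phi>" "binds Y \<phi> \<beta>"
  show "X \<notin> fv \<beta>"
  proof
    assume X: "X \<in> fv \<beta>"
    \<comment> \<open>The vacuous binders are closed, so a binder with a free variable is that of a
      history.\<close>
    then obtain h where h: "h \<in> hists" "\<beta> = build h" "Y = var h"
      using binders_\<Phi>[OF \<beta>] fv_vacuous[of _ "build [r]"] fv_root by blast
    obtain g where g: "X = var g" "strict_prefix g h" "g \<noteq> []" "\<Omega> (last h) \<le> \<Omega> (last g)"
      using fv_build[OF h(1)] X h(2) by blast
    then have "g \<in> hists" using hists_prefix[OF h(1)] by auto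
    then show False using lt g h by (simp add: var_priority_simps)
  qed
qed

end

section \<open>Infinite paths of histories\<close>

context core_like_graph
begin

definition hist_path :: "(nat \<Rightarrow> 'a list) \<Rightarrow> bool" where
  "hist_path \<rho> \<longleftrightarrow>
     (\<forall>n. \<rho> n \<in> hists \<and> (\<exists>w\<in>succ (last (\<rho> n)). \<rho> (Suc n) = next_hist (\<rho> n) w))"

text \<open>Demanding that the history before the visit extends \<open>g\<close> makes the arrival
  at \<open>g\<close> a back edge, that is, a regeneration of its variable and not a passage through
  its binder.\<close>

definition topmost :: "(nat \<Rightarrow> 'a list) \<Rightarrow> 'a list \<Rightarrow> bool" where
  "topmost \<rho> g \<longleftrightarrow> g \<in> hists \<and> (\<forall>\<^sub>\<infinity>n. prefix g (\<rho> n)) \<and>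
     (\<exists>\<^sub>\<infinity>n. prefix g (\<rho> n) \<and> \<rho> (Suc n) = g)"

lemma hist_path_step:
  assumes "hist_path \<rho>"
  obtains w where "w \<in> succ (last (\<rho> n))" "\<not> loops (\<rho> n) w" "\<rho> (Suc n) = \<rho> n @ [w]"
    | w where "w \<in> succ (last (\<rho> n))" "loops (\<rho> n) w" "\<rho> (Suc n) = next_hist (\<rho> n) w"
      "prefix (\<rho> (Suc n)) (\<rho> n)"
  using assms next_hist_new next_hist_loops loops_to_prefix unfolding hist_path_def by metis

text \<open>Take a visited history of the least length seen infinitely often, at a time after which
  nothing shorter occurs.\<close>

lemma topmost_exists:
  assumes \<rho>: "hist_path \<rho>"
  shows "\<exists>g. topmost \<rho> g"
proof -
  have "\<exists>h\<in>hists. \<exists>\<^sub>\<infinity>n. \<rho> n = h"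
    using \<rho> finite_hists unfolding hist_path_def by (auto intro: pigeonhole_infinite_rel simp: INFM_finite_Bex_distrib[symmetric] INFM_const)
  then have "\<exists>l. \<exists>\<^sub>\<infinity>n. length (\<rho> n) = l" by (auto elim: INFM_mono)
  define l where "l = (LEAST l. \<exists>\<^sub>\<infinity>n. length (\<rho> n) = l)"
  have l: "\<exists>\<^sub>\<infinity>n. length (\<rho> n) = l"
    unfolding l_def using \<open>\<exists>l. \<exists>\<^sub>\<infinity>n. length (\<rho> n) = l\<close> by (rule LeastI_ex)
  have "\<forall>i<l. \<not> (\<exists>\<^sub>\<infinity>n. length (\<rho> n) = i)" unfolding l_def using not_less_Least by blast
  then have "\<forall>i<l. \<forall>\<^sub>\<infinity>n. length (\<rho> n) \<noteq> i" by (simp add: not_INFM)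
  then have "\<forall>\<^sub>\<infinity>n. \<forall>i\<in>{..<l}. length (\<rho> n) \<noteq> i"
    by (subst eventually_ball_finite_distrib) auto
  then obtain N where "\<forall>n\<ge>N. \<forall>i\<in>{..<l}. length (\<rho> n) \<noteq> i" unfolding MOST_nat_le by blast
  then have N: "l \<le> length (\<rho> n)" if "n \<ge> N" for n using that by (auto simp flip: not_less)
  obtain n0 where n0: "n0 \<ge> N" "length (\<rho> n0) = l" using l unfolding INFM_nat_le by blast
  let ?g = "\<rho> n0"
  \<comment> \<open>A step either appends a vertex or cuts back to a prefix; as the prefix is no
    shorter than \<open>?g\<close>, it still extends \<open>?g\<close>.\<close>
  have pre: "n \<ge> n0 \<Longrightarrow> prefix ?g (\<rho> n)" for n
  proof (induction n rule: dec_induct)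
    case (step n)
    show ?case using \<rho>
    proof (cases rule: hist_path_step[of _ n])
      case (2 w)
      then show ?thesis using step.IH N[of "Suc n"] n0 step.hyps
        by (auto intro: prefix_length_prefix)
    qed (use step.IH in auto)
  qed simp
  have "\<exists>n\<ge>m. prefix ?g (\<rho> n) \<and> \<rho> (Suc n) = ?g" for m
  proof -
    obtain n where n: "n \<ge> Suc (max m n0)" "length (\<rho> n) = l" using l unfolding INFM_nat_le by blast
    then obtain n' where n': "n = Suc n'" "n' \<ge> m" "n' \<ge> n0" by (cases n) auto
    have "\<rho> n = ?g" using pre[of n] n n0 n' by (auto elim!: prefixE)
    then show ?thesis using n' pre[of n'] by auto
  qed
  then have "topmost \<rho> ?g" unfolding topmost_def INFM_nat_le MOST_nat_le
    using pre \<rho> by (auto simp: hist_path_def)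
  then show ?thesis ..
qed

text \<open>This suffices for the topmost history to have the highest priority: every path that
  leaves the subtree of a history \<open>h\<close> does so by a back edge as below.\<close>

definition compatible :: "('a list \<Rightarrow> nat) \<Rightarrow> bool" where
  "compatible P \<longleftrightarrow> (\<forall>k w h. k \<in> hists \<longrightarrow> w \<in> succ (last k) \<longrightarrow> loops k w \<longrightarrow>
     strict_prefix (next_hist k w) h \<longrightarrow> prefix h k \<longrightarrow> P h \<le> P (next_hist k w))"

text \<open>By \<open>var_in_fv_build\<close> the variable of the target of the back edge is free in
  the binder of \<open>h\<close>, so a priority assignment must give it at least the priority of
  \<open>h\<close>.\<close>

lemma compatible_assignment:
  assumes "priority_assignment \<Phi> \<Omega>' n"
  shows "compatible (\<lambda>h. \<Omega>' (var h))"
  unfolding compatible_def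
proof (intro allI impI)
  fix k w h
  assume *: "k \<in> hists" "w \<in> succ (last k)" "loops k w" "strict_prefix (next_hist k w) h" "prefix h k"
  have "h \<noteq> []" using *(4) by auto
  then have h: "h \<in> hists" using hists_prefix *(1,5) by blast
  have g: "next_hist k w \<in> hists" using next_hist_in *(1,2) by blast
  have "var (next_hist k w) \<in> fv (build h)" using var_in_fv_build[OF *(1-3) refl *(4,5)] .
  moreover have "build h \<in> sf \<Phi>" "binds (var h) (body h) (build h)"
    using build_in_\<Phi>[OF h] by (simp_all add: build_eq[of h])
  moreover have "var h \<in> bound_vars \<Phi>" "var (next_hist k w) \<in> bound_vars \<Phi>"
    using h g by (auto simp: bound_vars_\<Phi>)
  ultimately show "\<Omega>' (var h) \<le> \<Omega>' (var (next_hist k w))"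
    using assms unfolding priority_assignment_def by (meson not_le)
qed

lemma parity_assignment:
  assumes "priority_assignment \<Phi> \<Omega>' n" "h \<in> hists"
  shows "odd (\<Omega>' (var h)) \<longleftrightarrow> odd (\<Omega> (last h))"
  using assms build_in_\<Phi>[OF assms(2)] unfolding priority_assignment_def build_eq bnd_def
  by (auto split: if_splits)

text \<open>Eventually all histories extend \<open>g\<close>, and \<open>g\<close> is always visited
  again. Until that visit every proper extension of \<open>g\<close> in the current history must be
  cut off by a back edge, and compatibility bounds its priority by that of the target; repeating
  this ends at \<open>g\<close>.\<close>

lemma Max_topmost:
  assumes \<rho>: "hist_path \<rho>" and P: "compatible P" and g: "topmost \<rho> g"
  shows "Max {k. \<exists>\<^sub>\<infinity>n. P (\<rho> n) = k} = P g"
proof -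
  obtain N where N: "\<And>n. n \<ge> N \<Longrightarrow> prefix g (\<rho> n)"
    using g unfolding topmost_def MOST_nat_le by blast
  have inf: "\<exists>\<^sub>\<infinity>n. \<rho> n = g"
    using g unfolding topmost_def INFM_nat_le by (meson le_Suc_eq)
  \<comment> \<open>Induction backwards from the visit \<open>m\<close>. The claim covers all
    prefixes \<open>h\<close> of the current history above \<open>g\<close>, because after an
    appending step the old history survives only as a prefix.\<close>
  have below: "prefix h (\<rho> n) \<Longrightarrow> prefix g h \<Longrightarrow> P h \<le> P g" if "n \<le> m" "N \<le> n" "\<rho> m = g" for n m h
    using that(1,2)
  proof (induction n arbitrary: h rule: inc_induct)
    case base
    then have "h = g" using that(3) by (simp add: prefix_order.antisym)
    then show ?case by simp
  next
    case (step n)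
    show ?case using \<rho>
    proof (cases rule: hist_path_step[of _ n])
      case (1 w)
      then show ?thesis using step by (auto intro: prefix_prefix)
    next
      case (2 w)
      show ?thesis
      proof (cases "prefix h (\<rho> (Suc n))")
        case True
        then show ?thesis using step by auto
      next
        case False
        then have "strict_prefix (\<rho> (Suc n)) h"
          using prefix_same_cases[OF step.prems(1) 2(4)] by (auto simp: strict_prefix_def)
        then have "P h \<le> P (\<rho> (Suc n))"
          using P 2 step.prems(1) \<rho> unfolding compatible_def hist_path_def by metis
        also have "\<dots> \<le> P g" using step.IH[of "\<rho> (Suc n)"] N[of "Suc n"] step.prems by auto
        finally show ?thesis .
      qed
    qed
  qed
  have le: "P (\<rho> n) \<le> P g" if "n \<ge> N" for n
  proof -
    obtain m where "m \<ge> n" "\<rho> m = g" using inf unfolding INFM_nat_le by blast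
    then show ?thesis using below[of n m "\<rho> n"] N that by auto
  qed
  show ?thesis
  proof (rule Max_eqI)
    have "k \<le> P g" if "\<exists>\<^sub>\<infinity>n. P (\<rho> n) = k" for k
      using that le unfolding INFM_nat_le by blast
    then show "finite {k. \<exists>\<^sub>\<infinity>n. P (\<rho> n) = k}" "\<And>k. k \<in> {k. \<exists>\<^sub>\<infinity>n. P (\<rho> n) = k} \<Longrightarrow> k \<le> P g"
      using finite_nat_set_iff_bounded_le by blast+
    show "P g \<in> {k. \<exists>\<^sub>\<infinity>n. P (\<rho> n) = k}" using inf by (auto elim: INFM_mono)
  qed
qed

lemma compatible_\<Omega>: "compatible (\<lambda>h. \<Omega> (last h))"
proof -
  have "h \<in> hists" if "k \<in> hists" "strict_prefix g h" "prefix h k" for g h k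
  proof -
    have "h \<noteq> []" using that(2) by auto
    then show ?thesis using hists_prefix[OF that(1,3)] by blast
  qed
  then show ?thesis
    using compatible_assignment[OF priority_assignment_\<Phi>] next_hist_in unfolding compatible_def
    by (metis var_priority_simps(2))
qed

lemma odd_Max_topmost:
  assumes \<rho>: "hist_path \<rho>" and g: "topmost \<rho> g"
  shows "odd (Max {k. \<exists>\<^sub>\<infinity>n. \<Omega> (last (\<rho> n)) = k}) \<longleftrightarrow> odd (\<Omega> (last g))"
  using Max_topmost[OF \<rho> compatible_\<Omega> g] by simp

text \<open>Both maxima are attained at the topmost history, and the kind of its binder fixes the
  parity there for every priority assignment. The values themselves may differ.\<close>

lemma odd_Max_assignment:
  assumes \<rho>: "hist_path \<rho>" and "priority_assignment \<Phi> \<Omega>' n"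
  shows "odd (Max {k. \<exists>\<^sub>\<infinity>n. \<Omega>' (var (\<rho> n)) = k}) \<longleftrightarrow>
    odd (Max {k. \<exists>\<^sub>\<infinity>n. \<Omega> (last (\<rho> n)) = k})"
proof -
  obtain g where g: "topmost \<rho> g" using topmost_exists[OF \<rho>] ..
  show ?thesis
    using Max_topmost[OF \<rho> compatible_assignment[OF assms(2)] g] odd_Max_topmost[OF \<rho> g]
      parity_assignment[OF assms(2)] g by (simp add: topmost_def)
qed

end

section \<open>The tableau of the disjunctive formula\<close>

fun named :: "'p fm option \<Rightarrow> nat option" where
  "named (Some (Var X)) = Some X"
| "named (Some (Mu X _)) = Some X"
| "named (Some (Nu X _)) = Some X"
| "named _ = None"

lemma named_bnd [simp]: "named (Some (bnd k X \<phi>)) = Some X"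
  by (simp add: bnd_def)

text \<open>In the tableaus considered here a label is a singleton or consists of one modal formula,
  literals and possibly a conjunction of literals. The main formula is the one that a trace through
  infinitely many modal steps has to follow.\<close>

definition main_formula :: "'p fm set \<Rightarrow> 'p fm" where
  "main_formula \<Gamma> = (if \<exists>p. \<Gamma> = {p} then the_elem \<Gamma> else (THE p. p \<in> \<Gamma> \<and> p \<in> range Arrow))"

definition has_main :: "'p fm set \<Rightarrow> bool" where
  "has_main \<Gamma> \<longleftrightarrow> (\<exists>p. \<Gamma> = {p}) \<or> (\<exists>B. Arrow B \<in> \<Gamma> \<and> (\<forall>B'. Arrow B' \<in> \<Gamma> \<longrightarrow> B' = B))"

lemma main_singleton [simp]: "main_formula {p} = p"
  by (simp add: main_formula_def)

lemma main_Arrow: "has_main \<Gamma> \<Longrightarrow> Arrow B \<in> \<Gamma> \<Longrightarrow> main_formula \<Gamma> = Arrow B"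
proof (cases "\<exists>p. \<Gamma> = {p}")
  case False
  assume m: "has_main \<Gamma>" "Arrow B \<in> \<Gamma>"
  then have "\<And>B'. Arrow B' \<in> \<Gamma> \<Longrightarrow> B' = B" using False unfolding has_main_def by blast
  then have "(THE p. p \<in> \<Gamma> \<and> p \<in> range Arrow) = Arrow B" using m by (intro the_equality) blast+
  then show ?thesis using False unfolding main_formula_def by simp
qed auto

lemma main_in: "has_main \<Gamma> \<Longrightarrow> main_formula \<Gamma> \<in> \<Gamma>"
proof (cases "\<exists>p. \<Gamma> = {p}")
  case False
  assume m: "has_main \<Gamma>"
  then obtain B where "Arrow B \<in> \<Gamma>" using False unfolding has_main_def by blast
  then show ?thesis using main_Arrow[OF m] by simp
qed auto

text \<open>With a single \<open>Arrow\<close> in the label, the modal rule leaves only the chosen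
  successor. In a label with several formulas a non-modal rule acts on something other than the
  irreducible \<open>Arrow\<close>, which is kept.\<close>

lemma trace_step_main:
  assumes r: "tableau_rule \<Psi> \<Gamma> r m \<Gamma>'" and "has_main \<Gamma>" "has_main \<Gamma>'"
  shows "trace_step \<Psi> r m (main_formula \<Gamma>) (main_formula \<Gamma>')"
proof (cases r)
  case None
  then obtain B \<psi> where B: "Arrow B \<in> \<Gamma>" "m = Modal_move B \<psi>"
    "\<Gamma>' = insert \<psi> {Disj_set B' | B'. Arrow B' \<in> \<Gamma> \<and> B' \<noteq> B}" using r by auto
  have "B' = B" if "Arrow B' \<in> \<Gamma>" for B'
    using main_Arrow[OF assms(2) that] main_Arrow[OF assms(2) B(1)] by simp
  then have "\<Gamma>' = {\<psi>}" using B(3) by blast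
  then show ?thesis using main_Arrow[OF assms(2) B(1)] B(2) None
    by (simp add: trace_step.intros(3))
next
  case (Some p)
  then obtain D where D: "p \<in> \<Gamma>" "reduct \<Psi> p m D" "\<Gamma>' = \<Gamma> - {p} \<union> D" using r by auto
  show ?thesis
  proof (cases "\<Gamma> = {p}")
    case True
    then have "main_formula \<Gamma>' \<in> D" using main_in[OF assms(3)] D by simp
    then show ?thesis using True D Some by (auto intro: trace_step.intros)
  next
    case False
    then obtain B where B: "Arrow B \<in> \<Gamma>" using assms(2) D(1) unfolding has_main_def by auto
    then have "p \<noteq> Arrow B" "Arrow B \<in> \<Gamma>'" using D by auto
    then show ?thesis using main_Arrow[OF assms(2) B] main_Arrow[OF assms(3)] Some
      by (auto intro: trace_step.intros)
  qed
qed

section \<open>Histories and phases at the nodes of an arbitrary tableau of \<Phi>\<close>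

locale core_like_tableau = core_like_graph vs succ kind \<Omega> r q
  for vs :: "'a set" and succ and kind :: "'a \<Rightarrow> 'p kind" and \<Omega> r q +
  fixes T :: "'p tableau"
  assumes T: "tableau_of \<Phi> T"
begin

text \<open>The address is given in reverse, so that the recursion passes from a node to its parent.
  The default 0, like the variables of the vacuous binders, is not the variable of any
  history.\<close>

fun last_named :: "'p move list \<Rightarrow> nat" where
  "last_named [] = 0"
| "last_named (m # u) = (case named (rule T (rev u)) of Some X \<Rightarrow> X | None \<Rightarrow> last_named u)"

text \<open>The history at a node of the tableau is that of the fixpoint formula or variable to which
  a rule was last applied above the node.\<close>

definition hist_at :: "'p move list \<Rightarrow> 'a list" where
  "hist_at u = inv_into hists var (last_named (rev u))"

lemma hist_at_snoc:
  "named (rule T u) = None \<Longrightarrow> hist_at (u @ [m]) = hist_at u"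
  "named (rule T u) = Some (var h) \<Longrightarrow> h \<in> hists \<Longrightarrow> hist_at (u @ [m]) = h"
  by (simp_all add: hist_at_def inv_into_f_f[OF var(1)])

definition children :: "'a list \<Rightarrow> 'p fm list" where
  "children h = map (child h) (succs (last h))"

abbreviation arrow :: "'a list \<Rightarrow> 'p fm" where
  "arrow h \<equiv> Arrow (fset_of_list (children h))"

text \<open>A node passes through three phases of its history: \<open>entering\<close> while the
  body is intact or its literals are being taken apart, \<open>splitting\<close> inside the
  disjunction of the children, \<open>leaving\<close> at a single child. The literals in
  \<open>l1\<close> are already separate, those in \<open>l2\<close> are still joined.\<close>

definition entering :: "'a list \<Rightarrow> 'p fm set \<Rightarrow> bool" where
  "entering h \<Gamma> \<longleftrightarrow> \<Gamma> = {body h} \<or>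
     (\<exists>L l1 l2. kind (last h) = Modal L \<and> literal_list L = l1 @ l2 \<and> l2 \<noteq> [] \<and>
        \<Gamma> = insert (arrow h) (insert (bigand (map Lit l2)) (Lit ` set l1)))"

definition splitting :: "'a list \<Rightarrow> 'p fm set \<Rightarrow> bool" where
  "splitting h \<Gamma> \<longleftrightarrow> kind (last h) = Disjunctive \<and>
     (\<exists>i. Suc i < length (children h) \<and> \<Gamma> = {bigor (drop i (children h))})"

definition leaving :: "'a list \<Rightarrow> 'p fm set \<Rightarrow> bool" where
  "leaving h \<Gamma> \<longleftrightarrow> (\<exists>w\<in>succ (last h). \<Gamma> = {child h w})"

lemma body_children: "body h = node_formula (kind (last h)) (children h)"
  by (simp add: body_def children_def)

lemma length_children:
  "h \<in> hists \<Longrightarrow> kind (last h) = Disjunctive \<Longrightarrow> 2 \<le> length (children h)"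
proof -
  assume "h \<in> hists" "kind (last h) = Disjunctive"
  then have "set (succs (last h)) \<noteq> {}" using disj_succ last_hists succs(1) by metis
  then have "succs (last h) \<noteq> []" by auto
  then have "length (succs (last h)) \<noteq> 0" by simp
  then have "2 \<le> length (succs (last h))" using succs(2)[of "last h"] by linarith
  then show ?thesis by (simp add: children_def)
qed

lemma entering_disj: "h \<in> hists \<Longrightarrow> kind (last h) = Disjunctive \<Longrightarrow> entering h \<Gamma> \<longleftrightarrow> \<Gamma> = {body h}"
  by (auto simp: entering_def)

lemma entering_splitting:
  "h \<in> hists \<Longrightarrow> kind (last h) = Disjunctive \<Longrightarrow> entering h \<Gamma> \<Longrightarrow> splitting h \<Gamma>"
  using length_children[of h]
  by (auto simp: entering_disj splitting_def body_children node_formula_def intro!: exI[of _ 0])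

lemma leavingE:
  assumes "leaving h \<Gamma>" "h \<in> hists"
  obtains w where "w \<in> succ (last h)" "\<Gamma> = {child h w}"
  using assms unfolding leaving_def by blast

text \<open>A child is a variable for a back edge and a binder for a tree edge, but the tableau
  treats both alike: one unary step leads to the body of the next history.\<close>

lemma reducible_child:
  assumes "h \<in> hists" "w \<in> succ (last h)"
  shows "reducible \<Phi> (child h w)" "\<And>m D. reduct \<Phi> (child h w) m D \<longleftrightarrow> m = Unary \<and> D = {body (next_hist h w)}"
    "named (Some (child h w)) = Some (var (next_hist h w))"
proof -
  let ?g = "next_hist h w"
  have g: "?g \<in> hists" using next_hist_in assms by blast
  have b: "build ?g \<in> sf \<Phi>" "binds (var ?g) (body ?g) (build ?g)"
    using build_in_\<Phi>[OF g] by (simp_all add: build_eq[of ?g])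
  have u: "a = body ?g" if "\<beta> \<in> sf \<Phi>" "binds (var ?g) a \<beta>" for a \<beta>
    using binds_unique[OF _ that(1) b(1) that(2) b(2)] sentence_\<Phi> by (simp add: sentence_def)
  show "reducible \<Phi> (child h w)" using b by (cases "loops h w") (auto simp: child_def build_eq[of "h @ [w]"])
  show "reduct \<Phi> (child h w) m D \<longleftrightarrow> m = Unary \<and> D = {body ?g}" for m D
  proof (cases "loops h w")
    case True
    have "(\<exists>a. \<exists>\<beta>\<in>sf \<Phi>. binds (var ?g) a \<beta> \<and> D = {a}) \<longleftrightarrow> D = {body ?g}" using b u by blast
    then show ?thesis using True by (simp add: child_def)
  next
    case False
    then show ?thesis by (simp add: child_def build_eq[of "h @ [w]"] next_hist_new)
  qed
  show "named (Some (child h w)) = Some (var ?g)"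
    by (auto simp: child_def build_eq next_hist_new)
qed

lemma rule_singleton:
  "u \<in> nodes T \<Longrightarrow> label T u = {p} \<Longrightarrow> reducible \<Phi> p \<Longrightarrow> rule T u = Some p"
  using tableau_rule_applicable[OF T, of u] by (cases "rule T u") auto

lemma label_singleton:
  assumes "u @ [m] \<in> nodes T" "label T u = {p}" "reducible \<Phi> p"
  shows "reduct \<Phi> p m (label T (u @ [m]))"
  using tableau_child[OF T assms(1)] assms(2) rule_singleton[OF _ assms(2,3)] by auto

lemma child_singleton:
  assumes "u \<in> nodes T" "label T u = {p}" "reduct \<Phi> p m D"
  shows "u @ [m] \<in> nodes T" "label T (u @ [m]) = D"
proof -
  have "reducible \<Phi> p" using assms(3) by (auto simp: reducible_def)
  then have "tableau_rule \<Phi> (label T u) (rule T u) m D"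
    using rule_singleton[OF assms(1,2)] assms(2,3) by auto
  from tableau_childI[OF T assms(1) this] show "u @ [m] \<in> nodes T" "label T (u @ [m]) = D" .
qed

lemma leaving_step:
  assumes u: "u \<in> nodes T" and h: "h \<in> hists" "w \<in> succ (last h)" and l: "label T u = {child h w}"
  shows "u @ [Unary] \<in> nodes T" "label T (u @ [Unary]) = {body (next_hist h w)}"
    "hist_at (u @ [Unary]) = next_hist h w" "rule T u = Some (child h w)"
    "u @ [m] \<in> nodes T \<Longrightarrow> m = Unary"
proof -
  note c = reducible_child[OF h]
  show "u @ [Unary] \<in> nodes T" "label T (u @ [Unary]) = {body (next_hist h w)}"
    using child_singleton[OF u l] c(2) by auto
  show r: "rule T u = Some (child h w)" using rule_singleton[OF u l c(1)] .
  show "hist_at (u @ [Unary]) = next_hist h w"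
    using hist_at_snoc(2)[OF _ next_hist_in[OF h]] r c(3) by simp
  show "m = Unary" if "u @ [m] \<in> nodes T" using label_singleton[OF that l c(1)] c(2) by simp
qed

lemma splitting_rule:
  assumes "splitting h (label T u)" "u \<in> nodes T"
  obtains i where "Suc i < length (children h)" "label T u = {bigor (drop i (children h))}"
    "rule T u = Some (Or (children h ! i) (bigor (drop (Suc i) (children h))))"
    "label T u = {Or (children h ! i) (bigor (drop (Suc i) (children h)))}"
proof -
  obtain i where i: "Suc i < length (children h)" "label T u = {bigor (drop i (children h))}"
    using assms(1) unfolding splitting_def by blast
  have "drop i (children h) = children h ! i # children h ! Suc i # drop (Suc (Suc i)) (children h)"
    using i(1) by (simp add: Cons_nth_drop_Suc)
  moreover have "drop (Suc i) (children h) = children h ! Suc i # drop (Suc (Suc i)) (children h)"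
    using i(1) by (simp add: Cons_nth_drop_Suc)
  ultimately have eq: "bigor (drop i (children h)) = Or (children h ! i) (bigor (drop (Suc i) (children h)))"
    by (metis bigor.simps(3))
  show thesis
  proof (rule that[OF i])
    show l: "label T u = {Or (children h ! i) (bigor (drop (Suc i) (children h)))}"
      using i(2) eq by (rule trans[OF _ arg_cong])
    show "rule T u = Some (Or (children h ! i) (bigor (drop (Suc i) (children h))))"
      using rule_singleton[OF assms(2) l] by simp
  qed
qed

lemma leaving_nth:
  assumes "i < length (children h)"
  shows "leaving h {children h ! i}"
proof -
  have "succs (last h) ! i \<in> set (succs (last h))" using assms by (simp add: children_def)
  then have "succs (last h) ! i \<in> succ (last h)" using succs(1) by blast
  then show ?thesis using assms unfolding leaving_def by (auto simp: children_def)
qed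

lemma splitting_step:
  assumes s: "splitting h (label T u)" and um: "u @ [m] \<in> nodes T"
  shows "m \<in> {LeftDisj, RightDisj}" "hist_at (u @ [m]) = hist_at u"
    "splitting h (label T (u @ [m])) \<or> leaving h (label T (u @ [m]))"
proof -
  obtain i where i: "Suc i < length (children h)" "label T u = {bigor (drop i (children h))}"
    "rule T u = Some (Or (children h ! i) (bigor (drop (Suc i) (children h))))"
    "label T u = {Or (children h ! i) (bigor (drop (Suc i) (children h)))}"
    by (rule splitting_rule[OF s tableau_child(1)[OF T um]])
  have l: "m = LeftDisj \<and> label T (u @ [m]) = {children h ! i} \<or>
      m = RightDisj \<and> label T (u @ [m]) = {bigor (drop (Suc i) (children h))}"
    using label_singleton[OF um i(4)] by simp
  then show "m \<in> {LeftDisj, RightDisj}" by blast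
  show "hist_at (u @ [m]) = hist_at u" by (rule hist_at_snoc(1)) (simp add: i(3))
  have "splitting h {bigor (drop (Suc i) (children h))} \<or> leaving h {bigor (drop (Suc i) (children h))}"
  proof (cases "Suc (Suc i) < length (children h)")
    case True
    moreover have "kind (last h) = Disjunctive" using s unfolding splitting_def by blast
    ultimately show ?thesis unfolding splitting_def by blast
  next
    case False
    then have "drop (Suc i) (children h) = [children h ! Suc i]"
      using i(1) Cons_nth_drop_Suc[of "Suc i" "children h", symmetric] by (metis drop_all not_less)
    then show ?thesis using leaving_nth[of "Suc i" h] i(1) by simp
  qed
  then show "splitting h (label T (u @ [m])) \<or> leaving h (label T (u @ [m]))"
    using l leaving_nth[of i h, OF Suc_lessD[OF i(1)]] by metis
qed

lemma rule_NoneI: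
  assumes "u \<in> nodes T" "\<And>p. p \<in> label T u \<Longrightarrow> \<not> reducible \<Phi> p"
  shows "rule T u = None"
proof (cases "rule T u")
  case (Some p)
  then show ?thesis using tableau_principal[OF T assms(1)] assms(2) by blast
qed

lemma rule_SomeI:
  assumes "u \<in> nodes T" "p \<in> label T u" "reducible \<Phi> p"
    "\<And>p'. p' \<in> label T u \<Longrightarrow> reducible \<Phi> p' \<Longrightarrow> p' = p"
  shows "rule T u = Some p"
proof (cases "rule T u")
  case None
  then show ?thesis using tableau_rule_applicable[OF T assms(1)] assms(2,3) by auto
next
  case (Some p')
  then show ?thesis using tableau_principal[OF T assms(1)] assms(4) by blast
qed

lemma enteringI:
  "kind (last h) = Modal L \<Longrightarrow> literal_list L = l1 @ l2 \<Longrightarrow> l2 \<noteq> [] \<Longrightarrow>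
   \<Gamma> = insert (arrow h) (insert (bigand (map Lit l2)) (Lit ` set l1)) \<Longrightarrow> entering h \<Gamma>"
  unfolding entering_def by blast

text \<open>At any time at most one formula in the label is reducible, namely the remaining
  conjunction, so the rule is forced although \<open>T\<close> is arbitrary. The modal rule becomes
  due exactly when all literals are separate.\<close>

lemma entering_modal_rule:
  assumes e: "entering h (label T u)" and u: "u \<in> nodes T" and h: "h \<in> hists" and k: "kind (last h) = Modal L"
  shows "(rule T u = None \<and> arrow h \<in> label T u \<and> (\<forall>B. Arrow B \<in> label T u \<longrightarrow> Arrow B = arrow h) \<and>
           literals (label T u) = L) \<or>
     (\<exists>a b. rule T u = Some (And a b) \<and> entering h (label T u - {And a b} \<union> {a, b}))"
proof -
  have L: "set (literal_list L) = L" using set_literal_list[OF finite_literals[OF last_hists[OF h] k]] .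
  consider (arr) "literal_list L = []" "label T u = {arrow h}"
    | (conj) "literal_list L \<noteq> []" "label T u = {And (bigand (map Lit (literal_list L))) (arrow h)}"
    | (lits) l1 l2 where "literal_list L = l1 @ l2" "l2 \<noteq> []"
        "label T u = insert (arrow h) (insert (bigand (map Lit l2)) (Lit ` set l1))"
    using e k unfolding entering_def by (auto simp: body_children node_formula_def split: if_splits)
  then show ?thesis
  proof cases
    case arr
    then have "rule T u = None" using tableau_rule_applicable[OF T u] by (cases "rule T u") auto
    then show ?thesis using arr L by (auto simp: literals_def)
  next
    case conj
    let ?a = "bigand (map Lit (literal_list L))"
    have "rule T u = Some (And ?a (arrow h))" using rule_singleton[OF u conj(2)] by simp
    moreover have "entering h ({And ?a (arrow h)} - {And ?a (arrow h)} \<union> {?a, arrow h})"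
      using conj(1) by (intro enteringI[OF k, of "[]"]) auto
    ultimately show ?thesis using conj(2) by metis
  next
    case lits
    consider l where "l2 = [l]" | l l' ks where "l2 = l # l' # ks"
      using lits(2) by (metis list.exhaust)
    then show ?thesis
    proof cases
      case 1
      then have lab: "label T u = insert (arrow h) (Lit ` set (literal_list L))" using lits by auto
      have "rule T u = None" by (rule rule_NoneI[OF u]) (auto simp: lab)
      then show ?thesis using lab L by (auto simp: literals_def)
    next
      case (2 l l' ks)
      let ?b = "bigand (map Lit (l' # ks))"
      have lab: "label T u = insert (arrow h) (insert (And (Lit l) ?b) (Lit ` set l1))"
        using lits(3) 2 by simp
      have r: "rule T u = Some (And (Lit l) ?b)"
        by (rule rule_SomeI[OF u]) (auto simp: lab simp del: bigand.simps)
      have "label T u - {And (Lit l) ?b} \<union> {Lit l, ?b} =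
          insert (arrow h) (insert ?b (Lit ` set (l1 @ [l])))"
        unfolding lab by auto
      then have "entering h (label T u - {And (Lit l) ?b} \<union> {Lit l, ?b})"
        using lits(1) 2 by (intro enteringI[OF k, of "l1 @ [l]" "l' # ks"]) auto
      then show ?thesis using r by blast
    qed
  qed
qed

lemma entering_modal_step:
  assumes e: "entering h (label T u)" and um: "u @ [m] \<in> nodes T" and h: "h \<in> hists"
    and k: "kind (last h) = Modal L"
  shows "hist_at (u @ [m]) = hist_at u"
    "m = Unary \<and> entering h (label T (u @ [m])) \<or>
     m \<notin> nonmodal_moves \<and> rule T u = None \<and> leaving h (label T (u @ [m]))"
proof -
  have u: "u \<in> nodes T" using tableau_child(1)[OF T um] .
  note c = tableau_child(2)[OF T um]
  from entering_modal_rule[OF e u h k]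
  have "hist_at (u @ [m]) = hist_at u \<and> (m = Unary \<and> entering h (label T (u @ [m])) \<or>
     m \<notin> nonmodal_moves \<and> rule T u = None \<and> leaving h (label T (u @ [m])))"
  proof (elim disjE exE conjE)
    fix a b assume *: "rule T u = Some (And a b)" "entering h (label T u - {And a b} \<union> {a, b})"
    then have "m = Unary" "label T (u @ [m]) = label T u - {And a b} \<union> {a, b}" using c by auto
    then show ?thesis using * hist_at_snoc(1)[of u] by simp
  next
    assume *: "rule T u = None" "arrow h \<in> label T u" "\<forall>B. Arrow B \<in> label T u \<longrightarrow> Arrow B = arrow h"
    obtain B \<psi> where B: "Arrow B \<in> label T u" "\<psi> |\<in>| B" "m = Modal_move B \<psi>"
      "label T (u @ [m]) = insert \<psi> {Disj_set B' | B'. Arrow B' \<in> label T u \<and> B' \<noteq> B}"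
      using c *(1) by (simp only: tableau_rule_simps) blast
    then have Bh: "B = fset_of_list (children h)" using *(3) by blast
    have "B' = B" if "Arrow B' \<in> label T u" for B' using *(3) Bh that by blast
    then have l: "label T (u @ [m]) = {\<psi>}" unfolding B(4) by blast
    have "\<psi> \<in> set (children h)" using B(2) Bh by (simp add: fset_of_list_elem)
    then have "leaving h {\<psi>}" using leaving_nth by (metis in_set_conv_nth)
    then show ?thesis using *(1) l B(3) hist_at_snoc(1)[of u] by simp
  qed
  then show "hist_at (u @ [m]) = hist_at u"
    "m = Unary \<and> entering h (label T (u @ [m])) \<or>
     m \<notin> nonmodal_moves \<and> rule T u = None \<and> leaving h (label T (u @ [m]))" by blast+
qed

lemma entering_body: "entering h {body h}"
  by (simp add: entering_def)

lemma entering_unary_step: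
  assumes "entering h (label T u)" "u @ [m] \<in> nodes T" "h \<in> hists"
    "m = Unary \<or> m \<in> nonmodal_moves \<and> kind (last h) \<noteq> Disjunctive"
  shows "entering h (label T (u @ [m])) \<and> hist_at (u @ [m]) = hist_at u"
proof (cases "kind (last h)")
  case Disjunctive
  then show ?thesis using splitting_step(1)[OF entering_splitting[OF assms(3) _ assms(1)] assms(2)] assms(4) by auto
next
  case (Modal L)
  then show ?thesis using entering_modal_step[OF assms(1-3) Modal] assms(4) by auto
qed

lemma entering_steps:
  assumes e: "entering h (label T u)" and h: "h \<in> hists"
  shows "u @ w \<in> nodes T \<Longrightarrow> set w \<subseteq> {Unary} \<or> set w \<subseteq> nonmodal_moves \<and> kind (last h) \<noteq> Disjunctive \<Longrightarrow>
    entering h (label T (u @ w)) \<and> hist_at (u @ w) = hist_at u"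
proof (induction w rule: rev_induct)
  case (snoc m w)
  have "u @ w \<in> nodes T" using tableau_child(1)[OF T, of "u @ w" m] snoc.prems(1) by simp
  then have "entering h (label T (u @ w)) \<and> hist_at (u @ w) = hist_at u"
    using snoc.IH snoc.prems(2) by auto
  then show ?case using entering_unary_step[of h "u @ w" m] snoc.prems h by auto
qed (use e in simp)

text \<open>The invariant under which \<open>last (hist_at u)\<close> is the vertex matching the
  core node \<open>u\<close>. Of the nodes within one collapsed disjunction, \<open>entering\<close>
  selects the top one.\<close>

definition core_at :: "'p move list \<Rightarrow> bool" where
  "core_at u \<longleftrightarrow> hist_at u \<in> hists \<and> entering (hist_at u) (label T u) \<and>
     (modal_node T u \<or> disj_node T u)"

lemma core_at_node: "core_at u \<Longrightarrow> u \<in> nodes T"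
  unfolding core_at_def modal_node_def disj_node_def by blast

lemma entering_kind:
  assumes "entering h (label T u)" "u \<in> nodes T" "h \<in> hists"
  shows "modal_node T u \<Longrightarrow> kind (last h) = Modal (literals (label T u))"
    "disj_node T u \<Longrightarrow> kind (last h) = Disjunctive"
proof -
  have d: "\<not> modal_node T u" if "kind (last h) = Disjunctive"
    using splitting_rule[OF entering_splitting[OF assms(3) that assms(1)] assms(2)]
    unfolding modal_node_def by (metis option.discI)
  show "kind (last h) = Modal (literals (label T u))" if "modal_node T u"
    using d that entering_modal_rule[OF assms] by (cases "kind (last h)") (auto simp: modal_node_def)
  show "kind (last h) = Disjunctive" if "disj_node T u"
    using that entering_modal_rule[OF assms] by (cases "kind (last h)") (auto simp: disj_node_def)
qed

lemma entry_entering: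
  assumes z: "x @ replicate i Unary \<in> nodes T" and e: "entering h (label T (x @ replicate i Unary))"
    and h: "h \<in> hists" "hist_at (x @ replicate i Unary) = h"
  obtains k where "entry T x = x @ replicate (i + k) Unary" "core_at (entry T x)" "hist_at (entry T x) = h"
proof -
  let ?z = "x @ replicate i Unary"
  obtain k where k: "modal_node T (?z @ replicate k Unary) \<or> disj_node T (?z @ replicate k Unary)"
    using entry_exists[OF sentence_\<Phi> T z] by blast
  have eq: "?z @ replicate k Unary = x @ replicate (i + k) Unary" by (simp add: replicate_add)
  have en: "entry T x = ?z @ replicate k Unary"
    using entry_eqI[OF T, of x "i + k"] k unfolding eq by simp
  have "?z @ replicate k Unary \<in> nodes T" using k by (auto simp: modal_node_def disj_node_def)
  moreover have "set (replicate k (Unary :: 'p move)) \<subseteq> {Unary}" by auto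
  ultimately have "entering h (label T (entry T x)) \<and> hist_at (entry T x) = h"
    unfolding en using entering_steps[OF e h(1)] h(2) by blast
  then show thesis using that[of k] en eq k h unfolding core_at_def by simp
qed

end

lemma length_branch_node [simp]: "length (branch_node b n) = n"
  by (simp add: branch_node_def)

lemma branch_node_Suc: "branch_node b (Suc n) = branch_node b n @ [b n]"
  by (simp add: branch_node_def)

lemma prefix_branch_node: "i \<le> j \<Longrightarrow> prefix (branch_node b i) (branch_node b j)"
  by (induction j) (auto simp: le_Suc_eq branch_node_Suc)

lemma branch_node_prefix:
  assumes "prefix y (branch_node b n)"
  shows "y = branch_node b (length y)"
proof -
  have "length y \<le> n" using prefix_length_le[OF assms] by simp
  then have "prefix (branch_node b (length y)) (branch_node b n)" by (rule prefix_branch_node)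
  then show ?thesis using assms prefix_length_prefix[of y "branch_node b n" "branch_node b (length y)"]
      prefix_length_prefix[of "branch_node b (length y)" "branch_node b n" y]
    by (simp add: prefix_order.antisym)
qed

section \<open>Core edges correspond to edges of the given graph\<close>

context core_like_tableau
begin

lemma start_nodes:
  "j \<le> q \<Longrightarrow> replicate j Unary \<in> nodes T \<and> label T (replicate j Unary) = {vacuous (q - j) (build [r])}"
proof (induction j)
  case 0
  then show ?case using tableau_root[OF T] by (simp add: \<Phi>_def)
next
  case (Suc j)
  then have "q - j = Suc (q - Suc j)" by simp
  then have l: "label T (replicate j Unary) = {bnd (q - j) (q - j) (vacuous (q - Suc j) (build [r]))}"
    using Suc by simp
  show ?case
    using child_singleton[OF _ l, of Unary] Suc by (simp flip: replicate_append_same)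
qed

lemma core_at_start: "core_at (entry T [])" "hist_at (entry T []) = [r]"
proof -
  let ?x = "replicate q Unary"
  have x: "?x \<in> nodes T" "label T ?x = {build [r]}" using start_nodes[of q] by auto
  have red: "reduct \<Phi> (build [r]) Unary {body [r]}" by (simp add: build_eq[of "[r]"])
  have z: "?x @ [Unary] \<in> nodes T" "label T (?x @ [Unary]) = {body [r]}"
    using child_singleton[OF x red] .
  have "rule T ?x = Some (build [r])" using rule_singleton[OF x] by (simp add: build_eq[of "[r]"])
  then have "hist_at (?x @ [Unary]) = [r]"
    using hist_at_snoc(2)[OF _ hists.root] by (simp add: build_eq[of "[r]"])
  \<comment> \<open>These \<open>Suc q\<close> unary moves remove the \<open>q\<close> vacuous
    binders and then the binder of the root history.\<close>
  moreover have "?x @ [Unary] = [] @ replicate (Suc q) Unary" by (simp add: replicate_append_same)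
  ultimately show "core_at (entry T [])" "hist_at (entry T []) = [r]"
    using entry_entering[of "[]" "Suc q" "[r]"] z entering_body[of "[r]"] hists.root by metis+
qed

lemma leaving_entry:
  assumes x: "x \<in> nodes T" and h: "h \<in> hists" "w \<in> succ (last h)" and l: "label T x = {child h w}"
  shows "core_at (entry T x)" "hist_at (entry T x) = next_hist h w"
    "prefix (x @ [Unary]) (entry T x)"
    "prefix (x @ [Unary]) y \<Longrightarrow> prefix y (entry T x) \<Longrightarrow> hist_at y = next_hist h w"
proof -
  note s = leaving_step[OF x h l]
  have g: "next_hist h w \<in> hists" using next_hist_in[OF h] .
  have e: "entering (next_hist h w) (label T (x @ [Unary]))" using s(2) entering_body by simp
  obtain k where k: "entry T x = x @ replicate (1 + k) Unary" "core_at (entry T x)"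
    "hist_at (entry T x) = next_hist h w"
    using entry_entering[of x 1 "next_hist h w"] s(1,3) e g by auto
  show "core_at (entry T x)" "hist_at (entry T x) = next_hist h w" by fact+
  show "prefix (x @ [Unary]) (entry T x)" unfolding k(1) by simp
  assume "prefix (x @ [Unary]) y" "prefix y (entry T x)"
  then obtain ys where ys: "y = (x @ [Unary]) @ ys" "prefix ys (replicate k Unary)"
    unfolding k(1) by (auto elim!: prefixE)
  then have "set ys \<subseteq> {Unary}" using set_mono_prefix[OF ys(2)] by auto
  moreover have "y \<in> nodes T"
    using tableau_prefix_closed[OF T] core_at_node[OF k(2)] \<open>prefix y (entry T x)\<close> by (auto elim!: prefixE)
  ultimately show "hist_at y = next_hist h w"
    using entering_steps[OF e g, of ys] s(3) ys(1) by simp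
qed

text \<open>\<open>segment u v w\<close>: on the way from \<open>u\<close> to \<open>v\<close> the history
  changes just once, at the node labelled by the child of the history for \<open>w\<close>.\<close>

definition segment :: "'p move list \<Rightarrow> 'p move list \<Rightarrow> 'a \<Rightarrow> bool" where
  "segment u v w \<longleftrightarrow> w \<in> succ (last (hist_at u)) \<and> hist_at v = next_hist (hist_at u) w \<and>
     (\<exists>x\<in>nodes T. prefix u x \<and> prefix (x @ [Unary]) v \<and> label T x = {child (hist_at u) w}) \<and>
     (\<forall>y. prefix u y \<longrightarrow> prefix y v \<longrightarrow> hist_at y = hist_at u \<or> hist_at y = hist_at v)"

lemma segmentI:
  assumes "w \<in> succ (last (hist_at u))" "hist_at v = next_hist (hist_at u) w"
    "x \<in> nodes T" "prefix u x" "prefix (x @ [Unary]) v" "label T x = {child (hist_at u) w}"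
    "\<And>y. prefix u y \<Longrightarrow> prefix y v \<Longrightarrow> hist_at y = hist_at u \<or> hist_at y = hist_at v"
  shows "segment u v w"
  using assms unfolding segment_def by blast

lemma modal_child:
  assumes u: "core_at u" "modal_node T u" and um: "u @ [m] \<in> nodes T"
  shows "leaving (hist_at u) (label T (u @ [m]))" "hist_at (u @ [m]) = hist_at u"
proof -
  have h: "hist_at u \<in> hists" "entering (hist_at u) (label T u)" using u(1) unfolding core_at_def by auto
  have k: "kind (last (hist_at u)) = Modal (literals (label T u))"
    using entering_kind(1)[OF h(2) core_at_node[OF u(1)] h(1) u(2)] .
  have "m \<noteq> Unary" using no_unary_child[OF T, of u "[]"] u(2) um by auto
  then show "leaving (hist_at u) (label T (u @ [m]))" "hist_at (u @ [m]) = hist_at u"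
    using entering_modal_step[OF h(2) um h(1) k] by blast+
qed

text \<open>Non-modal moves from a disjunctive core node stay in its disjunction or have crossed
  exactly one child. They cannot cross a second one: the vertex after a disjunctive vertex is modal,
  and its history is left only by the modal rule.\<close>

lemma disj_walk:
  assumes u: "core_at u" and k: "kind (last (hist_at u)) = Disjunctive"
  shows "u @ ws \<in> nodes T \<Longrightarrow> set ws \<subseteq> nonmodal_moves \<Longrightarrow>
    (splitting (hist_at u) (label T (u @ ws)) \<or> leaving (hist_at u) (label T (u @ ws))) \<and>
      (\<forall>y. prefix u y \<longrightarrow> prefix y (u @ ws) \<longrightarrow> hist_at y = hist_at u) \<or>
    (\<exists>w. segment u (u @ ws) w \<and> entering (next_hist (hist_at u) w) (label T (u @ ws)))"
proof (induction ws rule: rev_induct)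
  case Nil
  then show ?case using entering_splitting[OF _ k] u unfolding core_at_def
    by (auto dest: prefix_order.antisym)
next
  case (snoc m ws)
  let ?h = "hist_at u" and ?z = "u @ ws" and ?v = "u @ ws @ [m]"
  have h: "?h \<in> hists" using u unfolding core_at_def by blast
  have v: "?z @ [m] \<in> nodes T" using snoc.prems by simp
  note z = tableau_child(1)[OF T v]
  have pre: "prefix y (?z @ [m]) \<longleftrightarrow> y = ?z @ [m] \<or> prefix y ?z" for y by (rule prefix_snoc)
  have "set ws \<subseteq> nonmodal_moves" using snoc.prems(2) by simp
  from snoc.IH[OF z this]
  consider (split) "splitting ?h (label T ?z)" "\<forall>y. prefix u y \<longrightarrow> prefix y ?z \<longrightarrow> hist_at y = ?h"
    | (leave) "leaving ?h (label T ?z)" "\<forall>y. prefix u y \<longrightarrow> prefix y ?z \<longrightarrow> hist_at y = ?h"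
    | (enter) w where "segment u ?z w" "entering (next_hist ?h w) (label T ?z)"
    by (elim disjE conjE exE)
  then have "(splitting ?h (label T (?z @ [m])) \<or> leaving ?h (label T (?z @ [m]))) \<and>
      (\<forall>y. prefix u y \<longrightarrow> prefix y (?z @ [m]) \<longrightarrow> hist_at y = ?h) \<or>
    (\<exists>w. segment u (?z @ [m]) w \<and> entering (next_hist ?h w) (label T (?z @ [m])))"
  proof cases
    case split
    have "hist_at ?z = ?h" using split(2)[rule_format, of ?z] by simp
    then show ?thesis using splitting_step[OF split(1) v] split(2) pre by metis
  next
    case leave
    obtain w where w: "w \<in> succ (last ?h)" "label T ?z = {child ?h w}" using leavingE[OF leave(1) h] .
    note s = leaving_step[OF z h w]
    have m: "m = Unary" using s(5)[OF v] .
    have "segment u (?z @ [m]) w"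
    proof (rule segmentI[OF w(1) _ z])
      show "hist_at (?z @ [m]) = next_hist ?h w" using s(3) m by simp
      show "hist_at y = ?h \<or> hist_at y = hist_at (?z @ [m])" if "prefix u y" "prefix y (?z @ [m])" for y
        using that(1) leave(2)[rule_format, OF that(1)] pre[of y] that(2) by metis
    qed (use w m in auto)
    moreover have "entering (next_hist ?h w) (label T (?z @ [m]))" using s(2) m entering_body by simp
    ultimately show ?thesis by blast
  next
    case (enter w)
    have w: "w \<in> succ (last ?h)" "hist_at ?z = next_hist ?h w" using enter(1) unfolding segment_def by auto
    have "kind (last (next_hist ?h w)) \<noteq> Disjunctive"
      using disj_succ_modal[OF last_hists[OF h] k w(1)] by simp
    then have e: "entering (next_hist ?h w) (label T (?z @ [m]))" "hist_at (?z @ [m]) = hist_at ?z"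
      using entering_unary_step[OF enter(2) v next_hist_in[OF h w(1)]] snoc.prems(2) by auto
    obtain x where x: "x \<in> nodes T" "prefix u x" "prefix (x @ [Unary]) ?z" "label T x = {child ?h w}"
      using enter(1) unfolding segment_def by blast
    have "segment u (?z @ [m]) w"
    proof (rule segmentI[OF w(1) _ x(1,2) _ x(4)])
      show "hist_at (?z @ [m]) = next_hist ?h w" using e(2) w(2) by simp
      show "prefix (x @ [Unary]) (?z @ [m])" using x(3) pre by blast
      show "hist_at y = ?h \<or> hist_at y = hist_at (?z @ [m])" if "prefix u y" "prefix y (?z @ [m])" for y
        using that enter(1) pre e(2) unfolding segment_def by metis
    qed
    then show ?thesis using e by blast
  qed
  then show ?case by simp
qed

lemma not_modal:
  assumes "h \<in> hists" "splitting h (label T v) \<or> leaving h (label T v)" "v \<in> nodes T"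
  shows "\<not> modal_node T v"
  using assms(2)
proof
  assume "splitting h (label T v)"
  from splitting_rule[OF this assms(3)] show ?thesis by (auto simp: modal_node_def)
next
  assume "leaving h (label T v)"
  then obtain w where "w \<in> succ (last h)" "label T v = {child h w}" using leavingE assms(1) by blast
  from leaving_step(4)[OF assms(3,1) this] show ?thesis by (simp add: modal_node_def)
qed

text \<open>The forth direction of the bisimulation. In the disjunctive case the end of the edge is
  modal, whereas \<open>splitting\<close> and \<open>leaving\<close> labels are reducible, so a
  child has been crossed by then.\<close>

lemma core_edge_segment:
  assumes u: "core_at u" and e: "core_edge T u v"
  shows "core_at v \<and> (\<exists>w. segment u v w)"
proof -
  let ?h = "hist_at u"
  have h: "?h \<in> hists" using u unfolding core_at_def by blast
  consider (modal) B \<psi> where "modal_node T u" "u @ [Modal_move B \<psi>] \<in> nodes T"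
      "v = entry T (u @ [Modal_move B \<psi>])"
    | (disj) ws where "disj_node T u" "modal_node T v" "set ws \<subseteq> nonmodal_moves" "v = u @ ws"
    using e unfolding core_edge_def by blast
  then show ?thesis
  proof cases
    case modal
    let ?x = "u @ [Modal_move B \<psi>]"
    note c = modal_child[OF u modal(1,2)]
    obtain w where w: "w \<in> succ (last ?h)" "label T ?x = {child ?h w}" using leavingE[OF c(1) h] .
    note l = leaving_entry[OF modal(2) h w]
    have "segment u v w"
    proof (rule segmentI[OF w(1) _ modal(2) _ _ w(2)])
      show "hist_at v = next_hist ?h w" "prefix (?x @ [Unary]) v" using l(2,3) modal(3) by auto
      show "hist_at y = ?h \<or> hist_at y = hist_at v" if "prefix u y" "prefix y v" for y
      proof -
        obtain vs where "v = ?x @ [Unary] @ vs" using l(3) modal(3) by (auto elim!: prefixE)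
        moreover obtain ys zs where ys: "y = u @ ys" "v = y @ zs" using \<open>prefix u y\<close> \<open>prefix y v\<close>
          by (auto elim!: prefixE)
        ultimately have "ys @ zs = Modal_move B \<psi> # Unary # vs" by simp
        then have "ys = [] \<or> ys = [Modal_move B \<psi>] \<or> prefix [Modal_move B \<psi>, Unary] ys"
          by (auto simp: append_eq_Cons_conv)
        then have "y = u \<or> y = ?x \<or> prefix (?x @ [Unary]) y" using ys(1) by auto
        then show ?thesis using l(2) l(4)[of y] that(2) modal(3) c(2) by auto
      qed
    qed simp
    then show ?thesis using l(1) modal(3) by blast
  next
    case disj
    have k: "kind (last ?h) = Disjunctive"
      using entering_kind(2)[OF _ core_at_node[OF u] h disj(1)] u unfolding core_at_def by blast
    have v: "v \<in> nodes T" using disj(2) unfolding modal_node_def by blast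
    obtain w where w: "segment u v w" "entering (next_hist ?h w) (label T v)"
      using disj_walk[OF u k, of ws] not_modal[OF h _ v] v disj by blast
    then have "w \<in> succ (last ?h)" "hist_at v = next_hist ?h w" unfolding segment_def by auto
    then show ?thesis using w next_hist_in[OF h] disj(2) unfolding core_at_def by auto
  qed
qed

lemma splitting_reaches:
  assumes u: "u \<in> nodes T" and l: "label T u = {body h}" and h: "h \<in> hists"
    and k: "kind (last h) = Disjunctive"
  shows "i < length (children h) \<Longrightarrow> u @ replicate i RightDisj \<in> nodes T \<and>
    label T (u @ replicate i RightDisj) = {bigor (drop i (children h))}"
proof (induction i)
  case 0
  then show ?case using u l k by (simp add: body_children node_formula_def)
next
  case (Suc i)
  let ?x = "u @ replicate i RightDisj"
  have x: "?x \<in> nodes T" "label T ?x = {bigor (drop i (children h))}" using Suc by auto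
  have "drop i (children h) = children h ! i # children h ! Suc i # drop (Suc (Suc i)) (children h)"
    using Suc.prems by (simp add: Cons_nth_drop_Suc)
  moreover have "drop (Suc i) (children h) = children h ! Suc i # drop (Suc (Suc i)) (children h)"
    using Suc.prems by (simp add: Cons_nth_drop_Suc)
  ultimately have "bigor (drop i (children h)) = Or (children h ! i) (bigor (drop (Suc i) (children h)))"
    by (metis bigor.simps(3))
  then have "reduct \<Phi> (bigor (drop i (children h))) RightDisj {bigor (drop (Suc i) (children h))}"
    by simp
  from child_singleton[OF x this] show ?case by (simp flip: replicate_append_same)
qed

text \<open>The back direction of the bisimulation: the addresses of the required nodes are given
  explicitly, except for the last stretch to a modal node, which exists by termination of the
  non-modal rules.\<close>

lemma core_edge_exists:
  assumes u: "core_at u" and w: "w \<in> succ (last (hist_at u))"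
  shows "\<exists>v. core_edge T u v \<and> hist_at v = next_hist (hist_at u) w"
proof -
  let ?h = "hist_at u"
  have h: "?h \<in> hists" "entering ?h (label T u)" and un: "u \<in> nodes T"
    using u core_at_node[OF u] unfolding core_at_def by auto
  have "w \<in> set (succs (last ?h))" using w succs(1) by blast
  then have child: "child ?h w \<in> set (children ?h)" by (simp add: children_def)
  show ?thesis
  proof (cases "kind (last ?h)")
    case (Modal L)
    then have m: "modal_node T u" using u entering_kind(2)[OF h(2) un h(1)] unfolding core_at_def by auto
    then have r: "rule T u = None" by (simp add: modal_node_def)
    have "arrow ?h \<in> label T u" "literals (label T u) = L"
      using entering_modal_rule[OF h(2) un h(1) Modal] r by auto
    \<comment> \<open>An inconsistent modal node has no children in the tableau; the successor
      \<open>w\<close> excludes this.\<close>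
    moreover have "consistent L" using consistent_literals[OF last_hists[OF h(1)] Modal w] .
    ultimately have "\<exists>\<Gamma>'. tableau_rule \<Phi> (label T u) (rule T u)
        (Modal_move (fset_of_list (children ?h)) (child ?h w)) \<Gamma>'"
      using child r by (simp add: fset_of_list_elem)
    then obtain \<Gamma>' where t: "tableau_rule \<Phi> (label T u) (rule T u)
        (Modal_move (fset_of_list (children ?h)) (child ?h w)) \<Gamma>'" by blast
    let ?x = "u @ [Modal_move (fset_of_list (children ?h)) (child ?h w)]"
    have x: "?x \<in> nodes T" using tableau_childI(1)[OF T un t] .
    have "child ?h w \<in> label T ?x" using tableau_childI(2)[OF T un t] t r by auto
    moreover have "leaving ?h (label T ?x)" using modal_child(1)[OF u m x] .
    ultimately have "label T ?x = {child ?h w}" unfolding leaving_def by auto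
    from leaving_entry(2)[OF x h(1) w this] show ?thesis
      using m x unfolding core_edge_def by blast
  next
    case Disjunctive
    have d: "disj_node T u" using u entering_kind(1)[OF h(2) un h(1)] Disjunctive unfolding core_at_def by auto
    have l: "label T u = {body ?h}" using h entering_disj[OF h(1) Disjunctive] by blast
    obtain i where i: "i < length (children ?h)" "children ?h ! i = child ?h w"
      using child by (metis in_set_conv_nth)
    let ?y = "u @ replicate i RightDisj"
    have y: "?y \<in> nodes T" "label T ?y = {bigor (drop i (children ?h))}"
      using splitting_reaches[OF un l h(1) Disjunctive i(1)] by auto
    \<comment> \<open>The child at position \<open>i\<close> is reached by \<open>i\<close> moves to
      the right and one to the left, except that the last child is itself the final right
      disjunct.\<close>
    have "\<exists>x ws. x = u @ ws \<and> x \<in> nodes T \<and> label T x = {child ?h w} \<and> set ws \<subseteq> nonmodal_moves"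
    proof (cases "Suc i < length (children ?h)")
      case False
      then have "drop i (children ?h) = [child ?h w]"
        using i Cons_nth_drop_Suc[of i "children ?h"] by simp
      then have "label T ?y = {child ?h w}" using y(2) by simp
      moreover have "set (replicate i RightDisj) \<subseteq> nonmodal_moves" by auto
      ultimately show ?thesis using y(1) by blast
    next
      case True
      have "drop i (children ?h) = child ?h w # children ?h ! Suc i # drop (Suc (Suc i)) (children ?h)"
        using True i by (simp add: Cons_nth_drop_Suc flip: i(2))
      then have "reduct \<Phi> (bigor (drop i (children ?h))) LeftDisj {child ?h w}" by simp
      note x = child_singleton[OF y this]
      have "set (replicate i RightDisj @ [LeftDisj]) \<subseteq> nonmodal_moves" by auto
      moreover have "?y @ [LeftDisj] = u @ (replicate i RightDisj @ [LeftDisj])" by simp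
      ultimately show ?thesis using x by metis
    qed
    then obtain x ws where x: "x = u @ ws" "x \<in> nodes T" "label T x = {child ?h w}" "set ws \<subseteq> nonmodal_moves"
      by blast
    let ?g = "next_hist ?h w"
    note s = leaving_step[OF x(2) h(1) w x(3)]
    obtain vs where vs: "set vs \<subseteq> nonmodal_moves" "modal_node T ((x @ [Unary]) @ vs)"
      using reaches_modal_node[OF sentence_\<Phi> T s(1)] by blast
    have e: "entering ?g (label T (x @ [Unary]))" using s(2) entering_body by simp
    have "kind (last ?g) \<noteq> Disjunctive" using disj_succ_modal[OF last_hists[OF h(1)] Disjunctive w] by simp
    moreover have "(x @ [Unary]) @ vs \<in> nodes T" using vs(2) unfolding modal_node_def by blast
    ultimately have "hist_at ((x @ [Unary]) @ vs) = ?g"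
      using entering_steps[OF e next_hist_in[OF h(1) w], of vs] vs(1) s(3) by simp
    moreover have "core_edge T u ((x @ [Unary]) @ vs)" unfolding core_edge_def
    proof (intro disjI2 conjI exI)
      show "set (ws @ [Unary] @ vs) \<subseteq> nonmodal_moves" using x(4) vs(1) by simp
    qed (use d vs(2) x(1) in auto)
    ultimately show ?thesis by blast
  qed
qed

text \<open>Unlike \<open>core_at\<close>, this covers all nodes, as needed for the traces: every
  node belongs to the initial run of vacuous binders or to one of the three phases.\<close>

lemma node_label:
  "u \<in> nodes T \<Longrightarrow> (\<exists>j. label T u = {vacuous j (build [r])}) \<or>
     hist_at u \<in> hists \<and> (entering (hist_at u) (label T u) \<or> splitting (hist_at u) (label T u) \<or>
       leaving (hist_at u) (label T u))"
proof (induction u rule: rev_induct)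
  case Nil
  then show ?case using tableau_root[OF T] by (auto simp: \<Phi>_def)
next
  case (snoc m u)
  let ?h = "hist_at u" and ?v = "u @ [m]"
  have u: "u \<in> nodes T" using tableau_child(1)[OF T snoc.prems] .
  from snoc.IH[OF u]
  consider (vac) j where "label T u = {vacuous j (build [r])}"
    | (enter) "?h \<in> hists" "entering ?h (label T u)"
    | (split) "?h \<in> hists" "splitting ?h (label T u)"
    | (leave) "?h \<in> hists" "leaving ?h (label T u)" by blast
  then show ?case
  proof cases
    case (vac j)
    show ?thesis
    proof (cases j)
      case 0
      then have l: "label T u = {build [r]}" using vac by simp
      have "reducible \<Phi> (build [r])" by (simp add: build_eq[of "[r]"])
      then have *: "rule T u = Some (build [r])" "reduct \<Phi> (build [r]) m (label T ?v)"
        using rule_singleton[OF u l] label_singleton[OF snoc.prems l] by auto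
      have "hist_at ?v = [r]" using *(1) hists.root by (intro hist_at_snoc(2)) (simp_all add: build_eq[of "[r]"])
      moreover have "label T ?v = {body [r]}"
        using *(2) unfolding build_eq[of "[r]"] bnd_simps by (rule conjunct2)
      ultimately show ?thesis using entering_body hists.root by simp
    next
      case (Suc i)
      then have "label T u = {bnd j j (vacuous i (build [r]))}" using vac by simp
      from label_singleton[OF snoc.prems this] show ?thesis by auto
    qed
  next
    case enter
    show ?thesis
    proof (cases "kind (last ?h)")
      case Disjunctive
      then show ?thesis using splitting_step[OF entering_splitting[OF enter(1) _ enter(2)] snoc.prems] enter(1) by metis
    next
      case (Modal L)
      then show ?thesis using entering_modal_step[OF enter(2) snoc.prems enter(1)] enter(1) by metis
    qed
  next
    case split
    then show ?thesis using splitting_step[OF split(2) snoc.prems] by metis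
  next
    case leave
    obtain w where w: "w \<in> succ (last ?h)" "label T u = {child ?h w}" using leavingE[OF leave(2,1)] .
    note s = leaving_step[OF u leave(1) w]
    have "m = Unary" using s(5)[OF snoc.prems] .
    then show ?thesis using s(2,3) next_hist_in[OF leave(1) w(1)] entering_body by simp
  qed
qed

lemma bigand_Lit_not_Arrow: "bigand (map Lit ls) \<noteq> Arrow B"
  by (induction ls rule: induct_list012) auto

lemma has_main_label:
  assumes "u \<in> nodes T"
  shows "has_main (label T u)"
proof -
  have "has_main \<Gamma>" if "entering h \<Gamma>" for h \<Gamma>
    using that unfolding entering_def
  proof (elim disjE exE conjE)
    fix L l1 l2
    assume \<Gamma>: "\<Gamma> = insert (arrow h) (insert (bigand (map Lit l2)) (Lit ` set l1))"
    have "B' = fset_of_list (children h)" if "Arrow B' \<in> \<Gamma>" for B'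
      using that bigand_Lit_not_Arrow[of l2 B'] unfolding \<Gamma> by auto
    moreover have "arrow h \<in> \<Gamma>" unfolding \<Gamma> by blast
    ultimately show ?thesis unfolding has_main_def by blast
  qed (simp add: has_main_def)
  moreover have "has_main \<Gamma>" if "splitting h \<Gamma>" for h \<Gamma>
    using that unfolding splitting_def has_main_def by blast
  moreover have "has_main \<Gamma>" if "leaving h \<Gamma>" for h \<Gamma>
    using that unfolding leaving_def has_main_def by blast
  moreover have "has_main {p}" for p :: "'p fm" unfolding has_main_def by blast
  ultimately show ?thesis using node_label[OF assms] by metis
qed

lemma splitting_rule_Or:
  "splitting h (label T u) \<Longrightarrow> u \<in> nodes T \<Longrightarrow> \<exists>a b. rule T u = Some (Or a b)"
  by (erule splitting_rule) blast+

text \<open>Only the \<open>leaving\<close> phase offers a variable to a rule, namely as the child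
  for a back edge, and the step enters the history of that variable.\<close>

lemma var_rule:
  assumes um: "u @ [m] \<in> nodes T" and r: "rule T u = Some (Var X)"
  shows "hist_at (u @ [m]) \<in> hists \<and> X = var (hist_at (u @ [m]))"
proof -
  let ?h = "hist_at u"
  have u: "u \<in> nodes T" using tableau_child(1)[OF T um] .
  from node_label[OF u]
  consider (vac) j where "label T u = {vacuous j (build [r])}"
    | (enter) "?h \<in> hists" "entering ?h (label T u)"
    | (split) "?h \<in> hists" "splitting ?h (label T u)"
    | (leave) "?h \<in> hists" "leaving ?h (label T u)" by blast
  then show ?thesis
  proof cases
    case (vac j)
    have "Var X \<in> label T u" using tableau_principal[OF T u r] by blast
    moreover have "vacuous j (build [r]) \<noteq> Var X" by (cases j) (simp_all add: build_eq[of "[r]"])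
    ultimately show ?thesis using vac by simp
  next
    case enter
    show ?thesis
    proof (cases "kind (last ?h)")
      case Disjunctive
      from splitting_rule_Or[OF entering_splitting[OF enter(1) this enter(2)] u] show ?thesis using r by simp
    next
      case (Modal L)
      from entering_modal_rule[OF enter(2) u enter(1) this] show ?thesis using r by auto
    qed
  next
    case split
    from splitting_rule_Or[OF split(2) u] show ?thesis using r by simp
  next
    case leave
    obtain w where w: "w \<in> succ (last ?h)" "label T u = {child ?h w}" using leavingE[OF leave(2,1)] .
    note s = leaving_step[OF u leave(1) w]
    have "m = Unary" using s(5)[OF um] .
    moreover have "child ?h w = Var X" using s(4) r by simp
    then have "X = var (next_hist ?h w)" using reducible_child(3)[OF leave(1) w(1)] by simp
    ultimately show ?thesis using s(3) next_hist_in[OF leave(1) w(1)] by simp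
  qed
qed

section \<open>Parity of the infinite paths of the core\<close>

lemma core_path:
  assumes \<pi>: "infinite_path (core T) \<pi>"
  shows "core_at (\<pi> n)" "\<exists>w. segment (\<pi> n) (\<pi> (Suc n)) w"
proof -
  have e: "core_edge T (\<pi> n) (\<pi> (Suc n))" for n using \<pi> unfolding infinite_path_def core_def by simp
  show c: "core_at (\<pi> n)" for n
  proof (induction n)
    case 0
    then show ?case using \<pi> core_at_start(1) unfolding infinite_path_def core_def by simp
  next
    case (Suc n)
    then show ?case using core_edge_segment e by blast
  qed
  show "\<exists>w. segment (\<pi> n) (\<pi> (Suc n)) w" using core_edge_segment[OF c e] by blast
qed

lemma hist_path_core_path:
  assumes \<pi>: "infinite_path (core T) \<pi>"
  shows "hist_path (\<lambda>n. hist_at (\<pi> n))"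
  unfolding hist_path_def
proof (intro allI conjI)
  fix n
  show "hist_at (\<pi> n) \<in> hists" using core_path(1)[OF \<pi>] unfolding core_at_def by blast
  show "\<exists>w\<in>succ (last (hist_at (\<pi> n))). hist_at (\<pi> (Suc n)) = next_hist (hist_at (\<pi> n)) w"
    using core_path(2)[OF \<pi>, of n] unfolding segment_def by blast
qed

lemma core_path_strict:
  assumes \<pi>: "infinite_path (core T) \<pi>"
  shows "strict_prefix (\<pi> n) (\<pi> (Suc n))"
proof -
  obtain x where x: "prefix (\<pi> n) x" "prefix (x @ [Unary]) (\<pi> (Suc n))"
    using core_path(2)[OF \<pi>] unfolding segment_def by blast
  then have "prefix (\<pi> n) (\<pi> (Suc n))" by (meson append_prefixD prefix_order.trans)
  moreover have "length (\<pi> n) < length (\<pi> (Suc n))"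
    using prefix_length_le[OF x(1)] prefix_length_le[OF x(2)] by simp
  ultimately show ?thesis by (auto simp: strict_prefix_def)
qed

lemma core_path_branch:
  assumes \<pi>: "infinite_path (core T) \<pi>"
  shows "n \<le> length (\<pi> n)" "\<exists>b. infinite_branch T b \<and> (\<forall>n. \<exists>k. \<pi> n = branch_node b k)"
proof -
  note sp = core_path_strict[OF \<pi>]
  have mono: "prefix (\<pi> i) (\<pi> j)" if "i \<le> j" for i j
    using that
  proof (induction j rule: dec_induct)
    case (step j)
    show ?case by (rule prefix_order.trans[OF step.IH prefix_order.less_imp_le[OF sp]])
  qed simp
  have nth: "ys ! k = xs ! k" if "prefix xs ys" "k < length xs" for k and xs ys :: "'p move list"
    using that by (auto simp: prefix_def nth_append)
  show len: "n \<le> length (\<pi> n)" for n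
  proof (induction n)
    case (Suc n)
    then show ?case using prefix_length_less[OF sp, of n] by simp
  qed simp
  \<comment> \<open>The node \<open>\<pi> (Suc k)\<close> has length at least \<open>Suc k\<close>,
    so the index is valid; later nodes extend it and agree there.\<close>
  define b where "b k = \<pi> (Suc k) ! k" for k
  have b: "\<pi> n = branch_node b (length (\<pi> n))" for n
  proof (rule nth_equalityI)
    fix k assume k: "k < length (\<pi> n)"
    have "\<pi> (Suc k) ! k = \<pi> n ! k"
    proof (cases "Suc k \<le> n")
      case True
      then show ?thesis using nth[OF mono[OF True], of k] len[of "Suc k"] by simp
    next
      case False
      then show ?thesis using nth[OF mono[of n "Suc k"] k] by simp
    qed
    then show "\<pi> n ! k = branch_node b (length (\<pi> n)) ! k" using k by (simp add: branch_node_def b_def)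
  qed simp
  have "branch_node b k \<in> nodes T" for k
  proof -
    have "prefix (branch_node b k) (\<pi> k)" using prefix_branch_node[OF len[of k], of b] b[of k] by simp
    then obtain zs where "\<pi> k = branch_node b k @ zs" by (auto elim: prefixE)
    then show ?thesis using tableau_prefix_closed[OF T] core_at_node[OF core_path(1)[OF \<pi>]] by metis
  qed
  then show "\<exists>b. infinite_branch T b \<and> (\<forall>n. \<exists>k. \<pi> n = branch_node b k)"
    using b unfolding infinite_branch_def by metis
qed

context
  fixes \<pi> :: "nat \<Rightarrow> 'p move list" and b and g
  assumes \<pi>: "infinite_path (core T) \<pi>" and b: "infinite_branch T b" "\<And>n. \<exists>k. \<pi> n = branch_node b k"
    and g: "topmost (\<lambda>n. hist_at (\<pi> n)) g"
begin

lemma \<pi>_branch: "\<pi> n = branch_node b (length (\<pi> n))"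
  using b(2)[of n] by auto

text \<open>A regeneration on the branch falls into some segment of the path, where only the
  histories of its two ends occur. Sufficiently late these both extend \<open>g\<close>.\<close>

lemma regenerated_visited:
  assumes "\<exists>\<^sub>\<infinity>n. rule T (branch_node b n) = Some (Var X)"
  shows "\<exists>h\<in>hists. X = var h \<and> prefix g h"
proof -
  obtain N where N: "\<And>n. n \<ge> N \<Longrightarrow> prefix g (hist_at (\<pi> n))"
    using g unfolding topmost_def MOST_nat_le by blast
  obtain k where k: "k \<ge> length (\<pi> N)" "rule T (branch_node b k) = Some (Var X)"
    using assms unfolding INFM_nat_le by blast
  let ?y = "branch_node b (Suc k)"
  have "?y \<in> nodes T" using b(1) unfolding infinite_branch_def by blast
  then have X: "hist_at ?y \<in> hists" "X = var (hist_at ?y)"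
    using var_rule[of "branch_node b k" "b k" X] k(2) by (simp_all add: branch_node_Suc)
  \<comment> \<open>The number of the segment containing position \<open>k\<close>: by minimality
    the length of \<open>\<pi> n\<close> is at most \<open>k\<close>.\<close>
  define n where "n = (LEAST n. k < length (\<pi> (Suc n)))"
  have "k < length (\<pi> (Suc k))" using core_path_branch(1)[OF \<pi>, of "Suc k"] by simp
  then have n: "k < length (\<pi> (Suc n))" unfolding n_def by (rule LeastI)
  have "N \<le> n"
  proof (rule ccontr)
    assume "\<not> N \<le> n"
    have mono: "length (\<pi> i) \<le> length (\<pi> (Suc i))" for i
      using prefix_length_less[OF core_path_strict[OF \<pi>, of i]] by simp
    have "length (\<pi> (Suc n)) \<le> length (\<pi> N)"
      using \<open>\<not> N \<le> n\<close> lift_Suc_mono_le[of "\<lambda>i. length (\<pi> i)", OF mono] by simp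
    then show False using n k(1) by simp
  qed
  have "length (\<pi> n) \<le> k"
  proof (cases n)
    case 0
    then show ?thesis using \<open>N \<le> n\<close> k(1) by simp
  next
    case (Suc n')
    then show ?thesis using not_less_Least[of n' "\<lambda>n. k < length (\<pi> (Suc n))"] unfolding n_def by simp
  qed
  then have "prefix (\<pi> n) ?y" using prefix_branch_node[of "length (\<pi> n)" "Suc k" b] \<pi>_branch[of n] by simp
  moreover have "prefix ?y (\<pi> (Suc n))"
    using prefix_branch_node[of "Suc k" "length (\<pi> (Suc n))" b] \<pi>_branch[of "Suc n"] n by simp
  ultimately have "hist_at ?y = hist_at (\<pi> n) \<or> hist_at ?y = hist_at (\<pi> (Suc n))"
    using core_path(2)[OF \<pi>, of n] unfolding segment_def by blast
  then have "prefix g (hist_at ?y)" using N \<open>N \<le> n\<close> by (metis le_SucI)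
  then show ?thesis using X by blast
qed

text \<open>It matters that the label is a singleton: every trace on the branch, and not only that
  of the main formulas, regenerates the variable of \<open>g\<close>.\<close>

lemma topmost_regenerated:
  "\<exists>\<^sub>\<infinity>n. label T (branch_node b n) = {Var (var g)} \<and> rule T (branch_node b n) = Some (Var (var g))"
  unfolding INFM_nat_le
proof
  fix m
  obtain n where n: "n \<ge> m" "prefix g (hist_at (\<pi> n))" "hist_at (\<pi> (Suc n)) = g"
    using g unfolding topmost_def INFM_nat_le by blast
  let ?h = "hist_at (\<pi> n)"
  obtain w x where w: "w \<in> succ (last ?h)" "g = next_hist ?h w" and
    x: "x \<in> nodes T" "prefix (\<pi> n) x" "prefix (x @ [Unary]) (\<pi> (Suc n))" "label T x = {child ?h w}"
    using core_path(2)[OF \<pi>, of n] n(3) unfolding segment_def by blast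
  have h: "?h \<in> hists" using core_path(1)[OF \<pi>] unfolding core_at_def by blast
  \<comment> \<open>Otherwise \<open>g\<close> would be longer than \<open>?h\<close>, although it
    is a prefix of it.\<close>
  have "loops ?h w"
  proof (rule ccontr)
    assume "\<not> loops ?h w"
    then have "g = ?h @ [w]" using w(2) next_hist_new by simp
    then show False using prefix_length_le[OF n(2)] by simp
  qed
  then have c: "child ?h w = Var (var g)" using w(2) by (simp add: child_def)
  have "prefix x (\<pi> (Suc n))" using x(3) by (auto elim!: prefixE)
  then have xb: "x = branch_node b (length x)" using branch_node_prefix \<pi>_branch by metis
  have "m \<le> length x"
    using n(1) core_path_branch(1)[OF \<pi>, of n] prefix_length_le[OF x(2)] by linarith
  moreover have "rule T x = Some (Var (var g))" using leaving_step(4)[OF x(1) h w(1) x(4)] c by simp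
  ultimately show "\<exists>n\<ge>m. label T (branch_node b n) = {Var (var g)} \<and>
      rule T (branch_node b n) = Some (Var (var g))"
    using x(4) c xb by metis
qed

text \<open>Variables regenerated infinitely often belong to extensions of \<open>g\<close>, whose
  binders are subformulas of \<open>build g\<close>; and any trace regenerates the variable of
  \<open>g\<close>. So this is the outermost one, whatever the trace.\<close>

lemma odd_branch_topmost: "odd_branch T b \<longleftrightarrow> odd (\<Omega> (last g))"
proof
  have gh: "g \<in> hists" using g unfolding topmost_def by blast
  note fT = tableau_root(1)[OF T]
  have uniq: "unique_binders \<Phi>" using sentence_\<Phi> by (simp add: sentence_def)
  have bu: "binds (var h) (body h) (build h)" for h by (simp add: build_eq[of h])
  have regen: "\<exists>h\<in>hists. X = var h \<and> prefix g h" if "regenerated_inf T b t X" for t X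
  proof -
    have "\<exists>\<^sub>\<infinity>n. rule T (branch_node b n) = Some (Var X)"
      using that unfolding regenerated_inf_def by (rule INFM_mono) blast
    then show ?thesis by (rule regenerated_visited)
  qed
  {
    assume "odd_branch T b"
    then obtain t X \<phi> where t: "is_trace T b t" and X: "Mu X \<phi> \<in> sf \<Phi>" "regenerated_inf T b t X"
      and out: "\<And>Y \<psi> \<beta>. \<beta> \<in> sf \<Phi> \<Longrightarrow> regenerated_inf T b t Y \<Longrightarrow> binds Y \<psi> \<beta> \<Longrightarrow> \<beta> \<in> sf (Mu X \<phi>)"
      unfolding odd_branch_def mu_trace_def fT by blast
    obtain h where h: "h \<in> hists" "X = var h" "prefix g h" using regen[OF X(2)] by blast
    have "binds (var h) \<phi> (Mu X \<phi>)" using h by (simp add: binds_def)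
    then have eq: "Mu X \<phi> = build h" using binds_unique[OF uniq X(1) build_in_\<Phi>[OF h(1)] _ bu] by blast
    have "t n = Var (var g)" if "label T (branch_node b n) = {Var (var g)}" for n
    proof -
      have "t n \<in> label T (branch_node b n)" using t unfolding is_trace_def by blast
      then show ?thesis using that by simp
    qed
    then have "regenerated_inf T b t (var g)"
      unfolding regenerated_inf_def by (intro INFM_mono[OF topmost_regenerated]) blast
    \<comment> \<open>The outermost binder \<open>build h\<close> contains that of \<open>g\<close>,
      but also lies inside it; formulas that are subformulas of each other are equal.\<close>
    then have "build g \<in> sf (build h)" using out[OF build_in_\<Phi>[OF gh] _ bu] eq by simp
    moreover have "build h \<in> sf (build g)" using build_in_sf[OF h(1,3) hists_not_Nil[OF gh]] .
    ultimately have "build g = build h" using sf_size by (metis less_asym)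
    then have "bnd (\<Omega> (last g)) (var g) (body g) = Mu X \<phi>" using eq by (simp add: build_eq[of g])
    then show "odd (\<Omega> (last g))" by (simp add: bnd_def split: if_splits)
  }
  assume odd: "odd (\<Omega> (last g))"
  \<comment> \<open>For the converse one trace has to be exhibited; the main formulas provide
    it.\<close>
  define t where "t n = main_formula (label T (branch_node b n))" for n
  have nodes: "branch_node b n \<in> nodes T" for n using b(1) unfolding infinite_branch_def by blast
  have "is_trace T b t" unfolding is_trace_def fT
  proof (intro allI conjI)
    fix n
    show "t n \<in> label T (branch_node b n)" unfolding t_def using main_in[OF has_main_label[OF nodes]] .
    have "tableau_rule \<Phi> (label T (branch_node b n)) (rule T (branch_node b n)) (b n)
        (label T (branch_node b (Suc n)))"
      using tableau_child(2)[OF T, of "branch_node b n" "b n"] nodes[of "Suc n"]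
      by (simp add: branch_node_Suc)
    from trace_step_main[OF this has_main_label[OF nodes] has_main_label[OF nodes]]
    show "trace_step \<Phi> (rule T (branch_node b n)) (b n) (t n) (t (Suc n))" unfolding t_def .
  qed
  moreover have "Mu (var g) (body g) \<in> sf \<Phi>"
    using build_in_\<Phi>[OF gh] odd by (simp add: build_eq[of g] bnd_def)
  moreover have "regenerated_inf T b t (var g)"
    unfolding regenerated_inf_def t_def by (rule INFM_mono[OF topmost_regenerated]) simp
  moreover have "\<beta> \<in> sf (Mu (var g) (body g))"
    if \<beta>: "\<beta> \<in> sf \<Phi>" "binds Y \<psi> \<beta>" and Y: "regenerated_inf T b t Y" for Y \<psi> \<beta>
  proof -
    obtain h where h: "h \<in> hists" "Y = var h" "prefix g h" using regen[OF Y] by blast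
    then have "\<beta> = build h" using binds_unique[OF uniq \<beta>(1) build_in_\<Phi>[OF h(1)] \<beta>(2)] bu by blast
    moreover have "build h \<in> sf (build g)" using build_in_sf[OF h(1,3) hists_not_Nil[OF gh]] .
    ultimately show ?thesis using odd by (simp add: build_eq[of g] bnd_def)
  qed
  ultimately show "odd_branch T b" unfolding odd_branch_def mu_trace_def fT by blast
qed

end

text \<open>The core calls a path odd if some branch through it is odd. By
  \<open>odd_branch_topmost\<close> all branches through the path agree, and there is one.\<close>

lemma odd_path_core:
  assumes \<pi>: "infinite_path (core T) \<pi>"
  shows "odd_path (core T) \<pi> \<longleftrightarrow> odd (Max {k. \<exists>\<^sub>\<infinity>n. \<Omega> (last (hist_at (\<pi> n))) = k})"
proof -
  obtain g where g: "topmost (\<lambda>n. hist_at (\<pi> n)) g"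
    using topmost_exists[OF hist_path_core_path[OF \<pi>]] by blast
  have "odd_path (core T) \<pi> \<longleftrightarrow> odd (\<Omega> (last g))"
    using odd_branch_topmost[OF \<pi> _ _ g] core_path_branch(2)[OF \<pi>] by (auto simp: core_def)
  then show ?thesis using odd_Max_topmost[OF hist_path_core_path[OF \<pi>] g] by simp
qed

lemma core_bisimilar:
  assumes "bisimilar H K" and H: "start H = r" "kind_of H = kind" "edge H = (\<lambda>x y. y \<in> succ x)"
    "odd_path H = (\<lambda>\<pi>. odd (Max {k. \<exists>\<^sub>\<infinity>n. \<Omega> (\<pi> n) = k}))"
  shows "bisimilar (core T) K"
proof (rule bisimilar_via_map[where I = core_at and f = "\<lambda>u. last (hist_at u)", OF assms(1)])
  show "core_at (start (core T))" "last (hist_at (start (core T))) = start H"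
    using core_at_start H by (simp_all add: core_def)
  show "kind_of (core T) u = kind_of H (last (hist_at u))" if "core_at u" for u
    using that entering_kind[OF _ core_at_node[OF that]] H unfolding core_at_def
    by (auto simp: core_def)
  show "core_at v \<and> edge H (last (hist_at u)) (last (hist_at v))"
    if "core_at u" "edge (core T) u v" for u v
  proof -
    have "core_edge T u v" using that(2) by (simp add: core_def)
    from core_edge_segment[OF that(1) this] show ?thesis using H unfolding segment_def by auto
  qed
  show "\<exists>v. edge (core T) u v \<and> last (hist_at v) = w"
    if u: "core_at u" and w: "edge H (last (hist_at u)) w" for u w
  proof -
    have "w \<in> succ (last (hist_at u))" using w H by simp
    from core_edge_exists[OF u this] obtain v
      where "core_edge T u v" "hist_at v = next_hist (hist_at u) w" by blast
    then show ?thesis by (intro exI[of _ v]) (simp add: core_def)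
  qed
  show "odd_path (core T) \<pi> \<longleftrightarrow> odd_path H ((\<lambda>u. last (hist_at u)) \<circ> \<pi>)"
    if "infinite_path (core T) \<pi>" for \<pi>
    using odd_path_core[OF that] H by simp
qed

end

section \<open>The tree of histories\<close>

context core_like_graph
begin

text \<open>Vertices are the variables instead of the histories themselves: a priority assignment of
  \<Phi> is then literally a priority map of the tree, and the vertices are natural numbers as in
  \<open>least_codomain\<close>.\<close>

definition hist_tree :: "(nat, 'p) back_tree" where
  "hist_tree = \<lparr> vertices = var ` hists, root = var [r],
     tree_edges = {(var h, var (h @ [w])) | h w. h \<in> hists \<and> w \<in> succ (last h) \<and> \<not> loops h w},
     back_edges = {(var h, var (next_hist h w)) | h w. h \<in> hists \<and> w \<in> succ (last h) \<and> loops h w},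
     vertex_kind = (\<lambda>x. kind (last (inv_into hists var x))) \<rparr>"

lemma hist_tree_ancestor:
  "h \<in> hists \<Longrightarrow> prefix g h \<Longrightarrow> g \<noteq> [] \<Longrightarrow> (var g, var h) \<in> (tree_edges hist_tree)\<^sup>*"
proof (induction rule: hists.induct)
  case root
  then show ?case by (auto simp: prefix_Cons)
next
  case (ext h w)
  show ?case
  proof (cases "g = h @ [w]")
    case False
    then have "(var g, var h) \<in> (tree_edges hist_tree)\<^sup>*" using ext by simp
    moreover have "(var h, var (h @ [w])) \<in> tree_edges hist_tree"
      using ext.hyps by (auto simp: hist_tree_def)
    ultimately show ?thesis by (rule rtrancl_into_rtrancl)
  qed simp
qed

lemma is_back_tree_hist_tree: "is_back_tree hist_tree"
  unfolding is_back_tree_def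
proof (intro conjI)
  show "finite (vertices hist_tree)" using finite_hists by (simp add: hist_tree_def)
  show "root hist_tree \<in> vertices hist_tree" using hists.root by (simp add: hist_tree_def)
  show "tree_edges hist_tree \<subseteq> vertices hist_tree \<times> vertices hist_tree"
    by (auto simp: hist_tree_def intro: hists.ext)
  show "back_edges hist_tree \<subseteq> vertices hist_tree \<times> vertices hist_tree"
    by (auto simp: hist_tree_def intro: next_hist_in)
  show "\<forall>v\<in>vertices hist_tree. (root hist_tree, v) \<in> (tree_edges hist_tree)\<^sup>*"
    using hist_tree_ancestor root_prefix by (auto simp: hist_tree_def)
  show "\<forall>(v, u)\<in>back_edges hist_tree. (u, v) \<in> (tree_edges hist_tree)\<^sup>*"
  proof
    fix e assume "e \<in> back_edges hist_tree"
    then obtain h w where e: "e = (var h, var (next_hist h w))" "h \<in> hists" "loops h w"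
      by (auto simp: hist_tree_def)
    then show "case e of (v, u) \<Rightarrow> (u, v) \<in> (tree_edges hist_tree)\<^sup>*"
      using hist_tree_ancestor[OF e(2)] loops_to_prefix[OF next_hist_loops[OF e(3)]] by simp
  qed
  show "\<forall>v. (v, root hist_tree) \<notin> tree_edges hist_tree"
  proof (rule allI notI)+
    fix v assume "(v, root hist_tree) \<in> tree_edges hist_tree"
    then obtain h w where h: "h \<in> hists" "w \<in> succ (last h)" "\<not> loops h w" "var [r] = var (h @ [w])"
      by (auto simp: hist_tree_def)
    then have "[r] = h @ [w]" using var_eq[OF hists.root hists.ext] by blast
    then show False using hists_not_Nil[OF h(1)] by (simp add: Cons_eq_append_conv)
  qed
  show "\<forall>u u' v. (u, v) \<in> tree_edges hist_tree \<longrightarrow> (u', v) \<in> tree_edges hist_tree \<longrightarrow> u = u'"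
  proof (intro allI impI)
    fix u u' v assume "(u, v) \<in> tree_edges hist_tree" "(u', v) \<in> tree_edges hist_tree"
    then obtain h w h' w' where h: "u = var h" "h \<in> hists" "w \<in> succ (last h)" "\<not> loops h w" "v = var (h @ [w])"
      and h': "u' = var h'" "h' \<in> hists" "w' \<in> succ (last h')" "\<not> loops h' w'" "v = var (h' @ [w'])"
      by (auto simp: hist_tree_def)
    then have "h @ [w] = h' @ [w']" using var_eq[OF hists.ext hists.ext] by metis
    then show "u = u'" using h h' by simp
  qed
qed

lemma hist_tree_priorities:
  "priority_assignment \<Phi> \<Omega>' n \<Longrightarrow> \<Omega>' ` vertices hist_tree \<subseteq> {0..n}"
  unfolding priority_assignment_def bound_vars_\<Phi> hist_tree_def by auto

lemma hist_tree_edge: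
  "h \<in> hists \<Longrightarrow> (var h, y) \<in> tree_edges hist_tree \<union> back_edges hist_tree \<longleftrightarrow>
     (\<exists>w\<in>succ (last h). y = var (next_hist h w))"
proof
  assume h: "h \<in> hists" and "(var h, y) \<in> tree_edges hist_tree \<union> back_edges hist_tree"
  then obtain h' w where "h' \<in> hists" "var h' = var h" "w \<in> succ (last h')" "y = var (next_hist h' w)"
    by (auto simp: hist_tree_def next_hist_new)
  then show "\<exists>w\<in>succ (last h). y = var (next_hist h w)" using var_eq h by metis
next
  assume h: "h \<in> hists" and "\<exists>w\<in>succ (last h). y = var (next_hist h w)"
  then obtain w where w: "w \<in> succ (last h)" "y = var (next_hist h w)" by blast
  then show "(var h, y) \<in> tree_edges hist_tree \<union> back_edges hist_tree"
    using h by (cases "loops h w") (auto simp: hist_tree_def next_hist_new)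
qed

text \<open>The priorities \<open>\<Omega>'\<close> are unrelated to \<Omega> in value;
  \<open>odd_Max_assignment\<close> makes the parities of the infinite paths agree.\<close>

lemma hist_tree_bisimilar:
  assumes pa: "priority_assignment \<Phi> \<Omega>' n" and "bisimilar H K"
    and H: "start H = r" "kind_of H = kind" "edge H = (\<lambda>x y. y \<in> succ x)"
    "odd_path H = (\<lambda>\<pi>. odd (Max {k. \<exists>\<^sub>\<infinity>n. \<Omega> (\<pi> n) = k}))"
  shows "bisimilar (back_tree_graph hist_tree \<Omega>') K"
proof -
  let ?G = "back_tree_graph hist_tree \<Omega>'" and ?d = "inv_into hists var"
  have d: "?d (var h) = h" if "h \<in> hists" for h using inv_into_f_f[OF var(1) that] .
  have edge: "edge ?G (var h) y \<longleftrightarrow> (\<exists>w\<in>succ (last h). y = var (next_hist h w))" if "h \<in> hists" for h y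
    using hist_tree_edge[OF that] by (simp add: back_tree_graph_def)
  show ?thesis
  proof (rule bisimilar_via_map[where I = "\<lambda>x. x \<in> var ` hists" and f = "\<lambda>x. last (?d x)", OF assms(2)])
    show "start ?G \<in> var ` hists" "last (?d (start ?G)) = start H"
      using hists.root H d[OF hists.root] by (simp_all add: back_tree_graph_def hist_tree_def)
    show "kind_of ?G x = kind_of H (last (?d x))" for x
      using H by (simp add: back_tree_graph_def hist_tree_def)
    show "y \<in> var ` hists \<and> edge H (last (?d x)) (last (?d y))" if x: "x \<in> var ` hists" and xy: "edge ?G x y" for x y
    proof -
      obtain h where h: "h \<in> hists" "x = var h" using x by blast
      then obtain w where w: "w \<in> succ (last h)" "y = var (next_hist h w)" using xy edge by blast
      then show ?thesis using h d next_hist_in[OF h(1) w(1)] H by simp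
    qed
    show "\<exists>y. edge ?G x y \<and> last (?d y) = w" if x: "x \<in> var ` hists" and xw: "edge H (last (?d x)) w" for x w
    proof -
      obtain h where h: "h \<in> hists" "x = var h" using x by blast
      then have w: "w \<in> succ (last h)" using xw d H by simp
      then show ?thesis using h d[OF next_hist_in[OF h(1) w]] edge[OF h(1)]
        by (intro exI[of _ "var (next_hist h w)"]) auto
    qed
    show "odd_path ?G \<pi> \<longleftrightarrow> odd_path H ((\<lambda>x. last (?d x)) \<circ> \<pi>)"
      if \<pi>: "infinite_path ?G \<pi>" "\<And>n. \<pi> n \<in> var ` hists" for \<pi>
    proof -
      define \<rho> where "\<rho> n = ?d (\<pi> n)" for n
      have \<rho>: "\<rho> n \<in> hists" "\<pi> n = var (\<rho> n)" for n
        using \<pi>(2)[of n] d unfolding \<rho>_def by auto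
      have "hist_path \<rho>" unfolding hist_path_def
      proof (intro allI conjI)
        fix n
        show "\<rho> n \<in> hists" by (rule \<rho>)
        have "edge ?G (var (\<rho> n)) (var (\<rho> (Suc n)))" using \<pi>(1) \<rho>(2) unfolding infinite_path_def by metis
        then obtain w where w: "w \<in> succ (last (\<rho> n))" "var (\<rho> (Suc n)) = var (next_hist (\<rho> n) w)"
          using edge[OF \<rho>(1)] by blast
        then show "\<exists>w\<in>succ (last (\<rho> n)). \<rho> (Suc n) = next_hist (\<rho> n) w"
          using var_eq[OF \<rho>(1) next_hist_in[OF \<rho>(1)]] by blast
      qed
      note odd_Max_assignment[OF this pa]
      moreover have "odd_path ?G \<pi> \<longleftrightarrow> odd (Max {k. \<exists>\<^sub>\<infinity>n. \<Omega>' (var (\<rho> n)) = k})"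
        by (simp add: back_tree_graph_def flip: \<rho>(2))
      moreover have "odd_path H ((\<lambda>x. last (?d x)) \<circ> \<pi>) \<longleftrightarrow>
          odd (Max {k. \<exists>\<^sub>\<infinity>n. \<Omega> (last (\<rho> n)) = k})"
        using H by (simp add: \<rho>_def)
      ultimately show ?thesis by simp
    qed
  qed
qed

end

theorem theorem2:
  fixes \<Psi> :: "'p fm" and T :: "'p tableau"
    and A :: "('a, 'p) back_tree" and \<Omega> :: "'a \<Rightarrow> nat" and q :: nat
  assumes "sentence \<Psi>" and "tableau_of \<Psi> T"
    and "represents A \<Omega> q T"
  shows "\<exists>\<Phi> :: 'p fm.
    sentence \<Phi> \<and> disjunctive \<Phi> \<and>
    (\<exists>\<Omega>'. priority_assignment \<Phi> \<Omega>' q) \<and>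
    (least_codomain T q \<longrightarrow> alternation_depth \<Phi> = q) \<and>
    (\<exists>T'. tableau_of \<Phi> T') \<and>
    (\<forall>T'. tableau_of \<Phi> T' \<longrightarrow> tableau_equivalent T' T)"
proof -
  let ?succ = "\<lambda>x. {y. (x, y) \<in> tree_edges A \<union> back_edges A}"
  interpret core_like_graph "vertices A" ?succ "vertex_kind A" \<Omega> "root A" q
    using represents_core_like[OF assms] .
  have bis: "bisimilar (back_tree_graph A \<Omega>) (core T)" using assms(3) unfolding represents_def by simp
  have graph: "start (back_tree_graph A \<Omega>) = root A" "kind_of (back_tree_graph A \<Omega>) = vertex_kind A"
    "edge (back_tree_graph A \<Omega>) = (\<lambda>x y. y \<in> ?succ x)"
    "odd_path (back_tree_graph A \<Omega>) = (\<lambda>\<pi>. odd (Max {k. \<exists>\<^sub>\<infinity>n. \<Omega> (\<pi> n) = k}))"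
    by (simp_all add: back_tree_graph_def)
  show ?thesis
  proof (intro exI[of _ \<Phi>] conjI allI impI)
    show "sentence \<Phi>" "disjunctive \<Phi>" by (rule sentence_\<Phi> disjunctive_\<Phi>)+
    show "\<exists>\<Omega>'. priority_assignment \<Phi> \<Omega>' q" using priority_assignment_\<Phi> by blast
    show "\<exists>T'. tableau_of \<Phi> T'" using tableau_exists[of \<Phi>] sentence_\<Phi> unfolding sentence_def by blast
    show "tableau_equivalent T' T" if "tableau_of \<Phi> T'" for T'
    proof -
      interpret core_like_tableau "vertices A" ?succ "vertex_kind A" \<Omega> "root A" q T'
        using that by unfold_locales
      show ?thesis unfolding tableau_equivalent_def using core_bisimilar[OF bis graph] .
    qed
    assume least: "least_codomain T q"
    show "alternation_depth \<Phi> = q" unfolding alternation_depth_def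
    proof (rule Least_equality)
      show "\<exists>\<Omega>'. priority_assignment \<Phi> \<Omega>' q" using priority_assignment_\<Phi> by blast
      fix n assume "\<exists>\<Omega>'. priority_assignment \<Phi> \<Omega>' n"
      then obtain \<Omega>' where pa: "priority_assignment \<Phi> \<Omega>' n" by blast
      \<comment> \<open>A priority assignment of \<Phi> with co-domain up to \<open>n\<close> thus
        competes with \<open>q\<close> in the minimality condition on \<open>T\<close>.\<close>
      have "represents hist_tree \<Omega>' n T"
        unfolding represents_def using is_back_tree_hist_tree hist_tree_priorities[OF pa]
          hist_tree_bisimilar[OF pa bis graph] by blast
      then show "q \<le> n" using least unfolding least_codomain_def by blast
    qed
  qed
qed

end
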